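(* Let $n\ge1$ and $1\le p\le\infty$. Then there is a bounded embedding $$S_p^1(\mathbb{R}^n)\hookrightarrow C^{0,1-\frac1p}(\mathbb{R}^n)$$ (with $1-\frac1p=1$ if $p=\infty$). Moreover, the equivalence class of every $u\in S_p^1(\mathbb{R}^n)$ has a representative in $C^{0,1-\frac1p}(\mathbb{R}^n)$ (again denoted $u$) which satisfies, for all $x,x'\in\mathbb{R}^n$ with $x_i<x'_i$, $i=1,\dots,n$, and with $P\subset\mathbb{R}^n$ the $n$-rectangle with bottom corner $x$ and top corner $x'$, the generalized Newton-Leibniz formula $$u(x')-u(x)=\sum_{k=1}^n\ \sum_{1\le i_1<\dots<i_k\le n}\ \int_{P_{i_1\dots i_k}}\frac{\partial^k u(\eta)}{\partial x_{i_1}\cdots\partial x_{i_k}}\,d\eta_{i_1}\cdots d\eta_{i_k}.$$ In particular, for all $k=1,\dots,n-1$ and all $1\le i_1<\dots<i_k\le n$, $$\frac{\partial^k u}{\partial x_{i_1}\cdots\partial x_{i_k}}\in L_p(P_{i_1\dots i_k})$$ in the sense of traces.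
   Context: **Space $S_p^1(\mathbb{R}^n)$.** For $1\le p\le\infty$, $S_p^1(\mathbb{R}^n)$ is the space of (equivalence classes of a.e. equal) functions $u\in L_p(\mathbb{R}^n)$ whose weak derivatives $\frac{\partial^k u}{\partial x_{i_1}\cdots\partial x_{i_k}}$ belong to $L_p(\mathbb{R}^n)$ for all $k=1,\dots,n$ and all $1\le i_1<\dots<i_k\le n$, with norm $$\|u\|_{S_p^1(\mathbb{R}^n)}=\Big(\|u\|_{L_p(\mathbb{R}^n)}^p+\sum_{k=1}^n\sum_{1\le i_1<\dots<i_k\le n}\Big\|\frac{\partial^k u}{\partial x_{i_1}\cdots\partial x_{i_k}}\Big\|_{L_p(\mathbb{R}^n)}^p\Big)^{1/p}\quad (1\le p<\infty),$$ and, for $p=\infty$, the sum of the corresponding $L_\infty(\mathbb{R}^n)$ norms. **Hölder spaces.** $C^0(\mathbb{R}^n)$ is the space of bounded continuous functions with the sup norm. For $0\le\gamma\le1$, $C^{0,\gamma}(\mathbb{R}^n)$ is the space of $u\in C^0(\mathbb{R}^n)$ with finite norm $$\|u\|_{C^{0,\gamma}(\mathbb{R}^n)}=\|u\|_{C^0(\mathbb{R}^n)}+\sup_{y\ne y'}\frac{|u(y)-u(y')|}{|y-y'|^\gamma};$$ $C^{0,0}(\mathbb{R}^n)$ is equivalent to $C^0(\mathbb{R}^n)$. **Embedding.** $B_1\hookrightarrow B_2$ (bounded embedding) means $B_1\subset B_2$ (every equivalence class in $B_1$ has a representative in $B_2$) and there is a constant $C$ with $\|u\|_{B_2}\le C\|u\|_{B_1}$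 for all $u\in B_1$. **Rectangles.** The $n$-rectangle with bottom corner $x$ and top corner $x'$ is $P=\{\eta\in\mathbb{R}^n: x_i\le\eta_i\le x_i',\ i=1,\dots,n\}$. For $\{i_1,\dots,i_k\}\subset\{1,\dots,n\}$, $P_{i_1\dots i_k}=P\cap\{\eta:\eta_l=x_l\text{ for all }l\notin\{i_1,\dots,i_k\}\}$, a $k$-dimensional face of $P$ through $x$ (equal to $P$ if $k=n$), equipped with $k$-dimensional Lebesgue measure $d\eta_{i_1}\cdots d\eta_{i_k}$. **Traces.** For $k<n$, the value of $\frac{\partial^k u}{\partial x_{i_1}\cdots\partial x_{i_k}}$ on the lower-dimensional set $P_{i_1\dots i_k}$, both in the formula and in the membership statement, is understood in the sense of traces: it is the limit, as $\epsilon\to0$, of the restrictions to $P_{i_1\dots i_k}$ of $\frac{\partial^k u^\epsilon}{\partial x_{i_1}\cdots\partial x_{i_k}}$, where $u^\epsilon=u*\phi^\epsilon$ is the mollification of $u$ with a standard rescaled mollifier $\phi^\epsilon$; the limit is taken in $L_p(P_{i_1\dots i_k})$ if $p<\infty$, and in $L_q(P_{i_1\dots i_k})$ for all $1<q<\infty$ if $p=\infty$ (the membership statement then asserting that this limit lies in $L_\infty(P_{i_1\dots i_k})$). For $k=n$ the weak derivative is an ordinary $L_p$ function on $P$. *)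

theory Defs
  imports "HOL-Probability.Essential_Supremum"
begin

text \<open>
  Points of the $n$-dimensional space have type \<open>real^'n\<close>, with $n$ = \<open>CARD('n)\<close>; the synonym
  is needed since the notation \<open>real^'n\<close> forces the sort \<open>finite\<close> on \<open>'n\<close>. The linear order on
  \<open>'n\<close> is the order $1 < \dots < n$ of the coordinates, so that a multi-index
  $i_1 < \dots < i_k$ is given by the set $I = \{i_1,\dots,i_k\}$. An equivalence class of
  functions equal a.e. is given by any of its members.
\<close>
type_synonym 'n euclid = "(real, 'n) vec"

section \<open>Lebesgue spaces\<close>

definition Lp_space :: "ennreal \<Rightarrow> 'a measure \<Rightarrow> ('a \<Rightarrow> real) set" where
  "Lp_space p M = {f \<in> borel_measurable M.
     if p = \<infinity> then esssup M (\<lambda>x. ennreal \<bar>f x\<bar>) < \<infinity>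
     else integrable M (\<lambda>x. \<bar>f x\<bar> powr enn2real p)}"

definition Lp_norm :: "ennreal \<Rightarrow> 'a measure \<Rightarrow> ('a \<Rightarrow> real) \<Rightarrow> real" where
  "Lp_norm p M f =
     (if p = \<infinity> then enn2real (esssup M (\<lambda>x. ennreal \<bar>f x\<bar>))
      else (LINT x|M. \<bar>f x\<bar> powr enn2real p) powr (1 / enn2real p))"

definition tendsto_Lp ::
    "ennreal \<Rightarrow> 'a measure \<Rightarrow> ('b \<Rightarrow> 'a \<Rightarrow> real) \<Rightarrow> ('a \<Rightarrow> real) \<Rightarrow> 'b filter \<Rightarrow> bool" where
  "tendsto_Lp p M f g F \<longleftrightarrow>
     (\<forall>\<^sub>F e in F. f e \<in> Lp_space p M) \<and> g \<in> Lp_space p M \<and>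
     ((\<lambda>e. Lp_norm p M (\<lambda>x. f e x - g x)) \<longlongrightarrow> 0) F"

section \<open>Classical and weak mixed derivatives\<close>

definition partial_deriv :: "'n \<Rightarrow> (('n::finite) euclid \<Rightarrow> real) \<Rightarrow> 'n euclid \<Rightarrow> real" where
  "partial_deriv i f x = deriv (\<lambda>t. f (x + t *\<^sub>R axis i 1)) 0"

definition partial_derivs :: "'n list \<Rightarrow> (('n::finite) euclid \<Rightarrow> real) \<Rightarrow> 'n euclid \<Rightarrow> real" where
  "partial_derivs is f = foldr partial_deriv is f"

definition mixed_deriv :: "'n::{finite,linorder} set \<Rightarrow> ('n euclid \<Rightarrow> real) \<Rightarrow> 'n euclid \<Rightarrow> real" where
  "mixed_deriv I f = partial_derivs (sorted_list_of_set I) f"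

text \<open>
  Differentiability of all iterated partial derivatives makes all of them continuous, so
  this is $C^\infty$.
\<close>
definition smooth :: "(('n::finite) euclid \<Rightarrow> real) \<Rightarrow> bool" where
  "smooth f \<longleftrightarrow> (\<forall>is x. partial_derivs is f differentiable (at x))"

definition test_function :: "(('n::finite) euclid \<Rightarrow> real) \<Rightarrow> bool" where
  "test_function \<phi> \<longleftrightarrow> smooth \<phi> \<and> compact (closure {x. \<phi> x \<noteq> 0})"

definition locally_integrable :: "(('n::finite) euclid \<Rightarrow> real) \<Rightarrow> bool" where
  "locally_integrable f \<longleftrightarrow> (\<forall>K. compact K \<longrightarrow> set_integrable lebesgue K f)"

definition has_weak_deriv ::
    "'n::{finite,linorder} set \<Rightarrow> ('n euclid \<Rightarrow> real) \<Rightarrow> ('n euclid \<Rightarrow> real) \<Rightarrow> bool" where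
  "has_weak_deriv I u g \<longleftrightarrow> locally_integrable u \<and> locally_integrable g \<and>
     (\<forall>\<phi>. test_function \<phi> \<longrightarrow>
        (LINT x|lebesgue. u x * mixed_deriv I \<phi> x) =
        (- 1) ^ card I * (LINT x|lebesgue. g x * \<phi> x))"

text \<open>If a weak derivative exists, this is one, and it is unique up to a.e. equality.\<close>
definition weak_deriv :: "'n::{finite,linorder} set \<Rightarrow> ('n euclid \<Rightarrow> real) \<Rightarrow> 'n euclid \<Rightarrow> real" where
  "weak_deriv I u = (SOME g. has_weak_deriv I u g)"

section \<open>The function spaces\<close>

definition S1_space :: "ennreal \<Rightarrow> (('n::{finite,linorder}) euclid \<Rightarrow> real) set" where
  "S1_space p = {u \<in> Lp_space p lebesgue.
     \<forall>I. I \<noteq> {} \<longrightarrow> (\<exists>g. has_weak_deriv I u g \<and> g \<in> Lp_space p lebesgue)}"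

definition S1_norm :: "ennreal \<Rightarrow> (('n::{finite,linorder}) euclid \<Rightarrow> real) \<Rightarrow> real" where
  "S1_norm p u =
     (if p = \<infinity> then
        Lp_norm p lebesgue u +
        (\<Sum>k=1..CARD('n). \<Sum>I | card I = k. Lp_norm p lebesgue (weak_deriv I u))
      else
        (Lp_norm p lebesgue u powr enn2real p +
         (\<Sum>k=1..CARD('n). \<Sum>I | card I = k.
            Lp_norm p lebesgue (weak_deriv I u) powr enn2real p)) powr (1 / enn2real p))"

definition hoelder_space :: "real \<Rightarrow> (('n::finite) euclid \<Rightarrow> real) set" where
  "hoelder_space \<gamma> = {u \<in> bcontfun.
     bdd_above ((\<lambda>(y, y'). \<bar>u y - u y'\<bar> / norm (y - y') powr \<gamma>) ` {(y, y'). y \<noteq> y'})}"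

definition hoelder_norm :: "real \<Rightarrow> (('n::finite) euclid \<Rightarrow> real) \<Rightarrow> real" where
  "hoelder_norm \<gamma> u =
     (SUP y. \<bar>u y\<bar>) + (SUP (y, y')\<in>{(y, y'). y \<noteq> y'}. \<bar>u y - u y'\<bar> / norm (y - y') powr \<gamma>)"

definition hoelder_exponent :: "ennreal \<Rightarrow> real" where
  "hoelder_exponent p = (if p = \<infinity> then 1 else 1 - 1 / enn2real p)"

text \<open>The members of \<open>B1\<close> stand for their a.e. classes, the members of \<open>B2\<close> for themselves.\<close>
definition bounded_embedding ::
    "(('n::finite) euclid \<Rightarrow> real) set \<Rightarrow> (('n euclid \<Rightarrow> real) \<Rightarrow> real) \<Rightarrow>
     ('n euclid \<Rightarrow> real) set \<Rightarrow> (('n euclid \<Rightarrow> real) \<Rightarrow> real) \<Rightarrow> bool" where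
  "bounded_embedding B1 norm1 B2 norm2 \<longleftrightarrow>
     (\<forall>u\<in>B1. \<exists>v\<in>B2. AE x in lebesgue. v x = u x) \<and>
     (\<exists>C. \<forall>u\<in>B1. \<forall>v\<in>B2. (AE x in lebesgue. v x = u x) \<longrightarrow> norm2 v \<le> C * norm1 u)"

section \<open>Faces of rectangles and traces\<close>

definition face :: "'n set \<Rightarrow> ('n::finite) euclid \<Rightarrow> 'n euclid \<Rightarrow> ('n euclid) set" where
  "face I x x' = {\<eta>. (\<forall>i. x $ i \<le> \<eta> $ i \<and> \<eta> $ i \<le> x' $ i) \<and> (\<forall>l. l \<notin> I \<longrightarrow> \<eta> $ l = x $ l)}"

text \<open>
  The Lebesgue measure in the coordinates \<open>I\<close>, transported to the affine subspace through \<open>x\<close>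
  spanned by these coordinates, completed, and restricted to the face.
\<close>
definition face_measure :: "'n set \<Rightarrow> ('n::finite) euclid \<Rightarrow> 'n euclid \<Rightarrow> ('n euclid) measure" where
  "face_measure I x x' = restrict_space
     (completion (distr (\<Pi>\<^sub>M i\<in>I. lborel) borel (\<lambda>s. \<chi> i. if i \<in> I then s i else x $ i)))
     (face I x x')"

definition mollifier :: "(('n::finite) euclid \<Rightarrow> real) \<Rightarrow> bool" where
  "mollifier \<phi> \<longleftrightarrow> smooth \<phi> \<and> (\<forall>x. \<phi> x \<ge> 0) \<and> closure {x. \<phi> x \<noteq> 0} \<subseteq> cball 0 1 \<and>
     (LINT x|lebesgue. \<phi> x) = 1"

definition mollify ::
    "(('n::finite) euclid \<Rightarrow> real) \<Rightarrow> real \<Rightarrow> ('n euclid \<Rightarrow> real) \<Rightarrow> 'n euclid \<Rightarrow> real" where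
  "mollify \<phi> \<epsilon> u x = (LINT y|lebesgue. u y * (\<phi> ((x - y) /\<^sub>R \<epsilon>) / \<epsilon> ^ CARD('n)))"

definition is_trace :: "ennreal \<Rightarrow> 'n::{finite,linorder} set \<Rightarrow> ('n euclid \<Rightarrow> real) \<Rightarrow>
    'n euclid \<Rightarrow> 'n euclid \<Rightarrow> ('n euclid \<Rightarrow> real) \<Rightarrow> bool" where
  "is_trace p I u x x' g \<longleftrightarrow>
     (\<forall>\<phi>. mollifier \<phi> \<longrightarrow>
        (if p = \<infinity> then
           (\<forall>q. 1 < q \<and> q < \<infinity> \<longrightarrow>
              tendsto_Lp q (face_measure I x x')
                (\<lambda>\<epsilon>. mixed_deriv I (mollify \<phi> \<epsilon> u)) g (at_right 0))
         else
           tendsto_Lp p (face_measure I x x')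
             (\<lambda>\<epsilon>. mixed_deriv I (mollify \<phi> \<epsilon> u)) g (at_right 0)))"

text \<open>\<open>g\<close> is the mixed derivative of \<open>u\<close> on the face: a trace if the face is lower-dimensional,
  and the weak derivative itself on the full rectangle.\<close>
definition is_face_deriv :: "ennreal \<Rightarrow> 'n::{finite,linorder} set \<Rightarrow> ('n euclid \<Rightarrow> real) \<Rightarrow>
    'n euclid \<Rightarrow> 'n euclid \<Rightarrow> ('n euclid \<Rightarrow> real) \<Rightarrow> bool" where
  "is_face_deriv p I u x x' g \<longleftrightarrow>
     (if I = UNIV then AE \<eta> in face_measure I x x'. g \<eta> = weak_deriv I u \<eta>
      else is_trace p I u x x' g)"

end

theory Submission
  imports Defs "HOL-Probability.Infinite_Product_Measure"
begin

text \<open>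
  Everything is derived from one identity. For a $C^1$ function of one variable,
  $f(0) = \int_0^1 (f(t) - (1-t) f'(t))\,dt$. Iterating this over a set \<open>D\<close> of coordinates
  expresses the value of a smooth function at \<open>\<eta>\<close> as a signed sum, over \<open>K \<subseteq> D\<close>, of weighted
  integrals of its mixed derivatives in the directions \<open>K\<close> over the cube spanned at \<open>\<eta>\<close> by the
  directions \<open>D\<close> (\<open>cube_average_mixed_family\<close>). With \<open>D\<close> the complement of \<open>I\<close>, applied to the
  derivative in the directions \<open>I\<close>, the right-hand side is meaningful for a function that merely has
  weak mixed derivatives in \<open>L_p\<close>. It serves as the explicit definition of the trace on all faces in
  the directions \<open>I\<close> (\<open>face_trace\<close>). For \<open>I = {}\<close> it defines the continuous representative, and for
  \<open>I = UNIV\<close> it is the weak derivative itself.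

  That these are indeed the traces rests on one estimate, \<open>face_cube_average_le\<close>: a face in the
  directions \<open>I\<close> and a cube in the complementary directions fill a full-dimensional box, so by
  Jensen's inequality and Tonelli's theorem the \<open>L_q\<close> distance of two averages on the face is at most a
  constant times the \<open>L_q\<close> distances of the averaged functions on that box. The mollified weak
  derivatives are classical mixed derivatives of the mollified function, hence equal to their own
  averages, and they converge locally in \<open>L_q\<close> to the weak derivatives (\<open>mollify_tendsto\<close>). So their
  restrictions to the face converge in \<open>L_q\<close> to \<open>face_trace\<close>, and for \<open>I = {}\<close> the convergence is
  locally uniform. For \<open>p = \<infinity>\<close> this applies to every finite exponent \<open>q\<close>.

  The generalized Newton-Leibniz formula holds for smooth functions by raising one coordinate at a time
  (\<open>newton_leibniz_family\<close>) and passes to the limit (\<open>newton_leibniz_face_trace\<close>). Restricted to a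
  single edge of length \<open>h\<close> and combined with the estimate above, it bounds the increment of the
  continuous representative by the integrals of weak derivatives over a box of volume \<open>h\<close>. Hoelder's
  inequality on that box yields the exponent \<open>1 - 1/p\<close> (\<open>face_trace_edge_le\<close>,
  \<open>cbox_integral_le_pos\<close>).

  The norm is formed with arbitrarily chosen weak derivatives. They are limits of their mollifications,
  which depend on the function only, hence unique almost everywhere (\<open>has_weak_deriv_unique\<close>).
\<close>

section \<open>Smooth functions and their mixed derivatives\<close>

lemma partial_derivs_Nil [simp]: "partial_derivs [] f = f"
  and partial_derivs_Cons [simp]: "partial_derivs (i # is) f = partial_deriv i (partial_derivs is f)"
  by (simp_all add: partial_derivs_def)

lemma partial_derivs_append: "partial_derivs (is @ js) f = partial_derivs is (partial_derivs js f)"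
  by (simp add: partial_derivs_def)

lemma smooth_partial_derivs: "smooth f \<Longrightarrow> smooth (partial_derivs is f)"
  unfolding smooth_def by (metis partial_derivs_append)

lemma smooth_partial_deriv: "smooth f \<Longrightarrow> smooth (partial_deriv i f)"
  using smooth_partial_derivs[of f "[i]"] by simp

lemma smooth_differentiable: "smooth f \<Longrightarrow> f differentiable (at x)"
  unfolding smooth_def by (metis partial_derivs_Nil)

lemma smooth_continuous: "smooth f \<Longrightarrow> continuous_on UNIV f"
  by (meson smooth_differentiable differentiable_imp_continuous_on differentiable_at_withinI
      differentiable_on_def)

text \<open>
  \<open>partial_deriv\<close> differentiates at parameter 0 only; moving the base point along the line gives the
  derivative at every parameter, as the mean value theorem and the fundamental theorem need it.
\<close>
lemma partial_deriv_DERIV: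
  fixes f :: "('n::finite) euclid \<Rightarrow> real"
  assumes "\<And>x. f differentiable (at x)"
  shows "((\<lambda>t. f (x + t *\<^sub>R axis i 1)) has_real_derivative partial_deriv i f (x + t *\<^sub>R axis i 1)) (at t)"
proof -
  have ex: "\<exists>d. ((\<lambda>t. f (y + t *\<^sub>R axis i 1)) has_real_derivative d) (at s)" for y s
  proof -
    have "(\<lambda>t::real. y + t *\<^sub>R axis i 1) differentiable (at s)"
      by (intro derivative_intros)
    then have "f \<circ> (\<lambda>t. y + t *\<^sub>R axis i 1) differentiable (at s)"
      by (intro differentiable_chain_at assms)
    then show ?thesis
      by (auto simp: o_def real_differentiable_def)
  qed
  obtain d where d: "((\<lambda>t. f (x + t *\<^sub>R axis i 1)) has_real_derivative d) (at t)"
    using ex by blast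
  have "((\<lambda>s. f (x + t *\<^sub>R axis i 1 + s *\<^sub>R axis i 1)) has_real_derivative d) (at 0)"
    using d DERIV_shift[of "\<lambda>t. f (x + t *\<^sub>R axis i 1)" d 0 t]
    by (simp add: scaleR_add_left algebra_simps)
  then have "partial_deriv i f (x + t *\<^sub>R axis i 1) = d"
    unfolding partial_deriv_def by (rule DERIV_imp_deriv)
  with d show ?thesis by simp
qed

lemmas smooth_DERIV = partial_deriv_DERIV[OF smooth_differentiable]

lemma partial_deriv_eqI:
  "((\<lambda>t. f (x + t *\<^sub>R axis i 1)) has_real_derivative d) (at 0) \<Longrightarrow> partial_deriv i f x = d"
  unfolding partial_deriv_def by (rule DERIV_imp_deriv)

text \<open>
  The mean value theorem, first in direction \<open>i\<close> for the increment in direction \<open>j\<close>, then in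
  direction \<open>j\<close>. The second difference on the left is symmetric in \<open>i\<close> and \<open>j\<close>.
\<close>
lemma mixed_difference_mean_value:
  fixes f :: "('n::finite) euclid \<Rightarrow> real"
  assumes f: "smooth f" and h: "h > 0"
  obtains s t where "0 < s" "s < h" "0 < t" "t < h"
    "f (x + h *\<^sub>R axis i 1 + h *\<^sub>R axis j 1) - f (x + h *\<^sub>R axis i 1) - f (x + h *\<^sub>R axis j 1) + f x
       = h * h * partial_deriv j (partial_deriv i f) (x + s *\<^sub>R axis i 1 + t *\<^sub>R axis j 1)"
proof -
  let ?ei = "axis i 1 :: 'n euclid" and ?ej = "axis j 1 :: 'n euclid"
  let ?d = "\<lambda>s. f (x + h *\<^sub>R ?ej + s *\<^sub>R ?ei) - f (x + s *\<^sub>R ?ei)"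
  have "\<exists>s. 0 < s \<and> s < h \<and> ?d h - ?d 0 = (h - 0) * (partial_deriv i f (x + h *\<^sub>R ?ej + s *\<^sub>R ?ei)
      - partial_deriv i f (x + s *\<^sub>R ?ei))"
    by (rule MVT2[OF h]) (intro derivative_intros smooth_DERIV[OF f])
  then obtain s where s: "0 < s" "s < h" "?d h - ?d 0 = h * (partial_deriv i f (x + h *\<^sub>R ?ej + s *\<^sub>R ?ei)
      - partial_deriv i f (x + s *\<^sub>R ?ei))" by auto
  have "\<exists>t. 0 < t \<and> t < h \<and> partial_deriv i f (x + s *\<^sub>R ?ei + h *\<^sub>R ?ej) - partial_deriv i f (x + s *\<^sub>R ?ei + 0 *\<^sub>R ?ej)
      = (h - 0) * partial_deriv j (partial_deriv i f) (x + s *\<^sub>R ?ei + t *\<^sub>R ?ej)"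
    by (rule MVT2[OF h]) (intro smooth_DERIV smooth_partial_deriv f)
  then obtain t where t: "0 < t" "t < h" "partial_deriv i f (x + s *\<^sub>R ?ei + h *\<^sub>R ?ej) - partial_deriv i f (x + s *\<^sub>R ?ei)
      = h * partial_deriv j (partial_deriv i f) (x + s *\<^sub>R ?ei + t *\<^sub>R ?ej)" by auto
  show thesis
    by (rule that[OF s(1,2) t(1,2)]) (use s(3) t(3) in \<open>simp add: algebra_simps\<close>)
qed

text \<open>
  Both sides are limits of the same symmetric second difference quotient. Commutation matters since
  \<open>mixed_deriv\<close> takes the derivatives in increasing order of the coordinates, while the arguments below
  add coordinates to an index set in arbitrary order.
\<close>
lemma partial_deriv_commute:
  fixes f :: "('n::finite) euclid \<Rightarrow> real"
  assumes f: "smooth f"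
  shows "partial_deriv i (partial_deriv j f) = partial_deriv j (partial_deriv i f)"
proof (rule ext, rule ccontr)
  fix x
  let ?A = "partial_deriv j (partial_deriv i f)" and ?B = "partial_deriv i (partial_deriv j f)"
  let ?ei = "axis i 1 :: 'n euclid" and ?ej = "axis j 1 :: 'n euclid"
  assume ne: "?B x \<noteq> ?A x"
  define e where "e = \<bar>?B x - ?A x\<bar> / 2"
  have e: "e > 0" using ne by (simp add: e_def)
  have cont: "continuous (at x) ?A" "continuous (at x) ?B"
    using smooth_continuous[OF smooth_partial_deriv[OF smooth_partial_deriv[OF f]]]
    by (auto simp: continuous_on_eq_continuous_at)
  obtain d1 where d1: "d1 > 0" "\<And>y. dist y x < d1 \<Longrightarrow> dist (?A y) (?A x) < e"
    using cont(1) e unfolding continuous_at_eps_delta by blast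
  obtain d2 where d2: "d2 > 0" "\<And>y. dist y x < d2 \<Longrightarrow> dist (?B y) (?B x) < e"
    using cont(2) e unfolding continuous_at_eps_delta by blast
  define h where "h = min d1 d2 / 2"
  have h: "h > 0" using d1 d2 by (simp add: h_def)
  have near: "dist (x + s *\<^sub>R axis k 1 + t *\<^sub>R axis l 1) x < min d1 d2"
    if "0 < s" "s < h" "0 < t" "t < h" for s t and k l :: 'n
  proof -
    have "norm (s *\<^sub>R axis k 1 + t *\<^sub>R axis l 1 :: 'n euclid) \<le> s + t"
      using that by (intro norm_triangle_le) simp
    then show ?thesis using that by (simp add: dist_norm h_def add.assoc)
  qed
  obtain s t where A: "0 < s" "s < h" "0 < t" "t < h"
    "f (x + h *\<^sub>R ?ei + h *\<^sub>R ?ej) - f (x + h *\<^sub>R ?ei) - f (x + h *\<^sub>R ?ej) + f x = h * h * ?A (x + s *\<^sub>R ?ei + t *\<^sub>R ?ej)"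
    using mixed_difference_mean_value[OF f h] .
  obtain s' t' where B: "0 < s'" "s' < h" "0 < t'" "t' < h"
    "f (x + h *\<^sub>R ?ej + h *\<^sub>R ?ei) - f (x + h *\<^sub>R ?ej) - f (x + h *\<^sub>R ?ei) + f x = h * h * ?B (x + s' *\<^sub>R ?ej + t' *\<^sub>R ?ei)"
    using mixed_difference_mean_value[OF f h] .
  have "h * h * ?A (x + s *\<^sub>R ?ei + t *\<^sub>R ?ej) = h * h * ?B (x + s' *\<^sub>R ?ej + t' *\<^sub>R ?ei)"
    using A(5) B(5) by (simp add: algebra_simps)
  then have "?A (x + s *\<^sub>R ?ei + t *\<^sub>R ?ej) = ?B (x + s' *\<^sub>R ?ej + t' *\<^sub>R ?ei)" using h by simp
  moreover have "dist (?A (x + s *\<^sub>R ?ei + t *\<^sub>R ?ej)) (?A x) < e"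
    using near[OF A(1-4), of i j] by (intro d1) simp
  moreover have "dist (?B (x + s' *\<^sub>R ?ej + t' *\<^sub>R ?ei)) (?B x) < e"
    using near[OF B(1-4), of j i] by (intro d2) simp
  ultimately show False by (simp add: e_def dist_real_def) argo
qed

lemma partial_derivs_insort:
  "smooth f \<Longrightarrow> partial_derivs (insort i is) f = partial_deriv i (partial_derivs is f)"
  by (induction "is") (simp_all add: partial_deriv_commute[OF smooth_partial_derivs])

lemma mixed_deriv_empty [simp]: "mixed_deriv {} f = f"
  by (simp add: mixed_deriv_def)

lemma mixed_deriv_insert:
  "smooth f \<Longrightarrow> i \<notin> I \<Longrightarrow> mixed_deriv (insert i I) f = partial_deriv i (mixed_deriv I f)"
  by (simp add: mixed_deriv_def partial_derivs_insort sorted_list_of_set_insert)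

text \<open>
  This covers the reflection (\<open>c = -1\<close>), the rescaling and the normalization of test functions.
\<close>
lemma partial_derivs_affine:
  fixes f :: "('n::finite) euclid \<Rightarrow> real"
  assumes f: "smooth f"
  shows "partial_derivs is (\<lambda>y. k * f (c *\<^sub>R y + a)) = (\<lambda>y. k * c ^ length is * partial_derivs is f (c *\<^sub>R y + a))"
proof (induction "is")
  case (Cons i "is")
  show ?case
  proof
    fix x
    have "((\<lambda>s. partial_derivs is f (c *\<^sub>R x + a + s *\<^sub>R axis i 1)) has_real_derivative
        partial_derivs (i # is) f (c *\<^sub>R x + a + (c * 0) *\<^sub>R axis i 1)) (at (c * 0))"
      using smooth_DERIV[OF smooth_partial_derivs[OF f], where t = 0] by simp
    from DERIV_chain2[where f = "\<lambda>s. partial_derivs is f (c *\<^sub>R x + a + s *\<^sub>R axis i 1)" and g = "\<lambda>t. c * t" and x = 0 and Db = c, OF this]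
    have "((\<lambda>t. partial_derivs is f (c *\<^sub>R x + a + (c * t) *\<^sub>R axis i 1)) has_real_derivative
        partial_derivs (i # is) f (c *\<^sub>R x + a) * c) (at 0)"
      by (auto intro!: derivative_eq_intros)
    then have "((\<lambda>t. k * c ^ length is * partial_derivs is f (c *\<^sub>R (x + t *\<^sub>R axis i 1) + a)) has_real_derivative
        k * c ^ length is * (partial_derivs (i # is) f (c *\<^sub>R x + a) * c)) (at 0)"
      by (intro DERIV_cmult) (simp add: algebra_simps)
    then show "partial_derivs (i # is) (\<lambda>y. k * f (c *\<^sub>R y + a)) x
        = k * c ^ length (i # is) * partial_derivs (i # is) f (c *\<^sub>R x + a)"
      by (simp add: Cons partial_deriv_eqI mult_ac)
  qed
qed simp

lemma smooth_affine:
  fixes f :: "('n::finite) euclid \<Rightarrow> real"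
  assumes f: "smooth f"
  shows "smooth (\<lambda>y. k * f (c *\<^sub>R y + a))"
  unfolding smooth_def partial_derivs_affine[OF f]
proof (intro allI)
  fix "is" x
  have "(\<lambda>y. c *\<^sub>R y + a) differentiable (at x)" by (intro derivative_intros)
  from differentiable_chain_at[OF this, of "partial_derivs is f"]
  have "(\<lambda>y. partial_derivs is f (c *\<^sub>R y + a)) differentiable (at x)"
    by (simp add: o_def smooth_differentiable smooth_partial_derivs f)
  then show "(\<lambda>y. k * c ^ length is * partial_derivs is f (c *\<^sub>R y + a)) differentiable (at x)"
    by (intro derivative_intros)
qed

lemma mixed_deriv_affine:
  "smooth f \<Longrightarrow> mixed_deriv I (\<lambda>y. k * f (c *\<^sub>R y + a)) = (\<lambda>y. k * c ^ card I * mixed_deriv I f (c *\<^sub>R y + a))"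
  by (simp add: mixed_deriv_def partial_derivs_affine)

text \<open>
  Off the closed set \<open>S\<close> the function vanishes in a whole neighbourhood, so its derivatives vanish
  there as well.
\<close>
lemma partial_derivs_support:
  fixes f :: "('n::finite) euclid \<Rightarrow> real"
  assumes "closed S" "\<And>x. x \<notin> S \<Longrightarrow> f x = 0" "x \<notin> S"
  shows "partial_derivs is f x = 0"
  using assms(3)
proof (induction "is" arbitrary: x)
  case (Cons i "is")
  have "((\<lambda>t. x + t *\<^sub>R axis i 1) \<longlongrightarrow> x + 0 *\<^sub>R axis i 1) (nhds 0)"
    by (intro tendsto_intros) (simp add: filterlim_ident)
  then have "\<forall>\<^sub>F t in nhds 0. x + t *\<^sub>R axis i 1 \<in> - S"
    using assms(1) Cons.prems by (intro topological_tendstoD) auto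
  then have "\<forall>\<^sub>F t in nhds 0. partial_derivs is f (x + t *\<^sub>R axis i 1) = 0"
    by eventually_elim (simp add: Cons.IH)
  then have "((\<lambda>t. partial_derivs is f (x + t *\<^sub>R axis i 1)) has_real_derivative 0) (at 0)"
    by (subst DERIV_cong_ev[OF refl _ refl, where g = "\<lambda>t. 0"]) auto
  then show ?case by (simp add: partial_deriv_eqI)
qed (use assms in simp)

section \<open>Existence of a mollifier\<close>

text \<open>
  The factor \<open>poly P (1 / t)\<close> makes this class, which contains $e^{-1/t}$ extended by 0, closed under
  differentiation.
\<close>
definition flat_exp :: "real poly \<Rightarrow> real \<Rightarrow> real" where
  "flat_exp P t = (if t > 0 then poly P (1 / t) * exp (- 1 / t) else 0)"

lemma poly_exp_decay: "((\<lambda>s. poly P s * exp (- s)) \<longlongrightarrow> 0) (at_top :: real filter)"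
proof -
  have "((\<lambda>s. \<Sum>i\<le>degree P. coeff P i * (s ^ i / exp s)) \<longlongrightarrow> (\<Sum>i\<le>degree P. coeff P i * 0)) at_top"
    by (intro tendsto_intros tendsto_power_div_exp_0)
  then show ?thesis
    by (simp add: poly_altdef sum_distrib_right exp_minus divide_inverse mult.assoc)
qed

lemma flat_exp_at_right: "(flat_exp P \<longlongrightarrow> 0) (at_right 0)"
proof -
  have "((\<lambda>t. poly P (1 / t) * exp (- (1 / t))) \<longlongrightarrow> 0) (at_right 0)"
    using filterlim_compose[OF poly_exp_decay filterlim_inverse_at_top_right] by (simp add: field_simps)
  then show ?thesis
    by (rule Lim_transform_eventually)
      (auto simp: flat_exp_def eventually_at_right_less intro!: eventually_mono[OF eventually_at_right_less])
qed

text \<open>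
  For \<open>t > 0\<close> the derivative of $P(1/t)e^{-1/t}$ is $t^{-2}(P - P')(1/t)e^{-1/t}$. At 0 the right
  difference quotient is \<open>flat_exp\<close> of \<open>X * P\<close>, which tends to 0 by \<open>flat_exp_at_right\<close>.
\<close>
lemma flat_exp_DERIV:
  "(flat_exp P has_real_derivative flat_exp ([:0, 0, 1:] * (P - pderiv P)) t) (at t)"
proof -
  consider "t > 0" | "t < 0" | "t = 0" by linarith
  then show ?thesis
  proof cases
    case 1
    have "((\<lambda>t. poly P (1 / t) * exp (- 1 / t)) has_real_derivative
        flat_exp ([:0, 0, 1:] * (P - pderiv P)) t) (at t)"
      using 1 by (auto intro!: derivative_eq_intros DERIV_chain2[OF poly_DERIV]
          simp: flat_exp_def field_simps power2_eq_square)
    moreover have "\<forall>\<^sub>F s in nhds t. s > 0"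
      using 1 by (intro eventually_nhds_in_open[of "{0<..}", simplified]) auto
    ultimately show ?thesis
      by (subst DERIV_cong_ev[OF refl _ refl, where g = "\<lambda>t. poly P (1 / t) * exp (- 1 / t)"])
        (auto simp: flat_exp_def elim!: eventually_mono)
  next
    case 2
    then have "\<forall>\<^sub>F s in nhds t. s < 0"
      by (intro eventually_nhds_in_open[of "{..<0}", simplified]) auto
    then show ?thesis using 2
      by (subst DERIV_cong_ev[OF refl _ refl, where g = "\<lambda>t. 0"])
        (auto simp: flat_exp_def elim!: eventually_mono)
  next
    case 3
    have "((\<lambda>h. flat_exp P h / h) \<longlongrightarrow> 0) (at_right 0)"
      using flat_exp_at_right[of "[:0, 1:] * P"]
      by (rule Lim_transform_eventually)
        (auto simp: flat_exp_def intro!: eventually_mono[OF eventually_at_right_less])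
    moreover have "((\<lambda>h. flat_exp P h / h) \<longlongrightarrow> 0) (at_left 0)"
      by (rule tendsto_eventually) (auto simp: eventually_at_filter flat_exp_def)
    ultimately show ?thesis
      using 3 by (simp add: DERIV_def filterlim_at_split flat_exp_def)
  qed
qed

text \<open>
  An algebra of functions closed under partial derivatives that contains $e^{-1/(1-|x|^2)}$, extended
  by 0 outside the unit ball. Membership shows smoothness without computing any derivative.
\<close>
inductive bump_algebra :: "(('n::finite) euclid \<Rightarrow> real) \<Rightarrow> bool" where
  const: "bump_algebra (\<lambda>x. c)"
| coordinate: "bump_algebra (\<lambda>x. x $ i)"
| add: "bump_algebra f \<Longrightarrow> bump_algebra g \<Longrightarrow> bump_algebra (\<lambda>x. f x + g x)"
| mult: "bump_algebra f \<Longrightarrow> bump_algebra g \<Longrightarrow> bump_algebra (\<lambda>x. f x * g x)"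
| flat: "bump_algebra f \<Longrightarrow> bump_algebra (\<lambda>x. flat_exp P (f x))"

lemma bump_algebra_differentiable: "bump_algebra f \<Longrightarrow> f differentiable (at x)"
proof (induction arbitrary: x rule: bump_algebra.induct)
  case (coordinate i)
  then show ?case
    by (intro bounded_linear_imp_differentiable bounded_linear_vec_nth)
next
  case (flat f P)
  have "flat_exp P differentiable (at (f x))"
    using flat_exp_DERIV by (auto simp: real_differentiable_def)
  from differentiable_chain_at[OF flat.IH this] show ?case by (simp add: o_def)
qed auto

lemma bump_algebra_partial_deriv:
  fixes f :: "('n::finite) euclid \<Rightarrow> real"
  shows "bump_algebra f \<Longrightarrow> bump_algebra (partial_deriv j f)"
proof (induction rule: bump_algebra.induct)
  case (const c)
  have "partial_deriv j (\<lambda>x. c) = (\<lambda>x. 0)"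
    by (rule ext, rule partial_deriv_eqI) simp
  then show ?case by (simp add: bump_algebra.const)
next
  case (coordinate i)
  have "partial_deriv j (\<lambda>x. x $ i) = (\<lambda>x. axis j 1 $ i)"
    by (rule ext, rule partial_deriv_eqI) (auto intro!: derivative_eq_intros)
  then show ?case by (simp add: bump_algebra.const)
next
  case (add f g)
  have "partial_deriv j (\<lambda>x. f x + g x) = (\<lambda>x. partial_deriv j f x + partial_deriv j g x)"
    using partial_deriv_DERIV[OF bump_algebra_differentiable[OF add.hyps(1)], of _ j 0]
      partial_deriv_DERIV[OF bump_algebra_differentiable[OF add.hyps(2)], of _ j 0]
    by (intro ext partial_deriv_eqI) (auto intro!: derivative_eq_intros)
  then show ?case by (simp add: add bump_algebra.add)
next
  case (mult f g)
  have "partial_deriv j (\<lambda>x. f x * g x) = (\<lambda>x. f x * partial_deriv j g x + partial_deriv j f x * g x)"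
    using partial_deriv_DERIV[OF bump_algebra_differentiable[OF mult.hyps(1)], of _ j 0]
      partial_deriv_DERIV[OF bump_algebra_differentiable[OF mult.hyps(2)], of _ j 0]
    by (intro ext partial_deriv_eqI) (auto intro!: derivative_eq_intros)
  then show ?case by (simp add: mult bump_algebra.add bump_algebra.mult)
next
  case (flat f P)
  have "partial_deriv j (\<lambda>x. flat_exp P (f x))
      = (\<lambda>x. flat_exp ([:0, 0, 1:] * (P - pderiv P)) (f x) * partial_deriv j f x)"
  proof (intro ext partial_deriv_eqI)
    fix x
    show "((\<lambda>t. flat_exp P (f (x + t *\<^sub>R axis j 1))) has_real_derivative
        flat_exp ([:0, 0, 1:] * (P - pderiv P)) (f x) * partial_deriv j f x) (at 0)"
      using DERIV_chain2[OF flat_exp_DERIV partial_deriv_DERIV[OF bump_algebra_differentiable[OF flat.hyps], of x j 0]]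
      by simp
  qed
  then show ?case using flat by (metis bump_algebra.flat bump_algebra.mult)
qed

lemma bump_algebra_smooth: "bump_algebra f \<Longrightarrow> smooth f"
proof -
  assume f: "bump_algebra f"
  have "bump_algebra (partial_derivs is f)" for "is"
    by (induction "is") (auto simp: f bump_algebra_partial_deriv)
  then show ?thesis by (simp add: smooth_def bump_algebra_differentiable)
qed

lemma mollifier_exists: "\<exists>\<phi> :: ('n::finite) euclid \<Rightarrow> real. mollifier \<phi>"
proof -
  \<comment> \<open>$e^{-1/(1-|x|^2)}$, written in the form in which it is seen to lie in the algebra\<close>
  define f :: "'n euclid \<Rightarrow> real" where "f = (\<lambda>x. flat_exp 1 (1 + (- 1) * (\<Sum>i\<in>UNIV. x $ i * x $ i)))"
  have "bump_algebra (\<lambda>x :: 'n euclid. \<Sum>i\<in>A. x $ i * x $ i)" if "finite A" for A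
    using that
  proof induction
    case (insert i A)
    have "bump_algebra (\<lambda>x :: 'n euclid. x $ i * x $ i + (\<Sum>i\<in>A. x $ i * x $ i))"
      by (rule bump_algebra.add[OF bump_algebra.mult[OF bump_algebra.coordinate bump_algebra.coordinate] insert.IH])
    then show ?case using insert.hyps by simp
  qed (simp add: bump_algebra.const)
  then have smooth: "smooth f"
    unfolding f_def
    by (intro bump_algebra_smooth bump_algebra.flat bump_algebra.add[OF bump_algebra.const bump_algebra.mult[OF bump_algebra.const]]) simp
  have f: "f x = (if norm x < 1 then exp (- 1 / (1 - (norm x)\<^sup>2)) else 0)" for x
  proof -
    have "(\<Sum>i\<in>UNIV. x $ i * x $ i) = (norm x)\<^sup>2"
      unfolding power2_norm_eq_inner inner_vec_def by simp
    moreover have "(norm x)\<^sup>2 < 1 \<longleftrightarrow> norm x < 1" using abs_square_less_1[of "norm x"] by simp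
    ultimately show ?thesis by (auto simp: f_def flat_exp_def)
  qed
  have supp: "closure {x. f x \<noteq> 0} \<subseteq> cball 0 1"
    by (rule closure_minimal) (auto simp: f)
  have cont: "continuous_on UNIV f" by (rule smooth_continuous[OF smooth])
  have nonneg: "f x \<ge> 0" for x by (simp add: f)
  have int: "integrable lborel f"
  proof -
    have "integrable lborel (\<lambda>x. indicator (cball 0 1) x *\<^sub>R f x)"
      by (intro borel_integrable_compact continuous_on_subset[OF cont]) auto
    also have "(\<lambda>x. indicator (cball 0 1) x *\<^sub>R f x) = f"
      by (auto simp: fun_eq_iff f indicator_def)
    finally show ?thesis .
  qed
  have meas: "f \<in> borel_measurable borel" using cont by (rule borel_measurable_continuous_onI)
  define c where "c = (LINT x|lborel. f x)"
  have "c \<noteq> 0"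
  proof
    assume "c = 0"
    then have "AE x in lborel. f x = 0"
      unfolding c_def by (subst (asm) integral_nonneg_eq_0_iff_AE[OF int]) (auto simp: nonneg)
    then have "emeasure lborel {x. f x \<noteq> 0} = 0"
      using meas by (subst (asm) AE_iff_measurable[OF _ refl]) auto
    moreover have "ball 0 1 \<subseteq> {x. f x \<noteq> 0}" by (auto simp: f)
    ultimately have "emeasure lborel (ball (0::'n euclid) 1) = 0"
      using emeasure_mono[of "ball 0 1" "{x. f x \<noteq> 0}" lborel] meas by simp
    then show False using unit_ball_vol_pos[of "real CARD('n)"] by (simp add: emeasure_ball)
  qed
  moreover have "c \<ge> 0" unfolding c_def by (simp add: nonneg)
  ultimately have c: "c > 0" by simp
  have "smooth (\<lambda>x. inverse c * f (1 *\<^sub>R x + 0))" by (rule smooth_affine[OF smooth])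
  moreover have "(LINT x|lebesgue. inverse c * f x) = 1"
    using c meas by (simp add: integral_completion c_def[symmetric])
  moreover have "{x. inverse c * f x \<noteq> 0} = {x. f x \<noteq> 0}" using c by auto
  ultimately have "mollifier (\<lambda>x. inverse c * f x)"
    unfolding mollifier_def using c nonneg supp by simp
  then show ?thesis by blast
qed

section \<open>Power means\<close>

text \<open>
  The power function is convex on the positive reals; at \<open>a = 0\<close>, which lies outside that interval,
  the left-hand side is \<open>(1 - q) * s powr q\<close>.
\<close>
lemma powr_tangent:
  fixes q :: real
  assumes q: "q \<ge> 1" and s: "s > 0" and a: "a \<ge> 0"
  shows "s powr q + q * s powr (q - 1) * (a - s) \<le> a powr q"
proof (cases "a = 0")
  case True
  have "s powr q = s powr (q - 1) * s" using s powr_mult_base[of s "q - 1"] by (simp add: mult.commute)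
  then have "s powr q + q * s powr (q - 1) * (a - s) = (1 - q) * s powr q" using True by (simp add: algebra_simps)
  also have "\<dots> \<le> 0" using q by (simp add: mult_nonpos_nonneg)
  finally show ?thesis using True q by simp
next
  case False
  have "a powr q - s powr q \<ge> (q * s powr (q - 1)) * (a - s)"
    by (rule convex_on_imp_above_tangent[OF powr_convex[OF q]])
      (use s a False in \<open>auto intro!: derivative_eq_intros simp: interior_open\<close>)
  then show ?thesis by simp
qed

lemma abs_le_one_plus_powr: "q \<ge> 1 \<Longrightarrow> \<bar>a::real\<bar> \<le> 1 + \<bar>a\<bar> powr q"
proof (cases "\<bar>a\<bar> \<le> 1")
  case False
  assume "q \<ge> 1"
  then have "\<bar>a\<bar> powr 1 \<le> \<bar>a\<bar> powr q" using False by (intro powr_mono) auto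
  then show ?thesis by simp
qed (simp add: add_increasing2)

lemma (in prob_space) integrable_of_powr:
  fixes f :: "'a \<Rightarrow> real"
  assumes f[measurable]: "f \<in> borel_measurable M" and q: "q \<ge> 1"
    and fin: "(\<integral>\<^sup>+x. ennreal (\<bar>f x\<bar> powr q) \<partial>M) < \<infinity>"
  shows "integrable M f" "integrable M (\<lambda>x. \<bar>f x\<bar> powr q)"
proof -
  show I: "integrable M (\<lambda>x. \<bar>f x\<bar> powr q)"
    using fin by (intro integrableI_bounded) (auto simp: measurable)
  have "integrable M (\<lambda>x. 1 + \<bar>f x\<bar> powr q)" using I by simp
  then show "integrable M f"
    by (rule Bochner_Integration.integrable_bound) (use abs_le_one_plus_powr[OF q] in \<open>auto simp: add_increasing\<close>)
qed

text \<open>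
  Integrate the tangent inequality at the mean of \<open>\<bar>f\<bar>\<close>.
\<close>
lemma (in prob_space) jensen_powr:
  fixes f :: "'a \<Rightarrow> real"
  assumes f[measurable]: "f \<in> borel_measurable M" and q: "q \<ge> 1"
  shows "ennreal (\<bar>LINT x|M. f x\<bar> powr q) \<le> (\<integral>\<^sup>+x. ennreal (\<bar>f x\<bar> powr q) \<partial>M)"
proof (cases "(\<integral>\<^sup>+x. ennreal (\<bar>f x\<bar> powr q) \<partial>M) < \<infinity>")
  case True
  note I = integrable_of_powr[OF f q True]
  define s where "s = (LINT x|M. \<bar>f x\<bar>)"
  have le: "\<bar>LINT x|M. f x\<bar> \<le> s" unfolding s_def by simp
  have "\<bar>LINT x|M. f x\<bar> powr q \<le> (LINT x|M. \<bar>f x\<bar> powr q)"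
  proof (cases "s > 0")
    case s: True
    have "\<bar>LINT x|M. f x\<bar> powr q \<le> s powr q" using q le by (intro powr_mono2) auto
    also have "\<dots> = (LINT x|M. s powr q + q * s powr (q - 1) * (\<bar>f x\<bar> - s))"
      using I by (simp add: prob_space s_def[symmetric])
    also have "\<dots> \<le> (LINT x|M. \<bar>f x\<bar> powr q)"
      using I by (intro integral_mono powr_tangent q s) auto
    finally show ?thesis .
  next
    case False
    then have "(LINT x|M. f x) = 0" using le by simp
    then show ?thesis using q by simp
  qed
  then show ?thesis
    using I(2) by (subst nn_integral_eq_integral) auto
qed (simp add: not_less top_unique)

text \<open>
  If \<open>f\<close> is not integrable, then neither is \<open>f - h\<close> and the right-hand side is infinite, so the
  default value 0 of the integral of \<open>f\<close> is harmless. Hence averages of \<open>L_q\<close> functions over slices can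
  be compared with averages of continuous ones on every slice, without exceptional null sets.
\<close>
lemma (in prob_space) jensen_powr_diff:
  fixes f h :: "'a \<Rightarrow> real"
  assumes f[measurable]: "f \<in> borel_measurable M" and h: "integrable M h" and q: "q \<ge> 1"
  shows "ennreal (\<bar>(LINT x|M. f x) - (LINT x|M. h x)\<bar> powr q) \<le> (\<integral>\<^sup>+x. ennreal (\<bar>f x - h x\<bar> powr q) \<partial>M)"
proof (cases "integrable M f")
  case True
  then show ?thesis
    using jensen_powr[of "\<lambda>x. f x - h x" q] h q by simp
next
  case False
  have hm[measurable]: "h \<in> borel_measurable M" using h by simp
  have "\<not> integrable M (\<lambda>x. f x - h x)"
  proof
    assume "integrable M (\<lambda>x. f x - h x)"
    from Bochner_Integration.integrable_add[OF this h] False show False by simp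
  qed
  then have "(\<integral>\<^sup>+x. ennreal (\<bar>f x - h x\<bar> powr q) \<partial>M) = \<infinity>"
    using integrable_of_powr(1)[of "\<lambda>x. f x - h x" q] q by (metis infinity_ennreal_def less_top borel_measurable_diff f hm)
  then show ?thesis by simp
qed

text \<open>
  The sum is at most \<open>card A\<close> times its largest term in absolute value.
\<close>
lemma sum_powr_le:
  fixes a :: "'b \<Rightarrow> real" and q :: real
  assumes A: "finite A" and q: "q \<ge> 1"
  shows "\<bar>\<Sum>k\<in>A. a k\<bar> powr q \<le> real (card A) powr q * (\<Sum>k\<in>A. \<bar>a k\<bar> powr q)"
proof (cases "A = {}")
  case False
  define m where "m = Max ((\<lambda>k. \<bar>a k\<bar>) ` A)"
  obtain k where k: "k \<in> A" "m = \<bar>a k\<bar>"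
    using Max_in[of "(\<lambda>k. \<bar>a k\<bar>) ` A"] A False unfolding m_def by blast
  have "\<bar>\<Sum>k\<in>A. a k\<bar> \<le> (\<Sum>k\<in>A. \<bar>a k\<bar>)" by (rule sum_abs)
  also have "\<dots> \<le> (\<Sum>k\<in>A. m)" using A unfolding m_def by (intro sum_mono Max_ge) auto
  finally have "\<bar>\<Sum>k\<in>A. a k\<bar> \<le> card A * \<bar>a k\<bar>" by (simp add: k)
  then have "\<bar>\<Sum>k\<in>A. a k\<bar> powr q \<le> (card A * \<bar>a k\<bar>) powr q"
    using q by (intro powr_mono2) auto
  also have "\<dots> = card A powr q * \<bar>a k\<bar> powr q" by (simp add: powr_mult)
  also have "\<dots> \<le> card A powr q * (\<Sum>k\<in>A. \<bar>a k\<bar> powr q)"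
    using A k by (intro mult_left_mono member_le_sum) auto
  finally show ?thesis .
qed simp

lemma powr_add_le: "q \<ge> 1 \<Longrightarrow> \<bar>a + b\<bar> powr q \<le> 2 powr q * (\<bar>a\<bar> powr q + \<bar>b\<bar> powr q)" for a b :: real
  using sum_powr_le[of "UNIV :: bool set" q "\<lambda>k. if k then a else b"] by (simp add: UNIV_bool add_ac)

lemma powr_add3_le:
  "q \<ge> 1 \<Longrightarrow> \<bar>a + b + c\<bar> powr q \<le> 3 powr q * (\<bar>a\<bar> powr q + \<bar>b\<bar> powr q + \<bar>c\<bar> powr q)" for a b c :: real
  using sum_powr_le[of "{0, 1, 2 :: nat}" q "\<lambda>k. if k = 0 then a else if k = 1 then b else c"] by (simp add: add_ac)

section \<open>Local density of continuous functions\<close>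

definition clip :: "real \<Rightarrow> real \<Rightarrow> real" where
  "clip M t = max (- M) (min M t)"

lemma clip_measurable [measurable]: "clip M \<in> borel_measurable borel"
  unfolding clip_def by measurable

lemma continuous_on_clip: "continuous_on UNIV h \<Longrightarrow> continuous_on UNIV (\<lambda>x. clip M (h x))"
  unfolding clip_def by (intro continuous_intros)

lemma ennreal_split_half:
  assumes "c > 0"
  shows "ennreal c * (e / (2 * ennreal c) + e / (2 * ennreal c)) = e"
proof -
  have "ennreal c * (e / (2 * ennreal c) + e / (2 * ennreal c)) = (2 * ennreal c) * (e / (2 * ennreal c))"
    by (simp add: algebra_simps flip: mult_2)
  also have "\<dots> = e"
    using assms
    by (simp add: ennreal_times_divide ennreal_mult_divide_eq mult.commute[of _ e] ennreal_mult_eq_top_iff)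
  finally show ?thesis .
qed

text \<open>
  Truncating \<open>f\<close> costs little by dominated convergence. The truncated function is an almost
  everywhere limit of continuous functions; these may be truncated at the same level, and dominated
  convergence applies again since \<open>B\<close> has finite measure.
\<close>
lemma continuous_approximation_powr:
  fixes f :: "'a::euclidean_space \<Rightarrow> real"
  assumes f[measurable]: "f \<in> borel_measurable borel" and q: "q \<ge> 1"
    and B[measurable]: "B \<in> sets borel" and Bfin: "emeasure lborel B < \<infinity>"
    and fin: "(\<integral>\<^sup>+x\<in>B. ennreal (\<bar>f x\<bar> powr q) \<partial>lborel) < \<infinity>" and e: "e > 0"
  obtains h where "continuous_on UNIV h"
    "(\<integral>\<^sup>+x\<in>B. ennreal (\<bar>f x - h x\<bar> powr q) \<partial>lborel) < e"
proof -
  have q0: "q > 0" using q by simp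
  \<comment> \<open>two errors, each multiplied by the factor \<open>2 powr q\<close> of \<open>powr_add_le\<close>\<close>
  define e' :: ennreal where "e' = e / (2 * ennreal (2 powr q))"
  have e': "e' > 0" unfolding e'_def using e
    by (simp add: ennreal_zero_less_divide ennreal_mult_eq_top_iff ennreal_mult_less_top)
  have "(\<lambda>n. \<integral>\<^sup>+x\<in>B. ennreal (\<bar>f x - clip (real n) (f x)\<bar> powr q) \<partial>lborel)
      \<longlonglongrightarrow> (\<integral>\<^sup>+(x::'a). 0 \<partial>lborel)"
  proof (rule nn_integral_dominated_convergence[OF _ _ _ _ fin])
    show "AE x in lborel. ennreal (\<bar>f x - clip (real n) (f x)\<bar> powr q) * indicator B x
        \<le> ennreal (\<bar>f x\<bar> powr q) * indicator B x" for n
      using q0 by (auto intro!: mult_right_mono ennreal_leI powr_mono2 simp: clip_def)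
    show "AE x in lborel. (\<lambda>n. ennreal (\<bar>f x - clip (real n) (f x)\<bar> powr q) * indicator B x) \<longlonglongrightarrow> 0"
    proof (intro AE_I2 tendsto_eventually)
      fix x
      obtain N :: nat where N: "\<bar>f x\<bar> \<le> real N" using real_arch_simple by blast
      show "\<forall>\<^sub>F n in sequentially. ennreal (\<bar>f x - clip (real n) (f x)\<bar> powr q) * indicator B x = 0"
        using eventually_ge_at_top[of N]
      proof eventually_elim
        case (elim n)
        then have "clip (real n) (f x) = f x" using N by (simp add: clip_def)
        then show ?case using q0 by simp
      qed
    qed
  qed auto
  then have "\<forall>\<^sub>F n in sequentially. (\<integral>\<^sup>+x\<in>B. ennreal (\<bar>f x - clip (real n) (f x)\<bar> powr q) \<partial>lborel) < e'"
    using e' by (intro order_tendstoD) auto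
  then obtain M :: nat where M:
    "(\<integral>\<^sup>+x\<in>B. ennreal (\<bar>f x - clip (real M) (f x)\<bar> powr q) \<partial>lborel) < e'"
    by (auto simp: eventually_sequentially)
  have "(\<lambda>x. clip M (f x)) \<in> borel_measurable lebesgue"
    by (intro measurable_completion) measurable
  then have "(\<lambda>x. clip M (f x)) measurable_on UNIV"
    by (simp add: measurable_on_iff_borel_measurable)
  then obtain N g where N: "negligible N" and g: "\<And>n::nat. continuous_on UNIV (g n)"
    "\<And>x. x \<notin> N \<Longrightarrow> (\<lambda>n. g n x) \<longlonglongrightarrow> clip M (f x)"
    by (auto simp: measurable_on_def)
  have [measurable]: "g n \<in> borel_measurable borel" for n
    using g(1) by (rule borel_measurable_continuous_onI)
  have "AE x in lebesgue. x \<notin> N"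
    using N by (intro AE_not_in) (simp add: negligible_iff_null_sets)
  moreover have "AE x in lebesgue. P x \<Longrightarrow> AE x in lborel. P x" for P :: "'a \<Rightarrow> bool"
    by (simp add: AE_completion_iff)
  ultimately have AEN: "AE x in lborel. x \<notin> N" by blast
  have "(\<lambda>n. \<integral>\<^sup>+x\<in>B. ennreal (\<bar>clip M (f x) - clip M (g n x)\<bar> powr q) \<partial>lborel)
      \<longlonglongrightarrow> (\<integral>\<^sup>+(x::'a). 0 \<partial>lborel)"
  proof (rule nn_integral_dominated_convergence[where w = "\<lambda>x. ennreal ((2 * real M) powr q) * indicator B x"])
    show "AE x in lborel. ennreal (\<bar>clip M (f x) - clip M (g n x)\<bar> powr q) * indicator B x
        \<le> ennreal ((2 * real M) powr q) * indicator B x" for n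
      using q0 by (intro AE_I2 mult_right_mono ennreal_leI powr_mono2) (auto simp: clip_def)
    show "AE x in lborel. (\<lambda>n. ennreal (\<bar>clip M (f x) - clip M (g n x)\<bar> powr q) * indicator B x) \<longlonglongrightarrow> 0"
      using AEN
    proof eventually_elim
      case (elim x)
      have "(\<lambda>n. clip M (g n x)) \<longlonglongrightarrow> clip M (clip M (f x))"
        unfolding clip_def[of _ "g _ x"] clip_def[of _ "clip _ _"] by (intro tendsto_intros g elim)
      also have "clip M (clip M (f x)) = clip M (f x)" by (simp add: clip_def)
      finally have "(\<lambda>n. \<bar>clip M (f x) - clip M (g n x)\<bar>) \<longlonglongrightarrow> 0"
        by (intro tendsto_eq_intros) (auto intro: tendsto_eq_intros)
      then have "(\<lambda>n. \<bar>clip M (f x) - clip M (g n x)\<bar> powr q) \<longlonglongrightarrow> 0"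
        by (rule tendsto_zero_powrI[OF _ tendsto_const _ q0]) auto
      then have "(\<lambda>n. ennreal (\<bar>clip M (f x) - clip M (g n x)\<bar> powr q)) \<longlonglongrightarrow> 0"
        by (simp add: tendsto_ennreal_iff flip: ennreal_0)
      then show ?case by (auto simp: indicator_def)
    qed
    show "(\<integral>\<^sup>+x\<in>B. ennreal ((2 * real M) powr q) \<partial>lborel) < \<infinity>"
      using Bfin by (simp add: nn_integral_cmult_indicator ennreal_mult_less_top)
  qed auto
  then have "\<forall>\<^sub>F n in sequentially. (\<integral>\<^sup>+x\<in>B. ennreal (\<bar>clip M (f x) - clip M (g n x)\<bar> powr q) \<partial>lborel) < e'"
    using e' by (intro order_tendstoD) auto
  then obtain n where n:
    "(\<integral>\<^sup>+x\<in>B. ennreal (\<bar>clip M (f x) - clip M (g n x)\<bar> powr q) \<partial>lborel) < e'"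
    by (auto simp: eventually_sequentially)
  let ?h = "\<lambda>x. clip M (g n x)"
  have "(\<integral>\<^sup>+x\<in>B. ennreal (\<bar>f x - ?h x\<bar> powr q) \<partial>lborel) \<le>
     (\<integral>\<^sup>+x. ennreal (2 powr q) * (ennreal (\<bar>f x - clip M (f x)\<bar> powr q) * indicator B x
        + ennreal (\<bar>clip M (f x) - ?h x\<bar> powr q) * indicator B x) \<partial>lborel)"
  proof (rule nn_integral_mono)
    fix x
    show "ennreal (\<bar>f x - ?h x\<bar> powr q) * indicator B x \<le> ennreal (2 powr q) * (ennreal (\<bar>f x - clip M (f x)\<bar> powr q) * indicator B x
        + ennreal (\<bar>clip M (f x) - ?h x\<bar> powr q) * indicator B x)"
      using powr_add_le[OF q, of "f x - clip M (f x)" "clip M (f x) - ?h x"]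
      by (auto simp: indicator_def simp flip: ennreal_plus ennreal_mult intro!: ennreal_leI)
  qed
  also have "\<dots> = ennreal (2 powr q) * ((\<integral>\<^sup>+x\<in>B. ennreal (\<bar>f x - clip M (f x)\<bar> powr q) \<partial>lborel)
        + (\<integral>\<^sup>+x\<in>B. ennreal (\<bar>clip M (f x) - ?h x\<bar> powr q) \<partial>lborel))"
    by (subst nn_integral_cmult, measurable, subst nn_integral_add, measurable)
  also have "\<dots> < ennreal (2 powr q) * (e' + e')"
    using M n by (intro ennreal_mult_strict_left_mono add_strict_mono) auto
  also have "\<dots> = e"
    unfolding e'_def by (rule ennreal_split_half) simp
  finally show thesis by (intro that[of ?h] continuous_on_clip g)
qed

section \<open>Mollification converges locally in Lq\<close>

lemma lborel_reflect: "distr lborel borel (\<lambda>y. x - y) = (lborel :: 'a::euclidean_space measure)"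
proof -
  have "(lborel :: 'a measure) = density (distr lborel borel (\<lambda>y. x + (- 1) *\<^sub>R y)) (\<lambda>_. ennreal (\<bar>- 1\<bar> ^ DIM('a)))"
    by (rule lborel_affine) simp
  then show ?thesis by (simp add: density_1)
qed

lemma nn_integral_reflect:
  fixes f :: "'a::euclidean_space \<Rightarrow> ennreal"
  assumes [measurable]: "f \<in> borel_measurable borel"
  shows "(\<integral>\<^sup>+y. f (x - y) \<partial>lborel) = (\<integral>\<^sup>+y. f y \<partial>lborel)"
  by (subst (2) lborel_reflect[of x, symmetric]) (simp add: nn_integral_distr)

lemma nn_integral_translate:
  fixes f :: "'a::euclidean_space \<Rightarrow> ennreal"
  assumes [measurable]: "f \<in> borel_measurable borel"
  shows "(\<integral>\<^sup>+x. f (x - y) \<partial>lborel) = (\<integral>\<^sup>+x. f x \<partial>lborel)"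
  by (subst (2) lborel_distr_plus[of "- y", symmetric]) (simp add: nn_integral_distr)

lemma nn_integral_scale:
  fixes f :: "'a::euclidean_space \<Rightarrow> ennreal"
  assumes [measurable]: "f \<in> borel_measurable borel" and e: "e > 0"
  shows "(\<integral>\<^sup>+x. ennreal (1 / e ^ DIM('a)) * f (x /\<^sub>R e) \<partial>lborel) = (\<integral>\<^sup>+x. f x \<partial>lborel)"
proof -
  have "(lborel :: 'a measure) = density (distr lborel borel (\<lambda>y. 0 + inverse e *\<^sub>R y)) (\<lambda>_. ennreal (\<bar>inverse e\<bar> ^ DIM('a)))"
    by (rule lborel_affine) (use e in simp)
  then have "(\<integral>\<^sup>+x. f x \<partial>lborel)
      = (\<integral>\<^sup>+x. f x \<partial>density (distr lborel borel (\<lambda>y. 0 + inverse e *\<^sub>R y)) (\<lambda>_. ennreal (\<bar>inverse e\<bar> ^ DIM('a))))"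
    by simp
  also have "\<dots> = (\<integral>\<^sup>+x. ennreal (1 / e ^ DIM('a)) * f (x /\<^sub>R e) \<partial>lborel)"
    using e by (subst nn_integral_density) (auto simp: nn_integral_distr power_inverse divide_inverse)
  finally show ?thesis by simp
qed

definition conv :: "('a::euclidean_space \<Rightarrow> real) \<Rightarrow> ('a \<Rightarrow> real) \<Rightarrow> 'a \<Rightarrow> real" where
  "conv g k x = (LINT y|lebesgue. g y * k (x - y))"

definition rescaled :: "(('n::finite) euclid \<Rightarrow> real) \<Rightarrow> real \<Rightarrow> 'n euclid \<Rightarrow> real" where
  "rescaled \<phi> \<epsilon> x = \<phi> (x /\<^sub>R \<epsilon>) / \<epsilon> ^ CARD('n)"

lemma mollify_eq_conv: "mollify \<phi> \<epsilon> g = conv g (rescaled \<phi> \<epsilon>)"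
  by (simp add: fun_eq_iff mollify_def conv_def rescaled_def)

text \<open>
  What the convergence of mollifications needs of the rescaled mollifier; \<open>r\<close> bounds the radius of
  the support.
\<close>
definition kernel :: "real \<Rightarrow> ('a::euclidean_space \<Rightarrow> real) \<Rightarrow> bool" where
  "kernel r k \<longleftrightarrow> continuous_on UNIV k \<and> (\<forall>x. k x \<ge> 0) \<and> (\<forall>x. norm x > r \<longrightarrow> k x = 0) \<and>
     (\<integral>\<^sup>+x. ennreal (k x) \<partial>lborel) = 1"

lemma mollifier_zero: "mollifier \<phi> \<Longrightarrow> norm x > 1 \<Longrightarrow> \<phi> x = 0"
  unfolding mollifier_def by (metis (mono_tags, lifting) closure_subset mem_Collect_eq mem_cball_0 not_less subsetD)

lemma compact_support_integrable:
  fixes k :: "'a::euclidean_space \<Rightarrow> real"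
  assumes "continuous_on UNIV k" "\<And>x. norm x > r \<Longrightarrow> k x = 0"
  shows "integrable lborel k"
proof -
  have "integrable lborel (\<lambda>x. indicator (cball 0 r) x *\<^sub>R k x)"
    by (intro borel_integrable_compact continuous_on_subset[OF assms(1)]) auto
  also have "(\<lambda>x. indicator (cball 0 r) x *\<^sub>R k x) = k"
    using assms(2) by (auto simp: fun_eq_iff indicator_def not_le)
  finally show ?thesis .
qed

lemma kernel_rescaled:
  assumes \<phi>: "mollifier (\<phi> :: ('n::finite) euclid \<Rightarrow> real)" and e: "\<epsilon> > 0"
  shows "kernel \<epsilon> (rescaled \<phi> \<epsilon>)"
proof -
  have cont: "continuous_on UNIV \<phi>" and nonneg: "\<And>x. \<phi> x \<ge> 0"
    using \<phi> by (auto simp: mollifier_def smooth_continuous)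
  have [measurable]: "\<phi> \<in> borel_measurable borel" using cont by (rule borel_measurable_continuous_onI)
  have int: "integrable lborel \<phi>" by (rule compact_support_integrable[OF cont mollifier_zero[OF \<phi>]])
  have "(\<integral>\<^sup>+x. ennreal (\<phi> x) \<partial>lborel) = ennreal (LINT x|lborel. \<phi> x)"
    by (rule nn_integral_eq_integral[OF int]) (simp add: nonneg)
  also have "\<dots> = 1" using \<phi> by (simp add: mollifier_def integral_completion)
  finally have "(\<integral>\<^sup>+x. ennreal (1 / \<epsilon> ^ CARD('n)) * ennreal (\<phi> (x /\<^sub>R \<epsilon>)) \<partial>lborel) = 1"
    using nn_integral_scale[of "\<lambda>x. ennreal (\<phi> x)" \<epsilon>] e by simp
  then have "(\<integral>\<^sup>+x. ennreal (rescaled \<phi> \<epsilon> x) \<partial>lborel) = 1"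
    using e by (simp add: rescaled_def nonneg flip: ennreal_mult')
  moreover have "rescaled \<phi> \<epsilon> x = 0" if "norm x > \<epsilon>" for x
    using that e by (simp add: rescaled_def mollifier_zero[OF \<phi>] field_simps)
  moreover have "continuous_on UNIV (rescaled \<phi> \<epsilon>)"
    unfolding rescaled_def using e
    by (intro continuous_intros continuous_on_compose2[OF cont]) auto
  ultimately show ?thesis
    using e by (simp add: kernel_def rescaled_def nonneg)
qed

lemma kernel_measurable: "kernel r k \<Longrightarrow> k \<in> borel_measurable borel"
  unfolding kernel_def by (intro borel_measurable_continuous_onI) simp

lemma kernel_prob_space:
  fixes k :: "'a::euclidean_space \<Rightarrow> real"
  assumes k: "kernel r k"
  shows "prob_space (density lborel (\<lambda>y. ennreal (k (x - y))))"
proof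
  have [measurable]: "k \<in> borel_measurable borel" by (rule kernel_measurable[OF k])
  show "emeasure (density lborel (\<lambda>y. ennreal (k (x - y)))) (space (density lborel (\<lambda>y. ennreal (k (x - y))))) = 1"
    using nn_integral_reflect[of "\<lambda>y. ennreal (k y)" x] k
    by (subst emeasure_density) (auto simp: kernel_def)
qed

lemma conv_eq_density:
  fixes g :: "'a::euclidean_space \<Rightarrow> real"
  assumes k: "kernel r k" and [measurable]: "g \<in> borel_measurable borel"
  shows "conv g k x = (LINT y|density lborel (\<lambda>y. ennreal (k (x - y))). g y)"
proof -
  have [measurable]: "k \<in> borel_measurable borel" by (rule kernel_measurable[OF k])
  have "k z \<ge> 0" for z using k by (simp add: kernel_def)
  then show ?thesis
    by (subst integral_density) (auto simp: conv_def integral_completion mult.commute)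
qed

text \<open>
  Jensen's inequality for the probability measure with density \<open>y \<mapsto> k (x - y)\<close>.
\<close>
lemma conv_diff_powr_le:
  fixes g h :: "'a::euclidean_space \<Rightarrow> real"
  assumes k: "kernel r k" and [measurable]: "g \<in> borel_measurable borel"
    and h: "continuous_on UNIV h" and q: "q \<ge> 1"
  shows "ennreal (\<bar>conv g k x - conv h k x\<bar> powr q)
    \<le> (\<integral>\<^sup>+y. ennreal (k (x - y)) * ennreal (\<bar>g y - h y\<bar> powr q) \<partial>lborel)"
proof -
  have [measurable]: "k \<in> borel_measurable borel" by (rule kernel_measurable[OF k])
  have hm[measurable]: "h \<in> borel_measurable borel" using h by (rule borel_measurable_continuous_onI)
  interpret prob_space "density lborel (\<lambda>y. ennreal (k (x - y)))" by (rule kernel_prob_space[OF k])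
  have nonneg: "k z \<ge> 0" for z using k by (simp add: kernel_def)
  have kc: "continuous_on UNIV k" using k by (simp add: kernel_def)
  have "integrable lborel (\<lambda>y. k (x - y) * h y)"
  proof (rule compact_support_integrable)
    show "continuous_on UNIV (\<lambda>y. k (x - y) * h y)"
      by (intro continuous_intros h continuous_on_compose2[OF kc]) auto
    fix y :: 'a assume "norm y > norm x + r"
    then have "norm (x - y) > r" using norm_triangle_ineq2[of y x] by (simp add: norm_minus_commute)
    then show "k (x - y) * h y = 0" using k by (simp add: kernel_def)
  qed
  then have "integrable (density lborel (\<lambda>y. ennreal (k (x - y)))) h"
    by (subst integrable_density) (auto simp: nonneg)
  then show ?thesis
    using jensen_powr_diff[of g h q] q
    by (simp add: conv_eq_density[OF k] nn_integral_density)
qed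

text \<open>
  Integrate the previous bound over \<open>K\<close> and exchange the integrals: the kernel has integral 1 in \<open>x\<close>
  as well, and it does not reach further than \<open>r\<close>.
\<close>
lemma conv_diff_powr_integral_le:
  fixes g h :: "'a::euclidean_space \<Rightarrow> real"
  assumes k: "kernel r k" and g[measurable]: "g \<in> borel_measurable borel"
    and h: "continuous_on UNIV h" and q: "q \<ge> 1"
    and K[measurable]: "K \<in> sets borel" and B[measurable]: "B \<in> sets borel"
    and KB: "\<And>x y::'a. x \<in> K \<Longrightarrow> norm (x - y) \<le> r \<Longrightarrow> y \<in> B"
  shows "(\<integral>\<^sup>+x\<in>K. ennreal (\<bar>conv g k x - conv h k x\<bar> powr q) \<partial>lborel)
    \<le> (\<integral>\<^sup>+y\<in>B. ennreal (\<bar>g y - h y\<bar> powr q) \<partial>lborel)"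
proof -
  have [measurable]: "k \<in> borel_measurable borel" by (rule kernel_measurable[OF k])
  have hm[measurable]: "h \<in> borel_measurable borel" using h by (rule borel_measurable_continuous_onI)
  have "(\<integral>\<^sup>+x\<in>K. ennreal (\<bar>conv g k x - conv h k x\<bar> powr q) \<partial>lborel)
    \<le> (\<integral>\<^sup>+x. (\<integral>\<^sup>+y. ennreal (k (x - y)) * ennreal (\<bar>g y - h y\<bar> powr q) \<partial>lborel) * indicator K x \<partial>lborel)"
    by (intro nn_integral_mono mult_right_mono conv_diff_powr_le[OF k g h q]) simp
  also have "\<dots> = (\<integral>\<^sup>+x. (\<integral>\<^sup>+y. ennreal (k (x - y)) * ennreal (\<bar>g y - h y\<bar> powr q) * indicator K x \<partial>lborel) \<partial>lborel)"
    by (intro nn_integral_cong nn_integral_multc[symmetric]) simp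
  also have "\<dots> = (\<integral>\<^sup>+y. (\<integral>\<^sup>+x\<in>K. ennreal (k (x - y)) * ennreal (\<bar>g y - h y\<bar> powr q) \<partial>lborel) \<partial>lborel)"
    by (rule lborel_pair.Fubini') simp
  also have "\<dots> \<le> (\<integral>\<^sup>+y. (\<integral>\<^sup>+x. ennreal (k (x - y)) * (ennreal (\<bar>g y - h y\<bar> powr q) * indicator B y) \<partial>lborel) \<partial>lborel)"
  proof (intro nn_integral_mono)
    fix x y :: 'a
    show "ennreal (k (x - y)) * ennreal (\<bar>g y - h y\<bar> powr q) * indicator K x
        \<le> ennreal (k (x - y)) * (ennreal (\<bar>g y - h y\<bar> powr q) * indicator B y)"
      using KB[of x y] k by (cases "norm (x - y) \<le> r") (auto simp: indicator_def kernel_def)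
  qed
  also have "\<dots> = (\<integral>\<^sup>+y\<in>B. ennreal (\<bar>g y - h y\<bar> powr q) \<partial>lborel)"
  proof (intro nn_integral_cong)
    fix y
    have "(\<integral>\<^sup>+x. ennreal (k (x - y)) \<partial>lborel) = 1"
      using nn_integral_translate[of "\<lambda>x. ennreal (k x)" y] k by (simp add: kernel_def)
    then show "(\<integral>\<^sup>+x. ennreal (k (x - y)) * (ennreal (\<bar>g y - h y\<bar> powr q) * indicator B y) \<partial>lborel)
       = ennreal (\<bar>g y - h y\<bar> powr q) * indicator B y"
      by (subst nn_integral_multc) auto
  qed
  finally show ?thesis .
qed

lemma conv_continuous_close:
  fixes h :: "'a::euclidean_space \<Rightarrow> real"
  assumes k: "kernel r k" and h: "continuous_on UNIV h"
    and close: "\<And>y. norm (x - y) \<le> r \<Longrightarrow> \<bar>h y - h x\<bar> \<le> \<eta>" and \<eta>: "\<eta> \<ge> 0"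
  shows "\<bar>conv h k x - h x\<bar> \<le> \<eta>"
proof -
  have [measurable]: "k \<in> borel_measurable borel" by (rule kernel_measurable[OF k])
  have hm[measurable]: "h \<in> borel_measurable borel" using h by (rule borel_measurable_continuous_onI)
  interpret prob_space "density lborel (\<lambda>y. ennreal (k (x - y)))" by (rule kernel_prob_space[OF k])
  have "ennreal (\<bar>conv h k x - conv (\<lambda>y. h x) k x\<bar> powr 1)
    \<le> (\<integral>\<^sup>+y. ennreal (k (x - y)) * ennreal (\<bar>h y - h x\<bar> powr 1) \<partial>lborel)"
    by (rule conv_diff_powr_le[OF k]) auto
  also have "\<dots> \<le> (\<integral>\<^sup>+y. ennreal (k (x - y)) * ennreal \<eta> \<partial>lborel)"
  proof (intro nn_integral_mono)
    fix y
    show "ennreal (k (x - y)) * ennreal (\<bar>h y - h x\<bar> powr 1) \<le> ennreal (k (x - y)) * ennreal \<eta>"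
      using k close[of y] by (cases "norm (x - y) \<le> r") (auto simp: kernel_def intro!: mult_left_mono ennreal_leI)
  qed
  also have "\<dots> = ennreal \<eta>"
    using nn_integral_reflect[of "\<lambda>y. ennreal (k y)" x] k
    by (subst nn_integral_multc) (auto simp: kernel_def)
  also have "conv (\<lambda>y. h x) k x = h x"
    using prob_space by (subst conv_eq_density[OF k]) auto
  finally show ?thesis using \<eta> by simp
qed

text \<open>
  Replace \<open>g\<close> by a continuous \<open>h\<close> that is close to it in \<open>L_q\<close> on an enlarged box. The error \<open>g - h\<close>
  does not grow under convolution, and \<open>h\<close> is uniformly continuous on the enlarged box.
\<close>
lemma conv_kernel_approx:
  fixes g :: "'a::euclidean_space \<Rightarrow> real"
  assumes g[measurable]: "g \<in> borel_measurable borel" and q: "q \<ge> 1"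
    and fin: "\<And>a b. (\<integral>\<^sup>+x\<in>cbox a b. ennreal (\<bar>g x\<bar> powr q) \<partial>lborel) < \<infinity>"
    and e: "e > 0"
  shows "\<exists>d>0. \<forall>r k. r < d \<longrightarrow> kernel r k \<longrightarrow>
     (\<integral>\<^sup>+x\<in>cbox a b. ennreal (\<bar>conv g k x - g x\<bar> powr q) \<partial>lborel) < e"
proof -
  have q0: "q > 0" using q by simp
  define B where "B = cbox (a - One) (b + One)"
  have KB: "y \<in> B" if "x \<in> cbox a b" "norm (x - y) \<le> 1" for x y
    unfolding B_def mem_box
  proof
    fix i :: 'a assume i: "i \<in> Basis"
    have "\<bar>(x - y) \<bullet> i\<bar> \<le> 1" using Basis_le_norm[OF i, of "x - y"] that by simp
    then show "(a - One) \<bullet> i \<le> y \<bullet> i \<and> y \<bullet> i \<le> (b + One) \<bullet> i"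
      using that(1) i by (auto simp: mem_box inner_diff_left inner_add_left)
  qed
  define V where "V = emeasure lborel (cbox a b)"
  have V: "V < \<infinity>" unfolding V_def by (simp add: emeasure_lborel_cbox_eq)
  have "\<exists>e'::real. e' > 0 \<and> ennreal (3 powr q) * (ennreal e' + V * ennreal e' + ennreal e') < e"
  proof -
    have "((\<lambda>t. ennreal (3 powr q) * (ennreal t + V * ennreal t + ennreal t)) \<longlongrightarrow>
        ennreal (3 powr q) * (ennreal 0 + V * ennreal 0 + ennreal 0)) (at_right 0)"
      using V by (intro ennreal_tendsto_cmult tendsto_add tendsto_ennrealI) (auto simp: ennreal_mult_less_top)
    then have "\<forall>\<^sub>F t in at_right 0. ennreal (3 powr q) * (ennreal t + V * ennreal t + ennreal t) < e"
      using e by (intro order_tendstoD) auto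
    then have "\<forall>\<^sub>F t in at_right 0. t > 0 \<and> ennreal (3 powr q) * (ennreal t + V * ennreal t + ennreal t) < e"
      using eventually_at_right_less by eventually_elim simp
    from eventually_happens'[OF _ this] show ?thesis by simp
  qed
  then obtain e' :: real where e': "e' > 0" "ennreal (3 powr q) * (ennreal e' + V * ennreal e' + ennreal e') < e" by blast
  obtain h where h: "continuous_on UNIV h"
    "(\<integral>\<^sup>+x\<in>B. ennreal (\<bar>g x - h x\<bar> powr q) \<partial>lborel) < ennreal e'"
    by (rule continuous_approximation_powr[OF g q _ _ _ , of B "ennreal e'"])
      (use fin e' in \<open>auto simp: B_def emeasure_lborel_cbox_eq\<close>)
  have [measurable]: "h \<in> borel_measurable borel" using h(1) by (rule borel_measurable_continuous_onI)
  \<comment> \<open>a uniform error of size \<open>\<eta>\<close> contributes \<open>\<eta> powr q = e'\<close> per unit of volume\<close>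
  define \<eta> where "\<eta> = e' powr (1 / q)"
  have \<eta>: "\<eta> > 0" "\<eta> powr q = e'" using e' q0 by (auto simp: \<eta>_def powr_powr)
  have "uniformly_continuous_on B h"
    unfolding B_def by (intro compact_uniformly_continuous continuous_on_subset[OF h(1)]) auto
  then obtain d where d: "d > 0" "\<And>x y. x \<in> B \<Longrightarrow> y \<in> B \<Longrightarrow> dist y x < d \<Longrightarrow> dist (h y) (h x) < \<eta>"
    unfolding uniformly_continuous_on_def using \<eta>(1) by metis
  show ?thesis
  proof (intro exI[of _ "min d 1"] conjI allI impI)
    fix r and k :: "'a \<Rightarrow> real" assume r: "r < min d 1" and k: "kernel r k"
    have [measurable]: "k \<in> borel_measurable borel" by (rule kernel_measurable[OF k])
    have cm: "conv f k \<in> borel_measurable borel" if [measurable]: "f \<in> borel_measurable borel" for f :: "'a \<Rightarrow> real"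
    proof -
      have "conv f k = (\<lambda>x. LINT y|lborel. f y * k (x - y))"
        by (auto simp: conv_def integral_completion fun_eq_iff)
      then show ?thesis by simp
    qed
    note [measurable] = cm[of g] cm[of h]
    have "(\<integral>\<^sup>+x\<in>cbox a b. ennreal (\<bar>conv g k x - g x\<bar> powr q) \<partial>lborel)
      \<le> (\<integral>\<^sup>+x. ennreal (3 powr q) * (ennreal (\<bar>conv g k x - conv h k x\<bar> powr q) * indicator (cbox a b) x
          + ennreal e' * indicator (cbox a b) x + ennreal (\<bar>g x - h x\<bar> powr q) * indicator B x) \<partial>lborel)"
    proof (rule nn_integral_mono)
      fix x
      show "ennreal (\<bar>conv g k x - g x\<bar> powr q) * indicator (cbox a b) x \<le>
        ennreal (3 powr q) * (ennreal (\<bar>conv g k x - conv h k x\<bar> powr q) * indicator (cbox a b) x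
          + ennreal e' * indicator (cbox a b) x + ennreal (\<bar>g x - h x\<bar> powr q) * indicator B x)"
      proof (cases "x \<in> cbox a b")
        case True
        then have xB: "x \<in> B" using KB[of x x] by simp
        have "\<bar>conv h k x - h x\<bar> \<le> \<eta>"
        proof (rule conv_continuous_close[OF k h(1)])
          fix y assume y: "norm (x - y) \<le> r"
          then have "y \<in> B" using KB[OF True, of y] r by simp
          then show "\<bar>h y - h x\<bar> \<le> \<eta>"
            using d(2)[OF xB, of y] y r by (simp add: dist_norm norm_minus_commute)
        qed (use \<eta> in simp)
        then have "\<bar>conv h k x - h x\<bar> powr q \<le> e'"
          unfolding \<eta>(2)[symmetric] using q0 by (intro powr_mono2) auto
        then have "\<bar>conv g k x - g x\<bar> powr q \<le> 3 powr q * (\<bar>conv g k x - conv h k x\<bar> powr q + e' + \<bar>g x - h x\<bar> powr q)"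
          using powr_add3_le[OF q, of "conv g k x - conv h k x" "conv h k x - h x" "h x - g x"]
          by (auto simp: abs_minus_commute elim!: order_trans intro!: mult_left_mono)
        then show ?thesis using True xB e'
          by (auto simp: simp flip: ennreal_plus ennreal_mult intro!: ennreal_leI)
      qed simp
    qed
    also have "\<dots> = ennreal (3 powr q) * ((\<integral>\<^sup>+x\<in>cbox a b. ennreal (\<bar>conv g k x - conv h k x\<bar> powr q) \<partial>lborel)
        + ennreal e' * V + (\<integral>\<^sup>+x\<in>B. ennreal (\<bar>g x - h x\<bar> powr q) \<partial>lborel))"
      unfolding V_def B_def
      by (simp add: nn_integral_cmult nn_integral_add nn_integral_cmult_indicator)
    also have "\<dots> \<le> ennreal (3 powr q) * ((\<integral>\<^sup>+x\<in>B. ennreal (\<bar>g x - h x\<bar> powr q) \<partial>lborel)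
        + ennreal e' * V + (\<integral>\<^sup>+x\<in>B. ennreal (\<bar>g x - h x\<bar> powr q) \<partial>lborel))"
      by (intro mult_left_mono add_right_mono conv_diff_powr_integral_le[OF k g h(1) q]) (use KB r in \<open>auto simp: B_def\<close>)
    also have "\<dots> \<le> ennreal (3 powr q) * (ennreal e' + V * ennreal e' + ennreal e')"
      using h(2) by (subst mult.commute[of V]) (intro mult_left_mono add_mono; simp)
    also have "\<dots> < e" by (rule e')
    finally show "(\<integral>\<^sup>+x\<in>cbox a b. ennreal (\<bar>conv g k x - g x\<bar> powr q) \<partial>lborel) < e" .
  qed (use d in simp)
qed

lemma mollify_tendsto:
  fixes g :: "('n::finite) euclid \<Rightarrow> real"
  assumes \<phi>: "mollifier \<phi>" and g: "g \<in> borel_measurable borel" and q: "q \<ge> 1"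
    and fin: "\<And>a b. (\<integral>\<^sup>+x\<in>cbox a b. ennreal (\<bar>g x\<bar> powr q) \<partial>lborel) < \<infinity>"
  shows "((\<lambda>\<epsilon>. \<integral>\<^sup>+x\<in>cbox a b. ennreal (\<bar>mollify \<phi> \<epsilon> g x - g x\<bar> powr q) \<partial>lborel) \<longlongrightarrow> 0) (at_right 0)"
proof (rule order_tendstoI)
  fix e :: ennreal assume "0 < e"
  from conv_kernel_approx[OF g q fin this, of a b] obtain d where d: "d > 0"
    "\<And>r k. r < d \<Longrightarrow> kernel r k \<Longrightarrow>
     (\<integral>\<^sup>+x\<in>cbox a b. ennreal (\<bar>conv g k x - g x\<bar> powr q) \<partial>lborel) < e" by blast
  show "\<forall>\<^sub>F \<epsilon> in at_right 0. (\<integral>\<^sup>+x\<in>cbox a b. ennreal (\<bar>mollify \<phi> \<epsilon> g x - g x\<bar> powr q) \<partial>lborel) < e"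
    unfolding eventually_at_right_field
    by (intro exI[of _ d]) (use d kernel_rescaled[OF \<phi>] in \<open>auto simp: mollify_eq_conv\<close>)
qed simp

section \<open>Locally integrable functions\<close>

lemma mem_cbox_norm:
  fixes x :: "'a::euclidean_space"
  assumes "norm x \<le> r"
  shows "x \<in> cbox (- r *\<^sub>R One) (r *\<^sub>R One)"
  unfolding mem_box
proof
  fix i :: 'a assume i: "i \<in> Basis"
  then show "- r *\<^sub>R One \<bullet> i \<le> x \<bullet> i \<and> x \<bullet> i \<le> r *\<^sub>R One \<bullet> i"
    using Basis_le_norm[OF i, of x] assms by auto
qed

lemma measurable_of_cboxes:
  fixes u :: "'a::euclidean_space \<Rightarrow> real"
  assumes "\<And>n::nat. (\<lambda>x. indicator (cbox (- real n *\<^sub>R One) (real n *\<^sub>R One)) x * u x) \<in> borel_measurable M"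
  shows "u \<in> borel_measurable M"
proof (rule borel_measurable_LIMSEQ_real)
  show "(\<lambda>x. indicator (cbox (- real n *\<^sub>R One) (real n *\<^sub>R One)) x * u x) \<in> borel_measurable M" for n
    by (rule assms)
  fix x :: 'a
  obtain N :: nat where N: "norm x \<le> real N" using real_arch_simple by blast
  show "(\<lambda>n. indicator (cbox (- real n *\<^sub>R One) (real n *\<^sub>R One)) x * u x) \<longlonglongrightarrow> u x"
  proof (rule tendsto_eventually)
    show "\<forall>\<^sub>F n in sequentially. indicator (cbox (- real n *\<^sub>R One) (real n *\<^sub>R One)) x * u x = u x"
      using eventually_ge_at_top[of N]
    proof eventually_elim
      case (elim n)
      have "x \<in> cbox (- real n *\<^sub>R One) (real n *\<^sub>R One)"
        using N elim by (intro mem_cbox_norm) simp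
      then show ?case by simp
    qed
  qed
qed

lemma locally_integrable_measurable:
  assumes "locally_integrable u"
  shows "u \<in> borel_measurable lebesgue"
proof (rule measurable_of_cboxes)
  fix n :: nat
  have "set_integrable lebesgue (cbox (- real n *\<^sub>R One) (real n *\<^sub>R One)) u"
    using assms by (simp add: locally_integrable_def)
  from borel_measurable_integrable[OF this[unfolded set_integrable_def]]
  show "(\<lambda>x. indicator (cbox (- real n *\<^sub>R One) (real n *\<^sub>R One)) x * u x) \<in> borel_measurable lebesgue"
    by simp
qed

lemma borel_representative:
  fixes u :: "'a::euclidean_space \<Rightarrow> real"
  assumes "u \<in> borel_measurable lebesgue"
  obtains u' where "u' \<in> borel_measurable borel" "AE x in lebesgue. u x = u' x"
proof -
  obtain u' where "u' \<in> borel_measurable lborel" "AE x in lborel. u x = u' x"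
    using completion_ex_borel_measurable_real[OF assms] by auto
  then show thesis by (intro that[of u']) (auto intro: AE_completion)
qed

lemma locally_integrable_cong_AE:
  assumes "locally_integrable u" "AE x in lebesgue. u x = u' x" "u' \<in> borel_measurable lebesgue"
  shows "locally_integrable u'"
  unfolding locally_integrable_def set_integrable_def
proof (intro allI impI)
  fix K :: "'a euclid set" assume K: "compact K"
  then have [measurable]: "K \<in> sets lebesgue" by (auto intro: lmeasurable_compact fmeasurableD)
  have *: "integrable lebesgue (\<lambda>x. indicator K x *\<^sub>R u x)"
    using assms(1) K by (simp add: locally_integrable_def set_integrable_def)
  show "integrable lebesgue (\<lambda>x. indicator K x *\<^sub>R u' x)"
    by (rule iffD1[OF integrable_cong_AE *]) (use assms * in auto)
qed

lemma locally_integrable_cbox_finite: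
  assumes "locally_integrable u" "u \<in> borel_measurable borel"
  shows "(\<integral>\<^sup>+x\<in>cbox a b. ennreal \<bar>u x\<bar> \<partial>lborel) < \<infinity>"
proof -
  have "integrable lebesgue (\<lambda>x. indicator (cbox a b) x *\<^sub>R u x)"
    using assms(1) by (simp add: locally_integrable_def set_integrable_def)
  then have "integrable lborel (\<lambda>x. indicator (cbox a b) x *\<^sub>R u x)"
    using assms(2) by (subst (asm) integrable_completion) auto
  then have "(\<integral>\<^sup>+x. ennreal (norm (indicator (cbox a b) x *\<^sub>R u x)) \<partial>lborel) < \<infinity>"
    by (simp add: integrable_iff_bounded)
  also have "(\<lambda>x. ennreal (norm (indicator (cbox a b) x *\<^sub>R u x))) = (\<lambda>x. ennreal \<bar>u x\<bar> * indicator (cbox a b) x)"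
    by (auto simp: indicator_def)
  finally show ?thesis .
qed

lemma conv_cong_AE:
  assumes "u \<in> borel_measurable lebesgue" "u' \<in> borel_measurable lebesgue"
    "AE x in lebesgue. u x = u' x" "k \<in> borel_measurable borel"
  shows "conv u k = conv u' k"
proof
  fix x
  have "(\<lambda>y. k (x - y)) \<in> borel_measurable lborel" using assms(4) by simp
  then have [measurable]: "(\<lambda>y. k (x - y)) \<in> borel_measurable lebesgue" by (rule measurable_completion)
  show "conv u k x = conv u' k x"
    unfolding conv_def by (rule integral_cong_AE) (use assms in auto)
qed

text \<open>
  Limits in \<open>L_1\<close> are unique on every box, and countably many boxes exhaust the space.
\<close>
lemma AE_eq_of_L1_limits:
  fixes g g' :: "'a::euclidean_space \<Rightarrow> real"
  assumes [measurable]: "g \<in> borel_measurable borel" "g' \<in> borel_measurable borel"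
    and f: "\<forall>\<^sub>F e in F. f e \<in> borel_measurable borel" and F: "F \<noteq> bot"
    and lim: "\<And>a b. ((\<lambda>e. \<integral>\<^sup>+x\<in>cbox a b. ennreal \<bar>f e x - g x\<bar> \<partial>lborel) \<longlongrightarrow> 0) F"
    and lim': "\<And>a b. ((\<lambda>e. \<integral>\<^sup>+x\<in>cbox a b. ennreal \<bar>f e x - g' x\<bar> \<partial>lborel) \<longlongrightarrow> 0) F"
  shows "AE x in lborel. g x = g' x"
proof -
  have "AE x in lborel. x \<in> cbox a b \<longrightarrow> g x = g' x" for a b :: 'a
  proof -
    have "\<forall>\<^sub>F e in F. (\<integral>\<^sup>+x\<in>cbox a b. ennreal \<bar>g x - g' x\<bar> \<partial>lborel)
      \<le> (\<integral>\<^sup>+x\<in>cbox a b. ennreal \<bar>f e x - g x\<bar> \<partial>lborel)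
        + (\<integral>\<^sup>+x\<in>cbox a b. ennreal \<bar>f e x - g' x\<bar> \<partial>lborel)"
      using f
    proof eventually_elim
      case (elim e)
      note elim[measurable]
      show ?case
        by (subst nn_integral_add[symmetric]; (intro nn_integral_mono)?)
          (auto simp: indicator_def simp flip: ennreal_plus intro!: ennreal_leI)
    qed
    then have "(\<integral>\<^sup>+x\<in>cbox a b. ennreal \<bar>g x - g' x\<bar> \<partial>lborel) \<le> 0 + 0"
      using tendsto_add[OF lim[of a b] lim'[of a b]] F by (intro tendsto_lowerbound) auto
    then have "AE x in lborel. ennreal \<bar>g x - g' x\<bar> * indicator (cbox a b) x = 0"
      by (subst (asm) add_0, subst (asm) le_zero_eq, subst (asm) nn_integral_0_iff_AE) auto
    then show ?thesis by eventually_elim (auto simp: indicator_def)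
  qed
  then have "AE x in lborel. \<forall>n::nat. x \<in> cbox (- real n *\<^sub>R One) (real n *\<^sub>R One) \<longrightarrow> g x = g' x"
    unfolding AE_all_countable by (intro allI)
  then show ?thesis
  proof eventually_elim
    case (elim x)
    obtain n :: nat where n: "norm (x::'a) \<le> real n" using real_arch_simple by blast
    have "x \<in> cbox (- real n *\<^sub>R One) (real n *\<^sub>R One)"
      using n by (rule mem_cbox_norm)
    with elim show ?case by blast
  qed
qed

section \<open>Differentiating convolutions\<close>

definition compactly_supported :: "('a::euclidean_space \<Rightarrow> real) \<Rightarrow> bool" where
  "compactly_supported k \<longleftrightarrow> (\<exists>R. \<forall>x. norm x > R \<longrightarrow> k x = 0)"

lemma test_function_iff: "test_function \<psi> \<longleftrightarrow> smooth \<psi> \<and> compactly_supported \<psi>"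
proof
  assume t: "test_function \<psi>"
  then have "bounded {x. \<psi> x \<noteq> 0}"
    unfolding test_function_def by (metis bounded_subset closure_subset compact_imp_bounded)
  then obtain R where "\<And>x. \<psi> x \<noteq> 0 \<Longrightarrow> norm x \<le> R" by (auto simp: bounded_iff)
  then show "smooth \<psi> \<and> compactly_supported \<psi>"
    using t unfolding test_function_def compactly_supported_def by (metis not_less)
next
  assume s: "smooth \<psi> \<and> compactly_supported \<psi>"
  then obtain R where R: "\<And>x. norm x > R \<Longrightarrow> \<psi> x = 0" by (auto simp: compactly_supported_def)
  have "{x. \<psi> x \<noteq> 0} \<subseteq> cball 0 R"
    using R by (auto simp: not_less[symmetric])
  then have "bounded {x. \<psi> x \<noteq> 0}" by (rule bounded_subset[OF bounded_cball])
  then show "test_function \<psi>" using s by (simp add: test_function_def)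
qed

lemma compactly_supported_partial_derivs:
  assumes "compactly_supported \<psi>"
  shows "compactly_supported (partial_derivs is \<psi>)"
proof -
  obtain R where R: "\<And>x. norm x > R \<Longrightarrow> \<psi> x = 0"
    using assms by (auto simp: compactly_supported_def)
  have "partial_derivs is \<psi> x = 0" if "norm x > R" for x
    by (rule partial_derivs_support[of "cball 0 R"]) (use R that in auto)
  then show ?thesis unfolding compactly_supported_def by blast
qed

lemma test_function_partial_derivs: "test_function \<psi> \<Longrightarrow> test_function (partial_derivs is \<psi>)"
  by (simp add: test_function_iff smooth_partial_derivs compactly_supported_partial_derivs)

lemma test_function_mixed_deriv: "test_function \<psi> \<Longrightarrow> test_function (mixed_deriv I \<psi>)"
  unfolding mixed_deriv_def by (rule test_function_partial_derivs)

lemma test_function_partial_deriv: "test_function \<psi> \<Longrightarrow> test_function (partial_deriv i \<psi>)"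
  using test_function_partial_derivs[of \<psi> "[i]"] by simp

lemma test_function_measurable: "test_function \<psi> \<Longrightarrow> \<psi> \<in> borel_measurable borel"
  by (intro borel_measurable_continuous_onI smooth_continuous) (simp add: test_function_def)

lemma test_function_reflect:
  assumes "test_function \<psi>"
  shows "test_function (\<lambda>y. \<psi> (x - y))"
proof -
  obtain R where R: "\<And>x. norm x > R \<Longrightarrow> \<psi> x = 0"
    using assms by (auto simp: test_function_iff compactly_supported_def)
  have "\<psi> (x - y) = 0" if "norm y > R + norm x" for y
    using R[of "x - y"] norm_triangle_ineq2[of y x] that by (simp add: norm_minus_commute)
  moreover have "smooth (\<lambda>y. 1 * \<psi> ((- 1) *\<^sub>R y + x))"
    using assms by (intro smooth_affine) (simp add: test_function_def)
  ultimately show ?thesis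
    by (auto simp: test_function_iff compactly_supported_def)
qed

lemma rescaled_test_function:
  assumes \<phi>: "mollifier \<phi>" and e: "\<epsilon> > 0"
  shows "test_function (rescaled \<phi> \<epsilon>)"
proof -
  have "smooth (\<lambda>x. 1 / \<epsilon> ^ CARD('a) * \<phi> (inverse \<epsilon> *\<^sub>R x + 0))"
    using \<phi> by (intro smooth_affine) (simp add: mollifier_def)
  then have "smooth (rescaled \<phi> \<epsilon>)" by (simp add: rescaled_def[abs_def])
  then show ?thesis
    using kernel_rescaled[OF \<phi> e] by (auto simp: test_function_iff kernel_def compactly_supported_def)
qed

lemma compactly_supported_bounded:
  assumes "continuous_on UNIV k" "compactly_supported k"
  obtains M where "\<And>x. \<bar>k x\<bar> \<le> M" "M \<ge> 0"
proof -
  obtain R where R: "\<And>x. norm x > R \<Longrightarrow> k x = 0"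
    using assms by (auto simp: compactly_supported_def)
  have "bounded (k ` cball 0 R)"
    by (intro compact_imp_bounded compact_continuous_image continuous_on_subset[OF assms(1)]) auto
  then obtain M where M: "\<And>x. norm x \<le> R \<Longrightarrow> \<bar>k x\<bar> \<le> M" by (fastforce simp: bounded_iff)
  have "\<bar>k x\<bar> \<le> max M 0" for x
    using M[of x] R[of x] by (cases "norm x \<le> R") auto
  then show thesis by (intro that[of "max M 0"]) auto
qed

text \<open>
  Dominated convergence with majorant \<open>M * \<bar>u\<bar>\<close> on \<open>K\<close>; a common support is required because \<open>u\<close>
  is in general integrable only on compact sets.
\<close>
lemma integral_against_tendsto:
  fixes u :: "'a::euclidean_space \<Rightarrow> real"
  assumes u: "set_integrable lebesgue K u"
    and meas: "\<And>n. \<psi> n \<in> borel_measurable borel" "\<psi>' \<in> borel_measurable borel"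
    and bound: "\<And>n y. \<bar>\<psi> n y\<bar> \<le> M" and supp: "\<And>n y. y \<notin> K \<Longrightarrow> \<psi> n y = 0"
    and lim: "\<And>y. (\<lambda>n. \<psi> n y) \<longlonglongrightarrow> \<psi>' y"
  shows "(\<lambda>n. LINT y|lebesgue. u y * \<psi> n y) \<longlonglongrightarrow> (LINT y|lebesgue. u y * \<psi>' y)"
proof -
  have supp': "\<psi>' y = 0" if "y \<notin> K" for y
    using lim[of y] supp[OF that] by (simp add: LIMSEQ_const_iff)
  have um: "(\<lambda>y. indicator K y *\<^sub>R u y) \<in> borel_measurable lebesgue"
    using u unfolding set_integrable_def by auto
  have [measurable]: "\<psi> n \<in> borel_measurable lebesgue" "\<psi>' \<in> borel_measurable lebesgue" for n
    using meas by (auto intro: measurable_completion)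
  have "(\<lambda>n. LINT y|lebesgue. indicator K y *\<^sub>R u y * \<psi> n y) \<longlonglongrightarrow> (LINT y|lebesgue. indicator K y *\<^sub>R u y * \<psi>' y)"
  proof (rule integral_dominated_convergence[where w = "\<lambda>y. M * \<bar>indicator K y *\<^sub>R u y\<bar>"])
    show "integrable lebesgue (\<lambda>y. M * \<bar>indicator K y *\<^sub>R u y\<bar>)"
      using u unfolding set_integrable_def by (intro integrable_mult_right integrable_abs)
    show "AE y in lebesgue. norm (indicator K y *\<^sub>R u y * \<psi> n y) \<le> M * \<bar>indicator K y *\<^sub>R u y\<bar>" for n
      using bound[of n] by (intro AE_I2) (auto simp: abs_mult mult.commute intro!: mult_right_mono)
    show "AE y in lebesgue. (\<lambda>n. indicator K y *\<^sub>R u y * \<psi> n y) \<longlonglongrightarrow> indicator K y *\<^sub>R u y * \<psi>' y"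
      by (intro AE_I2 tendsto_intros lim)
    show "(\<lambda>y. indicator K y *\<^sub>R u y * \<psi>' y) \<in> borel_measurable lebesgue"
      "(\<lambda>y. indicator K y *\<^sub>R u y * \<psi> n y) \<in> borel_measurable lebesgue" for n
      using um by (auto intro!: borel_measurable_times)
  qed
  moreover have "indicator K y *\<^sub>R u y * \<psi> n y = u y * \<psi> n y" for n y
    using supp[of y n] by (cases "y \<in> K") auto
  moreover have "indicator K y *\<^sub>R u y * \<psi>' y = u y * \<psi>' y" for y
    using supp'[of y] by (cases "y \<in> K") auto
  ultimately show ?thesis by (simp only:)
qed

lemma conv_continuous:
  assumes u: "locally_integrable u" and k: "continuous_on UNIV k" "compactly_supported k"
  shows "continuous_on UNIV (conv u k)"
  unfolding continuous_on_sequentially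
proof (intro allI ballI impI, elim conjE)
  fix s and x :: "'a euclid" assume s: "s \<longlonglongrightarrow> x"
  obtain M where M: "\<And>x. \<bar>k x\<bar> \<le> M" using compactly_supported_bounded[OF k] by blast
  obtain R where R: "\<And>x. norm x > R \<Longrightarrow> k x = 0"
    using k(2) by (auto simp: compactly_supported_def)
  obtain b where b: "\<And>n. norm (s n) \<le> b"
    using convergent_imp_bounded[OF s] by (auto simp: bounded_iff)
  have [measurable]: "k \<in> borel_measurable borel" by (rule borel_measurable_continuous_onI[OF k(1)])
  have "(\<lambda>n. conv u k (s n)) \<longlonglongrightarrow> conv u k x"
    unfolding conv_def
  proof (rule integral_against_tendsto[where K = "cball 0 (b + R)"])
    show "set_integrable lebesgue (cball 0 (b + R)) u" using u by (simp add: locally_integrable_def)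
    show "\<bar>k (s n - y)\<bar> \<le> M" for n y by (rule M)
    show "k (s n - y) = 0" if "y \<notin> cball 0 (b + R)" for n y
      using that b[of n] norm_triangle_ineq2[of y "s n"] by (intro R) (simp add: norm_minus_commute)
    show "(\<lambda>n. k (s n - y)) \<longlonglongrightarrow> k (x - y)" for y
      by (rule continuous_on_tendsto_compose[OF k(1)]) (auto intro!: tendsto_intros s)
  qed auto
  then show "(conv u k \<circ> s) \<longlonglongrightarrow> conv u k x" by (simp add: o_def)
qed

text \<open>
  Differentiation under the integral: by the mean value theorem the difference quotients of \<open>\<psi>\<close> are
  bounded by the supremum of its partial derivative, and along a convergent sequence of increments they
  vanish outside a common ball.
\<close>
lemma conv_has_derivative:
  fixes u :: "('n::finite) euclid \<Rightarrow> real"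
  assumes u: "locally_integrable u" and \<psi>: "test_function \<psi>"
  shows "((\<lambda>t. conv u \<psi> (x + t *\<^sub>R axis i 1)) has_real_derivative conv u (partial_deriv i \<psi>) x) (at 0)"
  unfolding DERIV_def tendsto_at_iff_sequentially
proof (intro allI impI)
  fix h :: "nat \<Rightarrow> real" assume h0: "\<forall>n. h n \<in> UNIV - {0}" and h: "h \<longlonglongrightarrow> 0"
  have sm: "smooth \<psi>" and cs: "compactly_supported \<psi>" using \<psi> by (auto simp: test_function_iff)
  have [measurable]: "\<psi> \<in> borel_measurable borel" "partial_deriv i \<psi> \<in> borel_measurable borel"
    using \<psi> by (auto intro!: test_function_measurable test_function_partial_deriv)
  have "test_function (partial_deriv i \<psi>)" by (rule test_function_partial_deriv[OF \<psi>])
  then obtain M where M: "\<And>x. \<bar>partial_deriv i \<psi> x\<bar> \<le> M"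
    using compactly_supported_bounded[of "partial_deriv i \<psi>"]
    by (auto simp: test_function_iff smooth_continuous)
  obtain R where R: "\<And>x. norm x > R \<Longrightarrow> \<psi> x = 0"
    using cs by (auto simp: compactly_supported_def)
  obtain b where b: "\<And>n. norm (h n) \<le> b"
    using convergent_imp_bounded[OF h] by (auto simp: bounded_iff)
  have b0: "b \<ge> 0" using b[of 0] norm_ge_zero order_trans by blast
  let ?q = "\<lambda>n y. (\<psi> (x + h n *\<^sub>R axis i 1 - y) - \<psi> (x - y)) / h n"
  have "(\<lambda>n. LINT y|lebesgue. u y * ?q n y) \<longlonglongrightarrow> (LINT y|lebesgue. u y * partial_deriv i \<psi> (x - y))"
  proof (rule integral_against_tendsto[where K = "cball 0 (norm x + b + R)"])
    show "set_integrable lebesgue (cball 0 (norm x + b + R)) u" using u by (simp add: locally_integrable_def)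
    show "\<bar>?q n y\<bar> \<le> M" for n y
    proof -
      have hn: "h n \<noteq> 0" using h0 by auto
      have d: "((\<lambda>t. \<psi> (x - y + t *\<^sub>R axis i 1)) has_real_derivative partial_deriv i \<psi> (x - y + t *\<^sub>R axis i 1)) (at t within UNIV)" for t
        by (rule smooth_DERIV[OF sm])
      have "norm (\<psi> (x - y + h n *\<^sub>R axis i 1) - \<psi> (x - y + 0 *\<^sub>R axis i 1)) \<le> M * norm (h n - 0)"
        by (rule field_differentiable_bound[OF convex_UNIV d]) (use M in auto)
      then show ?thesis using hn by (simp add: field_simps)
    qed
    show "?q n y = 0" if "y \<notin> cball 0 (norm x + b + R)" for n y
    proof -
      have "norm (x - y) > R"
        using that norm_triangle_ineq2[of y x] b0 by (simp add: norm_minus_commute)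
      moreover have "norm (x + h n *\<^sub>R axis i 1) \<le> norm x + b"
        using b[of n] by (intro norm_triangle_le) simp
      then have "norm (x + h n *\<^sub>R axis i 1 - y) > R"
        using that norm_triangle_ineq2[of y "x + h n *\<^sub>R axis i 1"] by (simp add: norm_minus_commute)
      ultimately show ?thesis by (simp add: R)
    qed
    show "(\<lambda>n. ?q n y) \<longlonglongrightarrow> partial_deriv i \<psi> (x - y)" for y
    proof -
      have "((\<lambda>t. \<psi> (x - y + t *\<^sub>R axis i 1)) has_real_derivative partial_deriv i \<psi> (x - y)) (at 0)"
        using smooth_DERIV[OF sm, of "x - y" i 0] by simp
      then show ?thesis
        unfolding DERIV_def tendsto_at_iff_sequentially using h0 h
        by (auto simp: o_def algebra_simps)
    qed
  qed auto
  moreover have "(conv u \<psi> (x + (0 + h n) *\<^sub>R axis i 1) - conv u \<psi> (x + 0 *\<^sub>R axis i 1)) / h n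
      = (LINT y|lebesgue. u y * ?q n y)" for n
  proof -
    have int: "integrable lebesgue (\<lambda>y. u y * \<psi> (z - y))" for z
    proof -
      obtain B where B: "\<And>x. \<bar>\<psi> x\<bar> \<le> B"
        using compactly_supported_bounded[OF smooth_continuous[OF sm] cs] by blast
      have "(\<lambda>y. \<psi> (z - y)) \<in> borel_measurable lborel" by simp
      then have [measurable]: "(\<lambda>y. \<psi> (z - y)) \<in> borel_measurable lebesgue" by (rule measurable_completion)
      have um[measurable]: "u \<in> borel_measurable lebesgue" by (rule locally_integrable_measurable[OF u])
      have "integrable lebesgue (\<lambda>y. B * (indicator (cball 0 (norm z + R)) y *\<^sub>R u y))"
        using u by (intro integrable_mult_right) (simp add: locally_integrable_def set_integrable_def)
      then show ?thesis
      proof (rule Bochner_Integration.integrable_bound)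
        show "AE y in lebesgue. norm (u y * \<psi> (z - y)) \<le> norm (B * (indicator (cball 0 (norm z + R)) y *\<^sub>R u y))"
        proof (intro AE_I2)
          fix y
          have "\<psi> (z - y) = 0" if "y \<notin> cball 0 (norm z + R)"
            using that norm_triangle_ineq2[of y z] by (intro R) (simp add: norm_minus_commute)
          moreover have "\<bar>u y\<bar> * \<bar>\<psi> (z - y)\<bar> \<le> \<bar>u y\<bar> * \<bar>B\<bar>"
            using B[of "z - y"] by (intro mult_left_mono) auto
          ultimately show "norm (u y * \<psi> (z - y)) \<le> norm (B * (indicator (cball 0 (norm z + R)) y *\<^sub>R u y))"
            by (cases "y \<in> cball 0 (norm z + R)") (auto simp: abs_mult mult.commute)
        qed
      qed measurable
    qed
    have "(LINT y|lebesgue. u y * ?q n y)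
        = (LINT y|lebesgue. (u y * \<psi> (x + h n *\<^sub>R axis i 1 - y) - u y * \<psi> (x - y)) / h n)"
      by (simp add: algebra_simps)
    also have "\<dots> = (conv u \<psi> (x + h n *\<^sub>R axis i 1) - conv u \<psi> x) / h n"
      using int[of "x + h n *\<^sub>R axis i 1"] int[of x] unfolding conv_def by simp
    finally show ?thesis by (simp only: add_0_left scaleR_zero_left add_0_right)
  qed
  ultimately have "(\<lambda>n. (conv u \<psi> (x + (0 + h n) *\<^sub>R axis i 1) - conv u \<psi> (x + 0 *\<^sub>R axis i 1)) / h n)
      \<longlonglongrightarrow> (LINT y|lebesgue. u y * partial_deriv i \<psi> (x - y))"
    by (simp only:)
  then show "((\<lambda>t. (conv u \<psi> (x + (0 + t) *\<^sub>R axis i 1) - conv u \<psi> (x + 0 *\<^sub>R axis i 1)) / t) \<circ> h)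
      \<longlonglongrightarrow> conv u (partial_deriv i \<psi>) x"
    unfolding o_def conv_def .
qed

section \<open>Weak derivatives\<close>

text \<open>
  This is the definition of the weak derivative for the test function \<open>y \<mapsto> \<psi> (x - y)\<close>, whose
  reflection contributes a second sign \<open>(-1) ^ card J\<close>.
\<close>
lemma conv_weak_deriv:
  assumes w: "has_weak_deriv J u g" and \<psi>: "test_function \<psi>"
  shows "conv g \<psi> = conv u (mixed_deriv J \<psi>)"
proof
  fix x
  have sm: "smooth \<psi>" using \<psi> by (simp add: test_function_def)
  have "mixed_deriv J (\<lambda>y. 1 * \<psi> ((- 1) *\<^sub>R y + x)) = (\<lambda>y. 1 * (- 1) ^ card J * mixed_deriv J \<psi> ((- 1) *\<^sub>R y + x))"
    by (rule mixed_deriv_affine[OF sm])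
  then have "mixed_deriv J (\<lambda>y. \<psi> (x - y)) = (\<lambda>y. (- 1) ^ card J * mixed_deriv J \<psi> (x - y))"
    by simp
  then have "(LINT y|lebesgue. u y * ((- 1) ^ card J * mixed_deriv J \<psi> (x - y))) =
      (- 1) ^ card J * (LINT y|lebesgue. g y * \<psi> (x - y))"
    using w test_function_reflect[OF \<psi>, of x] unfolding has_weak_deriv_def by metis
  then have "(- 1) ^ card J * (LINT y|lebesgue. u y * mixed_deriv J \<psi> (x - y)) =
      (- 1) ^ card J * (LINT y|lebesgue. g y * \<psi> (x - y))"
    by (simp only: mult.left_commute[of "u _"] integral_mult_right_zero)
  then show "conv g \<psi> x = conv u (mixed_deriv J \<psi>) x" by (simp add: conv_def)
qed

lemma has_weak_deriv_cong_AE: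
  assumes w: "has_weak_deriv J u g"
    and u': "AE x in lebesgue. u x = u' x" "u' \<in> borel_measurable lebesgue"
    and g': "AE x in lebesgue. g x = g' x" "g' \<in> borel_measurable lebesgue"
  shows "has_weak_deriv J u' g'"
  unfolding has_weak_deriv_def
proof (intro conjI allI impI)
  have lu: "locally_integrable u" and lg: "locally_integrable g" using w by (auto simp: has_weak_deriv_def)
  show "locally_integrable u'" "locally_integrable g'"
    using locally_integrable_cong_AE[OF lu u'] locally_integrable_cong_AE[OF lg g'] .
  fix \<phi> :: "'a euclid \<Rightarrow> real" assume \<phi>: "test_function \<phi>"
  have [measurable]: "u \<in> borel_measurable lebesgue" "g \<in> borel_measurable lebesgue"
    using lu lg by (auto intro: locally_integrable_measurable)
  have [measurable]: "\<phi> \<in> borel_measurable lebesgue" "mixed_deriv J \<phi> \<in> borel_measurable lebesgue"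
    using test_function_measurable[OF \<phi>] test_function_measurable[OF test_function_mixed_deriv[OF \<phi>, of J]]
    by (auto intro: measurable_completion)
  have "(LINT x|lebesgue. u' x * mixed_deriv J \<phi> x) = (LINT x|lebesgue. u x * mixed_deriv J \<phi> x)"
    by (rule integral_cong_AE) (use u' in auto)
  moreover have "(LINT x|lebesgue. g' x * \<phi> x) = (LINT x|lebesgue. g x * \<phi> x)"
    by (rule integral_cong_AE) (use g' in auto)
  ultimately show "(LINT x|lebesgue. u' x * mixed_deriv J \<phi> x) = (- 1) ^ card J * (LINT x|lebesgue. g' x * \<phi> x)"
    using w \<phi> by (simp add: has_weak_deriv_def)
qed

lemma has_weak_deriv_empty: "locally_integrable u \<Longrightarrow> has_weak_deriv {} u u"
  by (simp add: has_weak_deriv_def)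

text \<open>
  Both weak derivatives have the same mollifications, by \<open>conv_weak_deriv\<close>, and a locally integrable
  function is the local \<open>L_1\<close> limit of its mollifications.
\<close>
lemma has_weak_deriv_unique:
  fixes u :: "('n::{finite,linorder}) euclid \<Rightarrow> real"
  assumes w: "has_weak_deriv J u g" and w': "has_weak_deriv J u g'"
  shows "AE x in lebesgue. g x = g' x"
proof -
  have lg: "locally_integrable g" "locally_integrable g'" and lu: "locally_integrable u"
    using w w' by (auto simp: has_weak_deriv_def)
  note m = lg[THEN locally_integrable_measurable]
  obtain h where h: "h \<in> borel_measurable borel" "AE x in lebesgue. g x = h x"
    using borel_representative[OF m(1)] .
  obtain h' where h': "h' \<in> borel_measurable borel" "AE x in lebesgue. g' x = h' x"
    using borel_representative[OF m(2)] .
  have hm: "h \<in> borel_measurable lebesgue" "h' \<in> borel_measurable lebesgue"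
    using h h' by (auto intro: measurable_completion)
  have lh: "locally_integrable h" "locally_integrable h'"
    using locally_integrable_cong_AE[OF lg(1) h(2) hm(1)] locally_integrable_cong_AE[OF lg(2) h'(2) hm(2)] .
  obtain \<phi> :: "'n euclid \<Rightarrow> real" where \<phi>: "mollifier \<phi>" using mollifier_exists by blast
  have eq: "mollify \<phi> \<epsilon> h = mollify \<phi> \<epsilon> h'" if "\<epsilon> > 0" for \<epsilon>
  proof -
    note t = rescaled_test_function[OF \<phi> that]
    note mt = test_function_measurable[OF t]
    have "conv h (rescaled \<phi> \<epsilon>) = conv g (rescaled \<phi> \<epsilon>)"
      using conv_cong_AE[OF m(1) hm(1) h(2) mt] by simp
    also have "\<dots> = conv g' (rescaled \<phi> \<epsilon>)"
      by (simp add: conv_weak_deriv[OF w t] conv_weak_deriv[OF w' t])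
    also have "\<dots> = conv h' (rescaled \<phi> \<epsilon>)"
      using conv_cong_AE[OF m(2) hm(2) h'(2) mt] by simp
    finally show ?thesis by (simp add: mollify_eq_conv)
  qed
  have lim: "((\<lambda>\<epsilon>. \<integral>\<^sup>+x\<in>cbox a b. ennreal \<bar>mollify \<phi> \<epsilon> f x - f x\<bar> \<partial>lborel) \<longlongrightarrow> 0) (at_right 0)"
    if "f \<in> borel_measurable borel" "locally_integrable f" for f a b
    using mollify_tendsto[OF \<phi> that(1), of 1 a b] locally_integrable_cbox_finite[OF that(2,1)] by simp
  have "AE x in lborel. h x = h' x"
  proof (rule AE_eq_of_L1_limits[where f = "\<lambda>\<epsilon>. mollify \<phi> \<epsilon> h" and F = "at_right 0"])
    show "\<forall>\<^sub>F \<epsilon> in at_right 0. mollify \<phi> \<epsilon> h \<in> borel_measurable borel"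
      using eventually_at_right_less[of "0::real"]
    proof eventually_elim
      case (elim \<epsilon>)
      then show ?case
        using rescaled_test_function[OF \<phi> elim] unfolding mollify_eq_conv test_function_iff
        by (intro borel_measurable_continuous_onI conv_continuous lh smooth_continuous) auto
    qed
    fix a b :: "'n euclid"
    show "((\<lambda>\<epsilon>. \<integral>\<^sup>+x\<in>cbox a b. ennreal \<bar>mollify \<phi> \<epsilon> h x - h x\<bar> \<partial>lborel) \<longlongrightarrow> 0) (at_right 0)"
      by (rule lim[OF h(1) lh(1)])
    show "((\<lambda>\<epsilon>. \<integral>\<^sup>+x\<in>cbox a b. ennreal \<bar>mollify \<phi> \<epsilon> h x - h' x\<bar> \<partial>lborel) \<longlongrightarrow> 0) (at_right 0)"
      by (rule Lim_transform_eventually[OF lim[OF h'(1) lh(2)]])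
        (auto simp: eq intro!: eventually_mono[OF eventually_at_right_less])
  qed (use h h' in auto)
  then have "AE x in lebesgue. h x = h' x" by (rule AE_completion)
  with h(2) h'(2) show ?thesis by eventually_elim simp
qed

text \<open>
  \<open>F J\<close> plays the role of the mixed derivative of \<open>F {}\<close> in the directions \<open>J\<close>. The mollified weak
  derivatives of a function form such a family, and the formulas for smooth functions below are proved
  for such families.
\<close>
definition mixed_family :: "('n set \<Rightarrow> ('n::finite) euclid \<Rightarrow> real) \<Rightarrow> bool" where
  "mixed_family F \<longleftrightarrow> (\<forall>J. continuous_on UNIV (F J)) \<and>
     (\<forall>J i x. i \<notin> J \<longrightarrow> ((\<lambda>t. F J (x + t *\<^sub>R axis i 1)) has_real_derivative F (insert i J) x) (at 0))"

lemma mixed_family_mixed_deriv: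
  fixes F :: "('n::{finite,linorder}) set \<Rightarrow> 'n euclid \<Rightarrow> real"
  assumes F: "mixed_family F"
  shows "mixed_deriv I (F {}) = F I"
proof -
  have "partial_derivs is (F {}) = F (set is)" if "distinct is" for "is"
    using that
  proof (induction "is")
    case (Cons i "is")
    have "partial_deriv i (F (set is)) = F (insert i (set is))"
      using F Cons.prems by (intro ext partial_deriv_eqI) (simp add: mixed_family_def)
    then show ?case using Cons by simp
  qed simp
  from this[of "sorted_list_of_set I"] show ?thesis by (simp add: mixed_deriv_def)
qed

text \<open>
  Each member is \<open>u\<close> convolved with a mixed derivative of the kernel, so a further derivative falls on
  the kernel, where derivatives commute.
\<close>
lemma mixed_family_mollify:
  fixes G :: "('n::{finite,linorder}) set \<Rightarrow> 'n euclid \<Rightarrow> real"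
  assumes \<phi>: "mollifier \<phi>" and e: "\<epsilon> > 0" and w: "\<And>J. has_weak_deriv J u (G J)"
  shows "mixed_family (\<lambda>J. mollify \<phi> \<epsilon> (G J))"
  unfolding mixed_family_def mollify_eq_conv
proof (intro conjI allI impI)
  let ?k = "rescaled \<phi> \<epsilon>"
  have k: "test_function ?k" by (rule rescaled_test_function[OF \<phi> e])
  then have sm: "smooth ?k" and cs: "compactly_supported ?k" by (auto simp: test_function_iff)
  have lu: "locally_integrable u" and lG: "locally_integrable (G J)" for J
    using w by (auto simp: has_weak_deriv_def)
  show "continuous_on UNIV (conv (G J) ?k)" for J
    by (rule conv_continuous[OF lG smooth_continuous[OF sm] cs])
  fix J :: "'n set" and i x assume i: "i \<notin> J"
  have "((\<lambda>t. conv u (mixed_deriv J ?k) (x + t *\<^sub>R axis i 1)) has_real_derivative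
      conv u (partial_deriv i (mixed_deriv J ?k)) x) (at 0)"
    by (intro conv_has_derivative lu test_function_mixed_deriv k)
  then show "((\<lambda>t. conv (G J) ?k (x + t *\<^sub>R axis i 1)) has_real_derivative conv (G (insert i J)) ?k x) (at 0)"
    by (simp add: conv_weak_deriv[OF w k] mixed_deriv_insert[OF sm i])
qed

section \<open>Lebesgue measure on boxes and faces\<close>

definition segment_measure :: "real \<Rightarrow> real \<Rightarrow> real measure" where
  "segment_measure c d = density lborel (indicator {c..d})"

definition box_measure :: "('n \<Rightarrow> real) \<Rightarrow> ('n \<Rightarrow> real) \<Rightarrow> 'n set \<Rightarrow> ('n \<Rightarrow> real) measure" where
  "box_measure a b I = (\<Pi>\<^sub>M i\<in>I. segment_measure (a i) (b i))"

text \<open>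
  The parametrization of the affine subspace through \<open>x\<close> in the directions \<open>I\<close> that underlies
  \<open>face_measure\<close>.
\<close>
definition place :: "'n set \<Rightarrow> ('n::finite) euclid \<Rightarrow> ('n \<Rightarrow> real) \<Rightarrow> 'n euclid" where
  "place I x s = (\<chi> i. if i \<in> I then s i else x $ i)"

lemma place_nth [simp]: "place I x s $ i = (if i \<in> I then s i else x $ i)"
  by (simp add: place_def)

lemma sets_segment_measure [simp, measurable_cong]: "sets (segment_measure c d) = sets borel"
  and space_segment_measure [simp]: "space (segment_measure c d) = UNIV"
  by (simp_all add: segment_measure_def)

lemma emeasure_segment_measure:
  "A \<in> sets borel \<Longrightarrow> emeasure (segment_measure c d) A = emeasure lborel ({c..d} \<inter> A)"
  unfolding segment_measure_def
  by (subst emeasure_density) (auto simp: indicator_inter_arith[symmetric])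

lemma finite_segment_measure: "finite_measure (segment_measure c d)"
proof
  show "emeasure (segment_measure c d) (space (segment_measure c d)) \<noteq> \<infinity>"
    by (cases "c \<le> d") (auto simp: emeasure_segment_measure)
qed

lemma product_interval: "product_sigma_finite (\<lambda>i. segment_measure (a i) (b i))"
  using finite_segment_measure unfolding finite_measure_def by (intro product_sigma_finite.intro) blast

lemma product_lborel: "product_sigma_finite (\<lambda>i. lborel :: real measure)"
  by (intro product_sigma_finite.intro sigma_finite_lborel)

lemma sets_box_measure [measurable_cong]: "sets (box_measure a b I) = sets (\<Pi>\<^sub>M i\<in>I. borel)"
  unfolding box_measure_def by (intro sets_PiM_cong) auto

lemma space_box_measure: "space (box_measure a b I) = extensional I"
  by (simp add: box_measure_def space_PiM PiE_UNIV_domain PiE_def)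

lemma place_measurable [measurable]: "place I x \<in> borel_measurable (\<Pi>\<^sub>M i\<in>I. borel)"
  unfolding borel_measurable_euclidean_space[of "place I x"]
proof
  fix b :: "'a euclid" assume "b \<in> Basis"
  then obtain i where b: "b = axis i 1" by (auto simp: Basis_vec_def)
  show "(\<lambda>s. place I x s \<bullet> b) \<in> borel_measurable (\<Pi>\<^sub>M i\<in>I. borel)"
    unfolding b inner_axis by (cases "i \<in> I") simp_all
qed

text \<open>
  Restricting each coordinate to its interval or restricting the product measure to the box amounts to
  the same. The product form is the one to which the Fubini theorems for product measures apply.
\<close>
lemma box_measure_eq_density:
  fixes a b :: "'n::finite \<Rightarrow> real"
  shows "box_measure a b I = density (\<Pi>\<^sub>M i\<in>I. lborel) (\<lambda>s. \<Prod>i\<in>I. indicator {a i..b i} (s i))"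
  unfolding box_measure_def
proof (rule product_sigma_finite.PiM_eqI[OF product_interval, symmetric])
  interpret L: product_sigma_finite "\<lambda>i::'n. lborel :: real measure" by (rule product_lborel)
  show "sets (density (\<Pi>\<^sub>M i\<in>I. lborel) (\<lambda>s. \<Prod>i\<in>I. indicator {a i..b i} (s i)))
      = sets (\<Pi>\<^sub>M i\<in>I. segment_measure (a i) (b i))"
    by (simp cong: sets_PiM_cong)
  fix A :: "'n \<Rightarrow> real set" assume "\<And>i. i \<in> I \<Longrightarrow> A i \<in> sets (segment_measure (a i) (b i))"
  then have A: "A i \<in> sets borel" if "i \<in> I" for i using that by simp
  have PA: "Pi\<^sub>E I A \<in> sets (\<Pi>\<^sub>M i\<in>I. lborel)" using A by (intro sets_PiM_I_finite) auto
  have "emeasure (density (\<Pi>\<^sub>M i\<in>I. lborel) (\<lambda>s. \<Prod>i\<in>I. indicator {a i..b i} (s i))) (Pi\<^sub>E I A)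
      = (\<integral>\<^sup>+s\<in>Pi\<^sub>E I A. (\<Prod>i\<in>I. indicator {a i..b i} (s i)) \<partial>(\<Pi>\<^sub>M i\<in>I. lborel))"
    using PA by (intro emeasure_density) auto
  also have "\<dots> = (\<integral>\<^sup>+s. (\<Prod>i\<in>I. indicator ({a i..b i} \<inter> A i) (s i)) \<partial>(\<Pi>\<^sub>M i\<in>I. lborel))"
  proof (rule nn_integral_cong)
    fix s :: "'n \<Rightarrow> real" assume s: "s \<in> space (\<Pi>\<^sub>M i\<in>I. lborel)"
    show "(\<Prod>i\<in>I. indicator {a i..b i} (s i)) * indicator (Pi\<^sub>E I A) s = (\<Prod>i\<in>I. indicator ({a i..b i} \<inter> A i) (s i) :: ennreal)"
    proof (cases "s \<in> Pi\<^sub>E I A")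
      case True
      then show ?thesis by (auto simp: indicator_def intro!: prod.cong)
    next
      case False
      then obtain i where "i \<in> I" "s i \<notin> A i" using s by (auto simp: space_PiM PiE_def)
      then have "(\<Prod>i\<in>I. indicator ({a i..b i} \<inter> A i) (s i) :: ennreal) = 0"
        by (intro prod_zero bexI[of _ i]) auto
      then show ?thesis using False by simp
    qed
  qed
  also have "\<dots> = (\<Prod>i\<in>I. emeasure lborel ({a i..b i} \<inter> A i))"
    using A by (subst L.product_nn_integral_prod) auto
  finally show "emeasure (density (\<Pi>\<^sub>M i\<in>I. lborel) (\<lambda>s. \<Prod>i\<in>I. indicator {a i..b i} (s i))) (Pi\<^sub>E I A)
      = (\<Prod>i\<in>I. emeasure (segment_measure (a i) (b i)) (A i))"
    using A by (simp add: emeasure_segment_measure cong: prod.cong)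
qed simp

lemma finite_box_measure: "finite_measure (box_measure a b (I :: ('n::finite) set))"
proof
  interpret product_sigma_finite "\<lambda>i. segment_measure (a i) (b i)" by (rule product_interval)
  have "emeasure (box_measure a b I) (\<Pi>\<^sub>E i\<in>I. UNIV) = (\<Prod>i\<in>I. emeasure (segment_measure (a i) (b i)) UNIV)"
    unfolding box_measure_def by (intro emeasure_PiM) auto
  moreover have "emeasure (segment_measure (a i) (b i)) UNIV \<noteq> \<infinity>" for i
    using finite_measure.emeasure_finite[OF finite_segment_measure] by simp
  ultimately show "emeasure (box_measure a b I) (space (box_measure a b I)) \<noteq> \<infinity>"
    by (simp add: space_box_measure PiE_def ennreal_prod_eq_top)
qed

lemma AE_box_measure:
  "AE s in box_measure a b (I :: ('n::finite) set). \<forall>i\<in>I. s i \<in> {a i..b i}"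
proof (rule AE_finite_allI)
  interpret product_sigma_finite "\<lambda>i. segment_measure (a i) (b i)" by (rule product_interval)
  fix i assume i: "i \<in> I"
  let ?E = "\<lambda>j. if j = i then - {a i..b i} else UNIV"
  show "AE s in box_measure a b I. s i \<in> {a i..b i}"
  proof (rule AE_I)
    show "{s \<in> space (box_measure a b I). s i \<notin> {a i..b i}} \<subseteq> Pi\<^sub>E I ?E"
      by (auto simp: space_box_measure PiE_def extensional_def)
    have "emeasure (box_measure a b I) (Pi\<^sub>E I ?E) = (\<Prod>j\<in>I. emeasure (segment_measure (a j) (b j)) (?E j))"
      unfolding box_measure_def by (intro emeasure_PiM) auto
    also have "\<dots> = 0" using i by (intro prod_zero bexI[of _ i]) (auto simp: emeasure_segment_measure)
    finally show "emeasure (box_measure a b I) (Pi\<^sub>E I ?E) = 0" .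
    show "Pi\<^sub>E I ?E \<in> sets (box_measure a b I)"
      unfolding box_measure_def by (intro sets_PiM_I_finite) auto
  qed
qed simp

lemma integrable_box_measure:
  fixes f :: "('n::finite \<Rightarrow> real) \<Rightarrow> real"
  assumes "f \<in> borel_measurable (\<Pi>\<^sub>M i\<in>I. borel)"
    and "\<And>s. (\<And>i. i \<in> I \<Longrightarrow> s i \<in> {a i..b i}) \<Longrightarrow> \<bar>f s\<bar> \<le> B"
  shows "integrable (box_measure a b I) f"
proof (rule finite_measure.integrable_const_bound[OF finite_box_measure])
  show "AE s in box_measure a b I. norm (f s) \<le> B"
    using AE_box_measure[of I a b] by eventually_elim (use assms(2) in auto)
  show "f \<in> borel_measurable (box_measure a b I)"
    using assms(1) by (simp cong: measurable_cong_sets[OF sets_box_measure refl])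
qed

lemma lborel_vec: "distr (\<Pi>\<^sub>M i\<in>UNIV. lborel) borel (place UNIV x) = (lborel :: ('n::finite) euclid measure)"
proof (rule lborel_eqI[symmetric])
  interpret L: product_sigma_finite "\<lambda>i::'n. lborel :: real measure" by (rule product_lborel)
  have [measurable]: "place UNIV x \<in> borel_measurable (\<Pi>\<^sub>M i\<in>UNIV. lborel)"
    using place_measurable[of UNIV x] by (simp cong: measurable_cong_sets[OF sets_PiM_cong[OF refl sets_lborel] refl])
  fix l u :: "'n euclid" assume lu: "\<And>b. b \<in> Basis \<Longrightarrow> l \<bullet> b \<le> u \<bullet> b"
  have lu': "l $ i \<le> u $ i" for i using lu[of "axis i 1"] by (simp add: inner_axis axis_in_Basis_iff)
  have "place UNIV x -` box l u \<inter> space (\<Pi>\<^sub>M i\<in>UNIV. lborel) = (\<Pi>\<^sub>E i\<in>UNIV. {l $ i <..< u $ i})"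
    by (auto simp: mem_box_cart space_PiM PiE_def Pi_def)
  then have "emeasure (distr (\<Pi>\<^sub>M i\<in>UNIV. lborel) borel (place UNIV x)) (box l u) = (\<Prod>i\<in>UNIV. ennreal (u $ i - l $ i))"
    by (subst emeasure_distr) (auto simp: L.emeasure_PiM lu')
  also have "\<dots> = ennreal (\<Prod>i\<in>UNIV. u $ i - l $ i)" using lu' by (simp add: prod_ennreal)
  also have "(\<Prod>i\<in>UNIV. u $ i - l $ i) = (\<Prod>b\<in>Basis. (u - l) \<bullet> b)"
    by (subst prod.reindex_cong[where l = "\<lambda>i. axis i 1" and B = UNIV])
      (auto simp: Basis_vec_def inner_axis inj_on_def axis_eq_axis)
  finally show "emeasure (distr (\<Pi>\<^sub>M i\<in>UNIV. lborel) borel (place UNIV x)) (box l u) = (\<Prod>b\<in>Basis. (u - l) \<bullet> b)" .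
qed simp

lemma nn_integral_box_measure_UNIV:
  fixes h :: "('n::finite) euclid \<Rightarrow> ennreal"
  assumes [measurable]: "h \<in> borel_measurable borel"
  shows "(\<integral>\<^sup>+s. h (place UNIV x s) \<partial>box_measure a b UNIV)
    = (\<integral>\<^sup>+y\<in>cbox (\<chi> i. a i) (\<chi> i. b i). h y \<partial>lborel)"
proof -
  have [measurable]: "place UNIV x \<in> borel_measurable (\<Pi>\<^sub>M i\<in>UNIV. lborel)"
    using place_measurable[of UNIV x] by (simp cong: measurable_cong_sets[OF sets_PiM_cong[OF refl sets_lborel] refl])
  have "(\<integral>\<^sup>+y\<in>cbox (\<chi> i. a i) (\<chi> i. b i). h y \<partial>lborel)
    = (\<integral>\<^sup>+s. h (place UNIV x s) * indicator (cbox (\<chi> i. a i) (\<chi> i. b i)) (place UNIV x s) \<partial>(\<Pi>\<^sub>M i\<in>UNIV. lborel))"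
    by (subst lborel_vec[of x, symmetric], subst nn_integral_distr) auto
  also have "\<dots> = (\<integral>\<^sup>+s. (\<Prod>i\<in>UNIV. indicator {a i..b i} (s i)) * h (place UNIV x s) \<partial>(\<Pi>\<^sub>M i\<in>UNIV. lborel))"
  proof (rule nn_integral_cong)
    fix s :: "'n \<Rightarrow> real"
    have "indicator (cbox (\<chi> i. a i) (\<chi> i. b i)) (place UNIV x s) = (\<Prod>i\<in>UNIV. indicator {a i..b i} (s i) :: ennreal)"
    proof (cases "\<forall>i. s i \<in> {a i..b i}")
      case False
      then obtain i where "s i \<notin> {a i..b i}" by blast
      then show ?thesis
        by (subst prod_zero) (auto simp: mem_box_cart indicator_def intro!: exI[of _ i])
    qed (auto simp: mem_box_cart)
    then show "h (place UNIV x s) * indicator (cbox (\<chi> i. a i) (\<chi> i. b i)) (place UNIV x s)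
      = (\<Prod>i\<in>UNIV. indicator {a i..b i} (s i)) * h (place UNIV x s)" by (simp add: mult.commute)
  qed
  also have "\<dots> = (\<integral>\<^sup>+s. h (place UNIV x s) \<partial>box_measure a b UNIV)"
    unfolding box_measure_eq_density by (subst nn_integral_density) auto
  finally show ?thesis by simp
qed

lemma face_closed: "closed (face I x x')"
proof -
  have "face I x x' = cbox x x' \<inter> (\<Inter>l\<in>-I. {\<eta>. \<eta> $ l = x $ l})"
    by (auto simp: face_def mem_box_cart)
  moreover have "closed {\<eta>. \<eta> $ l = x $ l}" for l
    by (intro closed_Collect_eq continuous_intros)
  ultimately show ?thesis by (simp only:) (intro closed_Int closed_INT closed_cbox ballI)
qed

text \<open>
  The hypothesis puts the coordinates outside \<open>I\<close>, which stay at \<open>x\<close>, within the bounds of the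
  rectangle.
\<close>
lemma place_in_face_indicator:
  fixes x x' :: "('n::finite) euclid"
  assumes "\<And>i. x $ i \<le> x' $ i"
  shows "indicator (face I x x') (place I x s) = (\<Prod>i\<in>I. indicator {x $ i..x' $ i} (s i) :: 'b::{comm_semiring_1,semiring_no_zero_divisors})"
proof (cases "\<forall>i\<in>I. s i \<in> {x $ i..x' $ i}")
  case True
  then have "place I x s \<in> face I x x'" using assms by (auto simp: face_def)
  then show ?thesis using True by simp
next
  case False
  then obtain i where i: "i \<in> I" "s i \<notin> {x $ i..x' $ i}" by blast
  then have "place I x s \<notin> face I x x'" by (auto simp: face_def intro!: exI[of _ i])
  moreover have "(\<Prod>i\<in>I. indicator {x $ i..x' $ i} (s i) :: 'b) = 0"
    using i by (intro prod_zero bexI[of _ i]) auto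
  ultimately show ?thesis by simp
qed

lemma place_measurable_lborel [measurable]: "place I x \<in> (\<Pi>\<^sub>M i\<in>I. lborel) \<rightarrow>\<^sub>M borel"
  using place_measurable[of I x] by (simp cong: measurable_cong_sets[OF sets_PiM_cong[OF refl sets_lborel] refl])

lemma face_measure_eq:
  "face_measure I x x' = restrict_space (completion (distr (\<Pi>\<^sub>M i\<in>I. lborel) borel (place I x))) (face I x x')"
  by (simp add: face_measure_def place_def[abs_def])

lemma face_sets [measurable]: "face I x x' \<in> sets borel"
  using face_closed by (rule borel_closed)

lemma face_sets_completion:
  "face I x x' \<in> sets (completion (distr (\<Pi>\<^sub>M i\<in>I. lborel) borel (place I x)))"
  by (simp add: face_sets)

lemma borel_measurable_face_measure:
  "f \<in> borel_measurable borel \<Longrightarrow> f \<in> borel_measurable (face_measure I x x')"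
  unfolding face_measure_eq by (intro measurable_restrict_space1 measurable_completion) simp

lemma nn_integral_face_measure:
  fixes h :: "('n::finite) euclid \<Rightarrow> ennreal"
  assumes x: "\<And>i. x $ i \<le> x' $ i" and [measurable]: "h \<in> borel_measurable borel"
  shows "(\<integral>\<^sup>+\<eta>. h \<eta> \<partial>face_measure I x x') = (\<integral>\<^sup>+s. h (place I x s) \<partial>box_measure (vec_nth x) (vec_nth x') I)"
proof -
  have "(\<integral>\<^sup>+\<eta>. h \<eta> \<partial>face_measure I x x')
    = (\<integral>\<^sup>+\<eta>. h \<eta> * indicator (face I x x') \<eta> \<partial>completion (distr (\<Pi>\<^sub>M i\<in>I. lborel) borel (place I x)))"
    unfolding face_measure_eq by (subst nn_integral_restrict_space) (use face_sets_completion[of I x x'] in auto)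
  also have "\<dots> = (\<integral>\<^sup>+\<eta>. h \<eta> * indicator (face I x x') \<eta> \<partial>distr (\<Pi>\<^sub>M i\<in>I. lborel) borel (place I x))"
    by (rule nn_integral_completion)
  also have "\<dots> = (\<integral>\<^sup>+s. h (place I x s) * indicator (face I x x') (place I x s) \<partial>(\<Pi>\<^sub>M i\<in>I. lborel))"
    by (subst nn_integral_distr) auto
  also have "\<dots> = (\<integral>\<^sup>+s. h (place I x s) \<partial>box_measure (vec_nth x) (vec_nth x') I)"
    unfolding box_measure_eq_density place_in_face_indicator[OF x]
    by (subst nn_integral_density) (auto simp: mult.commute)
  finally show ?thesis .
qed

lemma
  fixes f :: "('n::finite) euclid \<Rightarrow> real"
  assumes x: "\<And>i. x $ i \<le> x' $ i" and f[measurable]: "f \<in> borel_measurable borel"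
  shows integral_face_measure:
      "(LINT \<eta>|face_measure I x x'. f \<eta>) = (LINT s|box_measure (vec_nth x) (vec_nth x') I. f (place I x s))"
    and integrable_face_measure:
      "integrable (face_measure I x x') f \<longleftrightarrow> integrable (box_measure (vec_nth x) (vec_nth x') I) (\<lambda>s. f (place I x s))"
proof -
  let ?L = "\<Pi>\<^sub>M i\<in>I. lborel :: real measure" and ?d = "distr (\<Pi>\<^sub>M i\<in>I. lborel) borel (place I x)"
  have pr: "(\<Prod>i\<in>I. indicator {x $ i..x' $ i} (s i) :: ennreal) = ennreal (\<Prod>i\<in>I. indicator {x $ i..x' $ i} (s i))" for s
    by (simp add: prod_ennreal[symmetric] ennreal_indicator)
  have "(LINT \<eta>|face_measure I x x'. f \<eta>) = (LINT \<eta>|completion ?d. indicator (face I x x') \<eta> *\<^sub>R f \<eta>)"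
    unfolding face_measure_eq by (subst integral_restrict_space) (use face_sets_completion[of I x x'] in auto)
  also have "\<dots> = (LINT \<eta>|?d. indicator (face I x x') \<eta> *\<^sub>R f \<eta>)"
    by (rule integral_completion) measurable
  also have "\<dots> = (LINT s|?L. indicator (face I x x') (place I x s) *\<^sub>R f (place I x s))"
    by (rule integral_distr) measurable
  also have "\<dots> = (LINT s|box_measure (vec_nth x) (vec_nth x') I. f (place I x s))"
    unfolding box_measure_eq_density place_in_face_indicator[OF x] pr
    by (subst integral_density) (auto intro!: prod_nonneg)
  finally show "(LINT \<eta>|face_measure I x x'. f \<eta>) = (LINT s|box_measure (vec_nth x) (vec_nth x') I. f (place I x s))" .
  have "integrable (face_measure I x x') f \<longleftrightarrow> integrable (completion ?d) (\<lambda>\<eta>. indicator (face I x x') \<eta> *\<^sub>R f \<eta>)"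
    unfolding face_measure_eq by (subst integrable_restrict_space) (use face_sets_completion[of I x x'] in auto)
  also have "\<dots> \<longleftrightarrow> integrable ?d (\<lambda>\<eta>. indicator (face I x x') \<eta> *\<^sub>R f \<eta>)"
    by (rule integrable_completion) measurable
  also have "\<dots> \<longleftrightarrow> integrable ?L (\<lambda>s. indicator (face I x x') (place I x s) *\<^sub>R f (place I x s))"
    by (rule integrable_distr_eq) measurable
  also have "\<dots> \<longleftrightarrow> integrable (box_measure (vec_nth x) (vec_nth x') I) (\<lambda>s. f (place I x s))"
    unfolding box_measure_eq_density place_in_face_indicator[OF x] pr
    by (subst integrable_density) (auto intro!: prod_nonneg)
  finally show "integrable (face_measure I x x') f \<longleftrightarrow> integrable (box_measure (vec_nth x) (vec_nth x') I) (\<lambda>s. f (place I x s))" .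
qed

lemma face_measure_UNIV:
  fixes x x' :: "('n::finite) euclid"
  shows "face_measure UNIV x x' = restrict_space lebesgue (cbox x x')"
proof -
  have "face UNIV x x' = cbox x x'" by (auto simp: face_def mem_box_cart)
  then show ?thesis by (simp add: face_measure_eq lborel_vec)
qed

section \<open>The Newton-Leibniz formula for smooth families\<close>

lemma integral_segment_measure:
  fixes f :: "real \<Rightarrow> real"
  assumes "f \<in> borel_measurable borel"
  shows "(LINT t|segment_measure c d. f t) = (LINT t|lborel. f t * indicator {c..d} t)"
proof -
  have "(LINT t|segment_measure c d. f t) = (LINT t|density lborel (\<lambda>t. ennreal (indicator {c..d} t)). f t)"
    by (simp add: segment_measure_def ennreal_indicator)
  also have "\<dots> = (LINT t|lborel. f t * indicator {c..d} t)"
    using assms by (subst integral_density) (auto simp: mult.commute)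
  finally show ?thesis .
qed

lemma integral_segment_measure_FTC:
  fixes f f' :: "real \<Rightarrow> real"
  assumes "c \<le> d" and f: "\<And>t. (f has_real_derivative f' t) (at t)" and f': "continuous_on UNIV f'"
  shows "(LINT t|segment_measure c d. f' t) = f d - f c"
proof -
  have "(LINT t|lborel. f' t * indicator {c..d} t) = f d - f c"
    by (rule integral_FTC_Icc_real) (use assms continuous_on_eq_continuous_at[OF open_UNIV, of f'] in auto)
  then show ?thesis
    by (subst integral_segment_measure) (auto intro: borel_measurable_continuous_onI[OF f'])
qed

text \<open>
  The integrand is the derivative of \<open>- (1 - t) * f t\<close>, which vanishes at 1.
\<close>
lemma unit_interval_representation:
  fixes f f' :: "real \<Rightarrow> real"
  assumes f: "\<And>t. (f has_real_derivative f' t) (at t)" and f': "continuous_on UNIV f'"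
  shows "f 0 = (LINT t|segment_measure 0 1. f t - (1 - t) * f' t)"
proof -
  have cf: "continuous_on UNIV f"
    using f by (meson DERIV_isCont continuous_at_imp_continuous_on)
  have "(LINT t|segment_measure 0 1. f t - (1 - t) * f' t) = - (1 - 1) * f 1 - (- (1 - 0) * f 0)"
    by (rule integral_segment_measure_FTC)
      (auto intro!: derivative_eq_intros f continuous_intros cf f' simp: algebra_simps)
  then show ?thesis by simp
qed

lemma mixed_family_continuous: "mixed_family F \<Longrightarrow> continuous_on UNIV (F J)"
  by (simp add: mixed_family_def)

lemma mixed_family_DERIV:
  assumes F: "mixed_family F" and i: "i \<notin> J"
  shows "((\<lambda>t. F J (x + t *\<^sub>R axis i 1)) has_real_derivative F (insert i J) (x + t *\<^sub>R axis i 1)) (at t)"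
proof -
  have "((\<lambda>s. F J (x + t *\<^sub>R axis i 1 + s *\<^sub>R axis i 1)) has_real_derivative F (insert i J) (x + t *\<^sub>R axis i 1)) (at 0)"
    using F i by (simp add: mixed_family_def)
  then show ?thesis
    using DERIV_shift[of "\<lambda>t. F J (x + t *\<^sub>R axis i 1)" "F (insert i J) (x + t *\<^sub>R axis i 1)" 0 t]
    by (simp add: scaleR_add_left algebra_simps)
qed

lemma mixed_family_line_continuous:
  assumes F: "mixed_family F"
  shows "continuous_on UNIV (\<lambda>t. F J (x + t *\<^sub>R axis i 1))"
  by (intro continuous_on_compose2[OF mixed_family_continuous[OF F]] continuous_intros) auto

lemma sum_Pow_insert:
  assumes "finite D" "i \<notin> D"
  shows "(\<Sum>K\<in>Pow (insert i D). f K) = (\<Sum>K\<in>Pow D. f K + f (insert i K))"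
proof -
  have "inj_on (insert i) (Pow D)" using assms by (intro inj_onI) (metis PowD insert_ident subsetD)
  moreover have "Pow D \<inter> insert i ` Pow D = {}" using assms by auto
  ultimately show ?thesis
    using assms by (simp add: Pow_insert sum.union_disjoint sum.reindex sum.distrib)
qed

lemma continuous_bounded_cbox:
  fixes f :: "'a::euclidean_space \<Rightarrow> real"
  assumes "continuous_on UNIV f"
  obtains B where "\<And>x. x \<in> cbox a b \<Longrightarrow> \<bar>f x\<bar> \<le> B" "B \<ge> 0"
proof -
  have "bounded (f ` cbox a b)"
    by (intro compact_imp_bounded compact_continuous_image continuous_on_subset[OF assms]) auto
  then obtain B where B: "\<And>x. x \<in> cbox a b \<Longrightarrow> \<bar>f x\<bar> \<le> B" by (fastforce simp: bounded_iff)
  show thesis by (rule that[of "max B 0"]) (use B in \<open>auto simp: max.coboundedI1\<close>)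
qed

lemma integrable_place:
  fixes f :: "('n::finite) euclid \<Rightarrow> real"
  assumes "continuous_on UNIV f"
  shows "integrable (box_measure a b I) (\<lambda>s. f (place I y s))"
proof -
  obtain B where B: "\<And>x. x \<in> cbox (place I y a) (place I y b) \<Longrightarrow> \<bar>f x\<bar> \<le> B"
    using continuous_bounded_cbox[OF assms] by blast
  have [measurable]: "f \<in> borel_measurable borel" by (rule borel_measurable_continuous_onI[OF assms])
  show ?thesis
    by (rule integrable_box_measure[where B = B]) (auto intro!: B simp: mem_box_cart)
qed

lemma box_measure_integral_insert:
  fixes f :: "('n::finite \<Rightarrow> real) \<Rightarrow> real"
  assumes "i \<notin> I" and "integrable (box_measure a b (insert i I)) f"
  shows "(LINT s|box_measure a b (insert i I). f s) =
    (LINT s|box_measure a b I. (LINT t|segment_measure (a i) (b i). f (s(i := t))))"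
  using assms product_sigma_finite.product_integral_insert[OF product_interval, of I i a b f]
  by (simp add: box_measure_def)

lemma integral_box_measure_empty: "(LINT s|box_measure a b {}. f s) = (f (\<lambda>_. undefined) :: real)"
  unfolding box_measure_def PiM_empty by (subst lebesgue_integral_count_space_finite) auto

text \<open>
  Raise the coordinates in \<open>D\<close> from \<open>a\<close> to \<open>b\<close> one at a time. Raising coordinate \<open>i\<close> changes the
  integrand over each face found so far by the integral of its derivative in direction \<open>i\<close>, that is, it
  adds the face extended by that direction.
\<close>
lemma newton_leibniz_family:
  fixes F :: "('n::finite) set \<Rightarrow> 'n euclid \<Rightarrow> real"
  assumes F: "mixed_family F" and ab: "\<And>i. a i \<le> b i"
    and y: "\<And>i. i \<in> D \<Longrightarrow> y $ i = a i"
  shows "F {} (place D y b) = (\<Sum>K\<in>Pow D. LINT s|box_measure a b K. F K (place K y s))"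
  using finite[of D] y
proof (induction D arbitrary: y rule: finite_induct)
  case empty
  then show ?case by (simp only: Pow_empty sum.insert_remove finite.emptyI integral_box_measure_empty) (simp add: place_def)
next
  case (insert i D)
  \<comment> \<open>raise the new coordinate first: the induction hypothesis is used at the base point \<open>?y'\<close>\<close>
  let ?y' = "\<chi> j. if j = i then b i else y $ j"
  have "F {} (place (insert i D) y b) = F {} (place D ?y' b)"
    using insert.hyps by (intro arg_cong[where f = "F {}"]) (auto simp: place_def vec_eq_iff)
  also have "\<dots> = (\<Sum>K\<in>Pow D. LINT s|box_measure a b K. F K (place K ?y' s))"
    using insert.prems insert.hyps by (intro insert.IH) auto
  also have "\<dots> = (\<Sum>K\<in>Pow D. (LINT s|box_measure a b K. F K (place K y s))
      + (LINT s|box_measure a b (insert i K). F (insert i K) (place (insert i K) y s)))"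
  proof (rule sum.cong[OF refl])
    fix K assume "K \<in> Pow D"
    then have K: "i \<notin> K" using insert.hyps by auto
    have yi: "y $ i = a i" using insert.prems by simp
    have "F K (place K ?y' s) = F K (place K y s)
        + (LINT t|segment_measure (a i) (b i). F (insert i K) (place (insert i K) y (s(i := t))))" for s
    proof -
      \<comment> \<open>subtracting \<open>y $ i\<close> makes the parameter along the line equal to the coordinate itself\<close>
      let ?z = "place K y s - y $ i *\<^sub>R axis i 1"
      have z: "?z + t *\<^sub>R axis i 1 = place (insert i K) y (s(i := t))" for t
        using K by (auto simp: vec_eq_iff axis_def)
      have "(LINT t|segment_measure (a i) (b i). F (insert i K) (?z + t *\<^sub>R axis i 1))
          = F K (?z + b i *\<^sub>R axis i 1) - F K (?z + a i *\<^sub>R axis i 1)"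
        by (rule integral_segment_measure_FTC[OF ab mixed_family_DERIV[OF F K] mixed_family_line_continuous[OF F]])
      moreover have "?z + b i *\<^sub>R axis i 1 = place K ?y' s" "?z + a i *\<^sub>R axis i 1 = place K y s"
        using K yi by (auto simp: vec_eq_iff axis_def)
      ultimately show ?thesis unfolding z by simp
    qed
    then have "(LINT s|box_measure a b K. F K (place K ?y' s)) = (LINT s|box_measure a b K. F K (place K y s)
        + (LINT t|segment_measure (a i) (b i). F (insert i K) (place (insert i K) y (s(i := t)))))"
      by simp
    also have "\<dots> = (LINT s|box_measure a b K. F K (place K y s))
        + (LINT s|box_measure a b K. (LINT t|segment_measure (a i) (b i). F (insert i K) (place (insert i K) y (s(i := t)))))"
    proof (rule Bochner_Integration.integral_add)
      show i1: "integrable (box_measure a b K) (\<lambda>s. F K (place K y s))"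
        by (rule integrable_place[OF mixed_family_continuous[OF F]])
      have "integrable (box_measure a b K) (\<lambda>s. F K (place K ?y' s) - F K (place K y s))"
        by (intro Bochner_Integration.integrable_diff integrable_place[OF mixed_family_continuous[OF F]])
      then show "integrable (box_measure a b K) (\<lambda>s. LINT t|segment_measure (a i) (b i). F (insert i K) (place (insert i K) y (s(i := t))))"
        by (simp add: \<open>\<And>s. F K (place K ?y' s) = _ s\<close> fun_upd_def)
    qed
    also have "(LINT s|box_measure a b K. (LINT t|segment_measure (a i) (b i). F (insert i K) (place (insert i K) y (s(i := t)))))
        = (LINT s|box_measure a b (insert i K). F (insert i K) (place (insert i K) y s))"
      by (rule box_measure_integral_insert[OF K integrable_place[OF mixed_family_continuous[OF F]], symmetric])
    finally show "(LINT s|box_measure a b K. F K (place K ?y' s)) = (LINT s|box_measure a b K. F K (place K y s))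
      + (LINT s|box_measure a b (insert i K). F (insert i K) (place (insert i K) y s))" .
  qed
  also have "\<dots> = (\<Sum>K\<in>Pow (insert i D). LINT s|box_measure a b K. F K (place K y s))"
    by (rule sum_Pow_insert[OF insert.hyps, symmetric])
  finally show ?case .
qed

section \<open>Averages over transversal cubes\<close>

definition unit_cube :: "'n set \<Rightarrow> ('n \<Rightarrow> real) measure" where
  "unit_cube D = box_measure (\<lambda>_. 0) (\<lambda>_. 1) D"

text \<open>
  If \<open>H K\<close> is the mixed derivative in the directions \<open>K\<close> of one smooth function \<open>H {}\<close>, then this is
  \<open>H {} \<eta>\<close>: it is the iterate over the directions in \<open>D\<close> of the identity
  $f(0) = \int_0^1 (f(t) - (1-t) f'(t))\,dt$.
\<close>
definition cube_average :: "'n set \<Rightarrow> ('n set \<Rightarrow> ('n::finite) euclid \<Rightarrow> real) \<Rightarrow> 'n euclid \<Rightarrow> real" where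
  "cube_average D H \<eta> = (\<Sum>K\<in>Pow D. (- 1) ^ card K *
     (LINT s|unit_cube D. (\<Prod>k\<in>K. 1 - s k) * H K (\<eta> + place D 0 s)))"

lemma prob_space_unit_cube: "prob_space (unit_cube (D :: ('n::finite) set))"
  unfolding unit_cube_def box_measure_def
  by (intro prob_space_PiM prob_spaceI) (simp add: emeasure_segment_measure)

lemma weight_measurable [measurable]:
  "K \<subseteq> D \<Longrightarrow> (\<lambda>s. \<Prod>k\<in>K. 1 - s k :: real) \<in> borel_measurable (\<Pi>\<^sub>M i\<in>D. borel)"
  by (intro borel_measurable_prod borel_measurable_diff) auto

lemma weight_bounds:
  assumes "K \<subseteq> D" "\<And>i. i \<in> D \<Longrightarrow> s i \<in> {0..1}"
  shows "(0::real) \<le> (\<Prod>k\<in>K. 1 - s k)" "(\<Prod>k\<in>K. 1 - s k :: real) \<le> 1"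
proof -
  have "0 \<le> 1 - s k \<and> 1 - s k \<le> 1" if "k \<in> K" for k using assms(1) assms(2)[of k] that by auto
  then show "(0::real) \<le> (\<Prod>k\<in>K. 1 - s k)" "(\<Prod>k\<in>K. 1 - s k :: real) \<le> 1"
    by (auto intro!: prod_nonneg prod_le_1)
qed

lemma integrable_cube_weight:
  fixes f :: "('n::finite) euclid \<Rightarrow> real"
  assumes f: "continuous_on UNIV f" and K: "K \<subseteq> D"
  shows "integrable (unit_cube D) (\<lambda>s. (\<Prod>k\<in>K. 1 - s k) * f (\<eta> + place D 0 s))"
proof -
  obtain B where B: "\<And>x. x \<in> cbox \<eta> (\<eta> + 1) \<Longrightarrow> \<bar>f x\<bar> \<le> B" "B \<ge> 0"
    using continuous_bounded_cbox[OF f] by blast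
  have [measurable]: "f \<in> borel_measurable borel" by (rule borel_measurable_continuous_onI[OF f])
  have [measurable]: "(\<lambda>s. \<Prod>k\<in>K. 1 - s k :: real) \<in> borel_measurable (\<Pi>\<^sub>M i\<in>D. borel)"
    by (rule weight_measurable[OF K])
  show ?thesis
    unfolding unit_cube_def
  proof (rule integrable_box_measure[where B = B])
    fix s assume s: "\<And>i. i \<in> D \<Longrightarrow> s i \<in> {0..1::real}"
    have "\<eta> + place D 0 s \<in> cbox \<eta> (\<eta> + 1)" using s by (auto simp: mem_box_cart)
    then have "\<bar>\<Prod>k\<in>K. 1 - s k\<bar> * \<bar>f (\<eta> + place D 0 s)\<bar> \<le> 1 * B"
      using weight_bounds[OF K s] B by (intro mult_mono) auto
    then show "\<bar>(\<Prod>k\<in>K. 1 - s k) * f (\<eta> + place D 0 s)\<bar> \<le> B" by (simp add: abs_mult)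
  qed measurable
qed

text \<open>
  Apply the one-dimensional identity in the new direction \<open>i\<close> inside the integral of every summand.
  Its first term keeps the index set \<open>K\<close>; its second term supplies the weight \<open>1 - t\<close>, the sign and the
  index set \<open>insert i K\<close>.
\<close>
lemma cube_average_mixed_family:
  fixes F :: "('n::finite) set \<Rightarrow> 'n euclid \<Rightarrow> real"
  assumes F: "mixed_family F" and "I \<inter> D = {}"
  shows "F I \<eta> = cube_average D (\<lambda>K. F (I \<union> K)) \<eta>"
  using finite[of D] assms(2)
proof (induction D rule: finite_induct)
  case empty
  have "place {} 0 s = (0 :: 'n euclid)" for s by (simp add: vec_eq_iff)
  then show ?case
    by (simp only: cube_average_def unit_cube_def integral_box_measure_empty) (simp add: integral_box_measure_empty del: lebesgue_integral_const)
next
  case (insert i D)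
  have iD: "i \<notin> D" and iI: "i \<notin> I" using insert by auto
  let ?w = "\<lambda>K s. \<Prod>k\<in>K. 1 - s k :: real"
  let ?z = "\<lambda>s. \<eta> + place D 0 s" and ?z' = "\<lambda>s. \<eta> + place (insert i D) 0 s"
  let ?f = "\<lambda>K s. ?w K s * F (I \<union> K) (?z' s)"
  have step: "(LINT s|unit_cube D. ?w K s * F (I \<union> K) (?z s))
      = (LINT s|unit_cube (insert i D). ?f K s) - (LINT s|unit_cube (insert i D). ?f (insert i K) s)"
    if "K \<in> Pow D" for K
  proof -
    have K: "K \<subseteq> D" "i \<notin> K" using that iD by auto
    have int: "integrable (unit_cube (insert i D)) (?f K)" "integrable (unit_cube (insert i D)) (?f (insert i K))"
      by (rule integrable_cube_weight[OF mixed_family_continuous[OF F]], use K in blast)+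
    have "?w K s * F (I \<union> K) (?z s)
        = (LINT t|segment_measure 0 1. ?f K (s(i := t)) - ?f (insert i K) (s(i := t)))" for s
    proof -
      have zt: "?z s + t *\<^sub>R axis i 1 = ?z' (s(i := t))" for t
        using iD by (auto simp: vec_eq_iff axis_def)
      have iIK: "i \<notin> I \<union> K" using K iI by auto
      have w1: "?w K (s(i := t)) = ?w K s" for t
        using K by (intro prod.cong) auto
      have w2: "?w (insert i K) (s(i := t)) = (1 - t) * ?w K s" for t
        using K w1[of t] finite[of K] by (subst prod.insert) auto
      have "F (I \<union> K) (?z s + 0 *\<^sub>R axis i 1) = (LINT t|segment_measure 0 1.
          F (I \<union> K) (?z s + t *\<^sub>R axis i 1) - (1 - t) * F (insert i (I \<union> K)) (?z s + t *\<^sub>R axis i 1))"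
        by (rule unit_interval_representation[OF mixed_family_DERIV[OF F iIK] mixed_family_line_continuous[OF F]])
      then have "?w K s * F (I \<union> K) (?z s) = ?w K s * (LINT t|segment_measure 0 1.
          F (I \<union> K) (?z' (s(i := t))) - (1 - t) * F (I \<union> insert i K) (?z' (s(i := t))))"
        unfolding zt[symmetric] by simp
      also have "\<dots> = (LINT t|segment_measure 0 1. ?f K (s(i := t)) - ?f (insert i K) (s(i := t)))"
        unfolding w1 w2 by (subst integral_mult_right_zero[symmetric]) (simp add: algebra_simps)
      finally show ?thesis .
    qed
    then have "(LINT s|unit_cube D. ?w K s * F (I \<union> K) (?z s))
      = (LINT s|unit_cube D. LINT t|segment_measure 0 1. ?f K (s(i := t)) - ?f (insert i K) (s(i := t)))"
      by simp
    also have "\<dots> = (LINT s|unit_cube (insert i D). ?f K s - ?f (insert i K) s)"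
      unfolding unit_cube_def
      by (rule box_measure_integral_insert[OF iD, symmetric])
        (use Bochner_Integration.integrable_diff[OF int] in \<open>simp add: unit_cube_def\<close>)
    also have "\<dots> = (LINT s|unit_cube (insert i D). ?f K s) - (LINT s|unit_cube (insert i D). ?f (insert i K) s)"
      by (rule Bochner_Integration.integral_diff[OF int])
    finally show ?thesis .
  qed
  have "F I \<eta> = cube_average D (\<lambda>K. F (I \<union> K)) \<eta>" using insert by auto
  also have "\<dots> = (\<Sum>K\<in>Pow D. (- 1) ^ card K * (LINT s|unit_cube (insert i D). ?f K s)
      + (- 1) ^ card (insert i K) * (LINT s|unit_cube (insert i D). ?f (insert i K) s))"
    unfolding cube_average_def
  proof (rule sum.cong[OF refl])
    fix K assume K: "K \<in> Pow D"
    then have "i \<notin> K" using iD by auto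
    then show "(- 1) ^ card K * (LINT s|unit_cube D. ?w K s * F (I \<union> K) (?z s))
      = (- 1) ^ card K * (LINT s|unit_cube (insert i D). ?f K s)
      + (- 1) ^ card (insert i K) * (LINT s|unit_cube (insert i D). ?f (insert i K) s)"
      unfolding step[OF K] by (simp add: algebra_simps)
  qed
  also have "\<dots> = cube_average (insert i D) (\<lambda>K. F (I \<union> K)) \<eta>"
    unfolding cube_average_def by (rule sum_Pow_insert[OF insert.hyps, symmetric])
  finally show ?case .
qed

lemma cube_average_measurable [measurable]:
  assumes [measurable]: "\<And>K. H K \<in> borel_measurable borel"
  shows "cube_average D H \<in> borel_measurable borel"
proof -
  interpret prob_space "unit_cube D" by (rule prob_space_unit_cube)
  have [measurable_cong]: "sets (unit_cube D) = sets (\<Pi>\<^sub>M i\<in>D. borel)"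
    unfolding unit_cube_def by (rule sets_box_measure)
  have "(\<lambda>\<eta>. LINT s|unit_cube D. (\<Prod>k\<in>K. 1 - s k) * H K (\<eta> + place D 0 s)) \<in> borel_measurable borel"
    if "K \<in> Pow D" for K
  proof -
    have [measurable]: "(\<lambda>s. \<Prod>k\<in>K. 1 - s k :: real) \<in> borel_measurable (\<Pi>\<^sub>M i\<in>D. borel)"
      by (rule weight_measurable) (use that in auto)
    show ?thesis by measurable
  qed
  then show ?thesis
    unfolding cube_average_def[abs_def] by (intro borel_measurable_sum borel_measurable_times) auto
qed

text \<open>
  A box in the directions \<open>I\<close> and a unit cube in the complementary directions together form a
  full-dimensional box, so this is Tonelli's theorem after a translation.
\<close>
lemma nn_integral_box_cube:
  fixes h :: "('n::finite) euclid \<Rightarrow> ennreal"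
  assumes [measurable]: "h \<in> borel_measurable borel"
  shows "(\<integral>\<^sup>+s. (\<integral>\<^sup>+t. h (place I x s + place (- I) 0 t) \<partial>unit_cube (- I)) \<partial>box_measure a b I)
    = (\<integral>\<^sup>+y. h y * indicator (cbox (place I x a) (place I (x + 1) b)) y \<partial>lborel)"
proof -
  let ?a = "\<lambda>i. if i \<in> I then a i else 0" and ?b = "\<lambda>i. if i \<in> I then b i else 1"
  \<comment> \<open>the part of the base point that translates the unit cube into place\<close>
  let ?x = "place I x (\<lambda>_. 0)"
  let ?h = "\<lambda>y. h (y + ?x)"
  interpret product_sigma_finite "\<lambda>i. segment_measure (?a i) (?b i)" by (rule product_interval)
  have I: "box_measure a b I = (\<Pi>\<^sub>M i\<in>I. segment_measure (?a i) (?b i))"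
    and D: "unit_cube (- I) = (\<Pi>\<^sub>M i\<in>- I. segment_measure (?a i) (?b i))"
    unfolding box_measure_def unit_cube_def by (auto intro!: PiM_cong)
  have U: "I \<union> - I = UNIV" "I \<inter> - I = {}" by auto
  have [measurable]: "place UNIV 0 \<in> (\<Pi>\<^sub>M i\<in>UNIV. segment_measure (?a i) (?b i)) \<rightarrow>\<^sub>M borel"
    using place_measurable[of UNIV 0] by (simp cong: measurable_cong_sets[OF sets_PiM_cong[OF refl sets_segment_measure] refl])
  have "(\<integral>\<^sup>+y. h y * indicator (cbox (place I x a) (place I (x + 1) b)) y \<partial>lborel)
    = (\<integral>\<^sup>+y. h y * indicator (cbox (place I x a) (place I (x + 1) b)) y \<partial>distr lborel borel ((+) ?x))"
    by (simp add: lborel_distr_plus)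
  also have "\<dots> = (\<integral>\<^sup>+y. ?h y * indicator (cbox (place I x a) (place I (x + 1) b)) (y + ?x) \<partial>lborel)"
    by (subst nn_integral_distr) (auto simp: add.commute)
  also have "\<dots> = (\<integral>\<^sup>+y\<in>cbox (\<chi> i. ?a i) (\<chi> i. ?b i). ?h y \<partial>lborel)"
  proof (rule nn_integral_cong)
    fix y :: "'n euclid"
    have "y + ?x \<in> cbox (place I x a) (place I (x + 1) b) \<longleftrightarrow> y \<in> cbox (\<chi> i. ?a i) (\<chi> i. ?b i)"
      unfolding mem_box_cart by (intro all_cong1) auto
    then show "?h y * indicator (cbox (place I x a) (place I (x + 1) b)) (y + ?x)
        = ?h y * indicator (cbox (\<chi> i. ?a i) (\<chi> i. ?b i)) y"
      by (simp add: indicator_def)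
  qed
  also have "\<dots> = (\<integral>\<^sup>+s. ?h (place UNIV 0 s) \<partial>box_measure ?a ?b UNIV)"
    by (rule nn_integral_box_measure_UNIV[symmetric]) measurable
  also have "\<dots> = (\<integral>\<^sup>+s. (\<integral>\<^sup>+t. ?h (place UNIV 0 (merge I (- I) (s, t))) \<partial>unit_cube (- I)) \<partial>box_measure a b I)"
    unfolding I D unfolding box_measure_def
    using product_nn_integral_fold[OF U(2), of "\<lambda>s. ?h (place UNIV 0 s)"]
    by (simp add: U(1))
  also have "\<dots> = (\<integral>\<^sup>+s. (\<integral>\<^sup>+t. h (place I x s + place (- I) 0 t) \<partial>unit_cube (- I)) \<partial>box_measure a b I)"
    by (intro nn_integral_cong arg_cong[where f = h]) (auto simp: vec_eq_iff merge_def)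
  finally show ?thesis by simp
qed

text \<open>
  The unit cube is a probability space and the weights lie between 0 and 1, so Jensen's inequality
  applies to each summand.
\<close>
lemma cube_average_diff_powr_le:
  fixes G F :: "('n::finite) set \<Rightarrow> 'n euclid \<Rightarrow> real"
  assumes G[measurable]: "\<And>K. G K \<in> borel_measurable borel" and F: "\<And>K. continuous_on UNIV (F K)" and q: "q \<ge> 1"
  shows "ennreal (\<bar>cube_average D G \<eta> - cube_average D F \<eta>\<bar> powr q) \<le>
    ennreal (card (Pow D) powr q) * (\<Sum>K\<in>Pow D. \<integral>\<^sup>+s. ennreal (\<bar>G K (\<eta> + place D 0 s) - F K (\<eta> + place D 0 s)\<bar> powr q) \<partial>unit_cube D)"
proof -
  let ?w = "\<lambda>K s. \<Prod>k\<in>K. 1 - s k :: real"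
  let ?g = "\<lambda>K s. ?w K s * G K (\<eta> + place D 0 s)" and ?f = "\<lambda>K s. ?w K s * F K (\<eta> + place D 0 s)"
  let ?d = "\<lambda>K. (LINT s|unit_cube D. ?g K s) - (LINT s|unit_cube D. ?f K s)"
  interpret prob_space "unit_cube D" by (rule prob_space_unit_cube)
  have [measurable_cong]: "sets (unit_cube D) = sets (\<Pi>\<^sub>M i\<in>D. borel)"
    unfolding unit_cube_def by (rule sets_box_measure)
  have "cube_average D G \<eta> - cube_average D F \<eta> = (\<Sum>K\<in>Pow D. (- 1) ^ card K * ?d K)"
    by (simp add: cube_average_def sum_subtractf right_diff_distrib)
  then have "\<bar>cube_average D G \<eta> - cube_average D F \<eta>\<bar> powr q \<le>
     card (Pow D) powr q * (\<Sum>K\<in>Pow D. \<bar>?d K\<bar> powr q)"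
    using sum_powr_le[of "Pow D" q "\<lambda>K. (- 1) ^ card K * ?d K"] q by (simp add: abs_mult power_abs)
  then have "ennreal (\<bar>cube_average D G \<eta> - cube_average D F \<eta>\<bar> powr q) \<le>
     ennreal (card (Pow D) powr q) * (\<Sum>K\<in>Pow D. ennreal (\<bar>?d K\<bar> powr q))"
    by (simp add: sum_nonneg flip: ennreal_mult)
  also have "\<dots> \<le> ennreal (card (Pow D) powr q) * (\<Sum>K\<in>Pow D. \<integral>\<^sup>+s. ennreal (\<bar>G K (\<eta> + place D 0 s) - F K (\<eta> + place D 0 s)\<bar> powr q) \<partial>unit_cube D)"
  proof (intro mult_left_mono sum_mono)
    fix K assume "K \<in> Pow D"
    then have K: "K \<subseteq> D" by simp
    have [measurable]: "(\<lambda>s. ?w K s) \<in> borel_measurable (\<Pi>\<^sub>M i\<in>D. borel)"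
      by (rule weight_measurable[OF K])
    have "ennreal (\<bar>?d K\<bar> powr q) \<le> (\<integral>\<^sup>+s. ennreal (\<bar>?g K s - ?f K s\<bar> powr q) \<partial>unit_cube D)"
      by (rule jensen_powr_diff[OF _ integrable_cube_weight[OF F K] q]) measurable
    also have "\<dots> \<le> (\<integral>\<^sup>+s. ennreal (\<bar>G K (\<eta> + place D 0 s) - F K (\<eta> + place D 0 s)\<bar> powr q) \<partial>unit_cube D)"
    proof (rule nn_integral_mono_AE)
      have "AE s in unit_cube D. \<forall>i\<in>D. s i \<in> {0..1}"
        unfolding unit_cube_def using AE_box_measure[of D "\<lambda>_. 0" "\<lambda>_. 1"] by simp
      then show "AE s in unit_cube D. ennreal (\<bar>?g K s - ?f K s\<bar> powr q)
          \<le> ennreal (\<bar>G K (\<eta> + place D 0 s) - F K (\<eta> + place D 0 s)\<bar> powr q)"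
      proof eventually_elim
        case (elim s)
        have "\<bar>?g K s - ?f K s\<bar> = ?w K s * \<bar>G K (\<eta> + place D 0 s) - F K (\<eta> + place D 0 s)\<bar>"
          using weight_bounds(1)[of K D s] K elim by (simp add: abs_mult flip: right_diff_distrib)
        also have "\<dots> \<le> 1 * \<bar>G K (\<eta> + place D 0 s) - F K (\<eta> + place D 0 s)\<bar>"
          using weight_bounds[of K D s] K elim by (intro mult_right_mono) auto
        finally show ?case using q by (intro ennreal_leI powr_mono2) auto
      qed
    qed
    finally show "ennreal (\<bar>?d K\<bar> powr q) \<le> (\<integral>\<^sup>+s. ennreal (\<bar>G K (\<eta> + place D 0 s) - F K (\<eta> + place D 0 s)\<bar> powr q) \<partial>unit_cube D)" .
  qed simp
  finally show ?thesis .
qed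

text \<open>
  The central estimate: the \<open>L_q\<close> distance on a face is controlled by \<open>L_q\<close> distances on a
  full-dimensional box.
\<close>
lemma face_cube_average_le:
  fixes G F :: "('n::finite) set \<Rightarrow> 'n euclid \<Rightarrow> real"
  assumes G[measurable]: "\<And>K. G K \<in> borel_measurable borel" and F: "\<And>K. continuous_on UNIV (F K)" and q: "q \<ge> 1"
  shows "(\<integral>\<^sup>+s. ennreal (\<bar>cube_average (- I) G (place I x s) - cube_average (- I) F (place I x s)\<bar> powr q) \<partial>box_measure a b I)
    \<le> ennreal (card (Pow (- I)) powr q) * (\<Sum>K\<in>Pow (- I).
      \<integral>\<^sup>+y. ennreal (\<bar>G K y - F K y\<bar> powr q) * indicator (cbox (place I x a) (place I (x + 1) b)) y \<partial>lborel)"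
proof -
  have [measurable]: "F K \<in> borel_measurable borel" for K by (rule borel_measurable_continuous_onI[OF F])
  interpret prob_space "unit_cube (- I)" by (rule prob_space_unit_cube)
  have [measurable_cong]: "sets (unit_cube (- I)) = sets (\<Pi>\<^sub>M i\<in>- I. borel)"
    unfolding unit_cube_def by (rule sets_box_measure)
  let ?D = "- I"
  let ?h = "\<lambda>K y. ennreal (\<bar>G K y - F K y\<bar> powr q)"
  have "(\<integral>\<^sup>+s. ennreal (\<bar>cube_average ?D G (place I x s) - cube_average ?D F (place I x s)\<bar> powr q) \<partial>box_measure a b I)
    \<le> (\<integral>\<^sup>+s. ennreal (card (Pow ?D) powr q) * (\<Sum>K\<in>Pow ?D. \<integral>\<^sup>+t. ?h K (place I x s + place ?D 0 t) \<partial>unit_cube ?D) \<partial>box_measure a b I)"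
    by (intro nn_integral_mono cube_average_diff_powr_le G F q)
  also have "\<dots> = ennreal (card (Pow ?D) powr q) * (\<Sum>K\<in>Pow ?D. \<integral>\<^sup>+s. \<integral>\<^sup>+t. ?h K (place I x s + place ?D 0 t) \<partial>unit_cube ?D \<partial>box_measure a b I)"
    by (subst nn_integral_cmult, measurable, subst nn_integral_sum) measurable
  also have "\<dots> = ennreal (card (Pow ?D) powr q) * (\<Sum>K\<in>Pow ?D.
      \<integral>\<^sup>+y. ?h K y * indicator (cbox (place I x a) (place I (x + 1) b)) y \<partial>lborel)"
    by (subst nn_integral_box_cube) measurable
  finally show ?thesis .
qed

section \<open>Traces of weak derivatives\<close>

lemma nn_integral_box_measure_empty:
  "(\<integral>\<^sup>+s. f s \<partial>box_measure a b {}) = f (\<lambda>_. undefined)"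
  unfolding box_measure_def PiM_empty by (subst nn_integral_count_space_finite) auto

lemma place_empty [simp]: "place {} x s = x"
  by (simp add: vec_eq_iff)

lemma cube_average_zero [simp]: "cube_average D (\<lambda>K x. 0) \<eta> = 0"
  by (simp add: cube_average_def)

lemma cube_average_empty: "cube_average {} H \<eta> = H {} \<eta>"
  unfolding cube_average_def unit_cube_def
  by (simp only: Pow_empty integral_box_measure_empty) simp

text \<open>
  The case \<open>I = {}\<close> of the central estimate, in which the face is a point. The bound is uniform on the
  box from \<open>c\<close> to \<open>d\<close> because all unit cubes attached to its points lie in one larger box.
\<close>
lemma cube_average_diff_le:
  fixes G F :: "('n::finite) set \<Rightarrow> 'n euclid \<Rightarrow> real"
  assumes G[measurable]: "\<And>K. G K \<in> borel_measurable borel" and F: "\<And>K. continuous_on UNIV (F K)"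
    and x: "x \<in> cbox c d"
  shows "ennreal \<bar>cube_average UNIV G x - cube_average UNIV F x\<bar>
    \<le> ennreal (2 ^ CARD('n)) * (\<Sum>K\<in>UNIV. \<integral>\<^sup>+y\<in>cbox c (d + 1). ennreal \<bar>G K y - F K y\<bar> \<partial>lborel)"
proof -
  have "ennreal \<bar>cube_average UNIV G x - cube_average UNIV F x\<bar> \<le> ennreal (2 ^ CARD('n)) * (\<Sum>K\<in>UNIV.
      \<integral>\<^sup>+y\<in>cbox x (x + 1). ennreal \<bar>G K y - F K y\<bar> \<partial>lborel)"
    using face_cube_average_le[where G = G and F = F and q = 1 and I = "{}" and x = x, OF G F, unfolded nn_integral_box_measure_empty place_empty]
    by (simp add: card_Pow)
  also have "\<dots> \<le> ennreal (2 ^ CARD('n)) * (\<Sum>K\<in>UNIV. \<integral>\<^sup>+y\<in>cbox c (d + 1). ennreal \<bar>G K y - F K y\<bar> \<partial>lborel)"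
  proof (rule mult_left_mono[OF sum_mono[OF nn_integral_mono]])
    fix K y
    have "cbox x (x + 1) \<subseteq> cbox c (d + 1)"
    proof
      fix z assume z: "z \<in> cbox x (x + 1)"
      have "c $ i \<le> z $ i \<and> z $ i \<le> (d + 1) $ i" for i
      proof -
        have "c $ i \<le> x $ i" "x $ i \<le> d $ i" "x $ i \<le> z $ i" "z $ i \<le> x $ i + 1"
          using x z by (auto simp: mem_box_cart)
        then show ?thesis by simp
      qed
      then show "z \<in> cbox c (d + 1)" by (simp add: mem_box_cart)
    qed
    then show "ennreal \<bar>G K y - F K y\<bar> * indicator (cbox x (x + 1)) y \<le> ennreal \<bar>G K y - F K y\<bar> * indicator (cbox c (d + 1)) y"
      by (auto simp: indicator_def)
  qed simp
  finally show ?thesis .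
qed

lemma tendsto_sum_cmult_zero:
  fixes f :: "'a \<Rightarrow> 'b \<Rightarrow> ennreal"
  assumes "c < \<infinity>" "\<And>K. K \<in> A \<Longrightarrow> ((\<lambda>e. f e K) \<longlongrightarrow> 0) F"
  shows "((\<lambda>e. c * (\<Sum>K\<in>A. f e K)) \<longlongrightarrow> 0) F"
proof -
  have "((\<lambda>e. c * (\<Sum>K\<in>A. f e K)) \<longlongrightarrow> c * (\<Sum>K\<in>A. 0)) F"
    by (intro ennreal_tendsto_cmult tendsto_sum assms) (use assms in auto)
  then show ?thesis by simp
qed

lemma tendsto_zero_ennreal_mono:
  fixes f g :: "'a \<Rightarrow> ennreal"
  assumes "(g \<longlongrightarrow> 0) F" "\<forall>\<^sub>F e in F. f e \<le> g e"
  shows "(f \<longlongrightarrow> 0) F"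
  by (rule tendsto_sandwich[of "\<lambda>_. 0" f F g]) (use assms in auto)

lemma integrable_of_L1_limit:
  fixes g :: "'a \<Rightarrow> real"
  assumes lim: "((\<lambda>e. \<integral>\<^sup>+x. ennreal \<bar>f e x - g x\<bar> \<partial>M) \<longlongrightarrow> 0) F" and F: "F \<noteq> bot"
    and f: "\<forall>\<^sub>F e in F. integrable M (f e)" and g[measurable]: "g \<in> borel_measurable M"
  shows "integrable M g" "((\<lambda>e. LINT x|M. f e x) \<longlongrightarrow> (LINT x|M. g x)) F"
proof -
  have "\<forall>\<^sub>F e in F. (\<integral>\<^sup>+x. ennreal \<bar>f e x - g x\<bar> \<partial>M) < 1"
    using lim by (rule order_tendstoD) simp
  with f have "\<forall>\<^sub>F e in F. integrable M (f e) \<and> (\<integral>\<^sup>+x. ennreal \<bar>f e x - g x\<bar> \<partial>M) < 1"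
    by eventually_elim simp
  from eventually_happens'[OF F this] obtain e where e: "integrable M (f e)" "(\<integral>\<^sup>+x. ennreal \<bar>f e x - g x\<bar> \<partial>M) < 1" by blast
  have "integrable M (\<lambda>x. f e x - g x)"
    by (rule integrableI_bounded) (use e in \<open>auto intro: less_trans\<close>)
  from Bochner_Integration.integrable_diff[OF e(1) this] show g': "integrable M g" by simp
  let ?f = "\<lambda>e. if integrable M (f e) then f e else g"
  have ev: "\<forall>\<^sub>F e in F. ?f e = f e" using f by eventually_elim simp
  have "((\<lambda>e. LINT x|M. ?f e x) \<longlongrightarrow> (LINT x|M. g x)) F"
  proof (rule tendsto_L1_int[OF _ g'])
    show "integrable M (?f e)" for e using g' by simp
    show "((\<lambda>e. \<integral>\<^sup>+x. norm (?f e x - g x) \<partial>M) \<longlongrightarrow> 0) F"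
      by (rule Lim_transform_eventually[OF lim]) (use ev in eventually_elim, simp)
  qed
  then show "((\<lambda>e. LINT x|M. f e x) \<longlongrightarrow> (LINT x|M. g x)) F"
    by (rule Lim_transform_eventually) (use ev in eventually_elim, simp)
qed

text \<open>
  Borel representatives of all weak mixed derivatives. Lebesgue measurability would not be
  enough to make their restrictions to lower-dimensional slices measurable. \<open>G {}\<close> represents \<open>u\<close> itself.
\<close>
locale weak_deriv_family =
  fixes u :: "('n::{finite,linorder}) euclid \<Rightarrow> real" and G :: "'n set \<Rightarrow> 'n euclid \<Rightarrow> real"
  assumes borel [measurable]: "\<And>J. G J \<in> borel_measurable borel"
    and weak: "\<And>J. has_weak_deriv J u (G J)"
begin

text \<open>
  The trace is given by an explicit formula, which makes sense at all points because the integral of a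
  non-integrable slice has the value 0. One function serves for all faces in the directions \<open>I\<close>.
\<close>

definition face_trace :: "'n set \<Rightarrow> 'n euclid \<Rightarrow> real" where
  "face_trace I = cube_average (- I) (\<lambda>K. G (I \<union> K))"

lemma face_trace_measurable [measurable]: "face_trace I \<in> borel_measurable borel"
  unfolding face_trace_def by (rule cube_average_measurable) simp

lemma face_trace_UNIV: "face_trace UNIV = G UNIV"
  by (simp add: face_trace_def fun_eq_iff cube_average_empty)

lemma locally_L1: "(\<integral>\<^sup>+x\<in>cbox a b. ennreal (\<bar>G J x\<bar> powr 1) \<partial>lborel) < \<infinity>"
  using locally_integrable_cbox_finite[OF _ borel] weak[of J] by (simp add: has_weak_deriv_def)

text \<open>
  A mollified weak derivative is reproduced by the averages of the further ones, so that it can be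
  compared with \<open>face_trace\<close> through \<open>face_cube_average_le\<close>.
\<close>
lemma mollify_cube_average:
  assumes "mollifier \<phi>" "\<epsilon> > 0"
  shows "mollify \<phi> \<epsilon> (G I) = cube_average (- I) (\<lambda>K. mollify \<phi> \<epsilon> (G (I \<union> K)))"
  using cube_average_mixed_family[OF mixed_family_mollify[OF assms weak], of I "- I"] by (simp add: fun_eq_iff)

lemma mollify_continuous: "mollifier \<phi> \<Longrightarrow> \<epsilon> > 0 \<Longrightarrow> continuous_on UNIV (mollify \<phi> \<epsilon> (G J))"
  using mixed_family_continuous[OF mixed_family_mollify[OF _ _ weak], of \<phi> \<epsilon> J] by simp

lemma mollify_mixed_deriv:
  assumes "mollifier \<phi>" "\<epsilon> > 0"
  shows "mixed_deriv I (mollify \<phi> \<epsilon> (G {})) = mollify \<phi> \<epsilon> (G I)"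
  using mixed_family_mixed_deriv[OF mixed_family_mollify[OF assms weak]] .

text \<open>
  This identifies the trace: \<open>place I x\<close> parametrizes the face, and the left-hand side is the \<open>L_q\<close>
  distance on it between the mollified derivative and \<open>face_trace\<close>.
\<close>
lemma face_trace_limit:
  assumes \<phi>: "mollifier \<phi>" and q: "q \<ge> 1"
    and fin: "\<And>J a b. (\<integral>\<^sup>+x\<in>cbox a b. ennreal (\<bar>G J x\<bar> powr q) \<partial>lborel) < \<infinity>"
  shows "((\<lambda>\<epsilon>. \<integral>\<^sup>+s. ennreal (\<bar>mollify \<phi> \<epsilon> (G I) (place I x s) - face_trace I (place I x s)\<bar> powr q) \<partial>box_measure a b I)
    \<longlongrightarrow> 0) (at_right 0)"
proof -
  let ?C = "ennreal (card (Pow (- I)) powr q)" and ?Q = "cbox (place I x a) (place I (x + 1) b)"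
  let ?B = "\<lambda>\<epsilon> K. \<integral>\<^sup>+y\<in>?Q. ennreal (\<bar>mollify \<phi> \<epsilon> (G (I \<union> K)) y - G (I \<union> K) y\<bar> powr q) \<partial>lborel"
  have "((\<lambda>\<epsilon>. ?C * (\<Sum>K\<in>Pow (- I). ?B \<epsilon> K)) \<longlongrightarrow> 0) (at_right 0)"
    by (intro tendsto_sum_cmult_zero mollify_tendsto \<phi> borel q fin) simp
  moreover have "\<forall>\<^sub>F \<epsilon> in at_right 0. (\<integral>\<^sup>+s. ennreal (\<bar>mollify \<phi> \<epsilon> (G I) (place I x s) - face_trace I (place I x s)\<bar> powr q) \<partial>box_measure a b I)
      \<le> ?C * (\<Sum>K\<in>Pow (- I). ?B \<epsilon> K)"
    using eventually_at_right_less[of "0::real"]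
  proof eventually_elim
    case (elim \<epsilon>)
    have "(\<integral>\<^sup>+s. ennreal (\<bar>cube_average (- I) (\<lambda>K. G (I \<union> K)) (place I x s)
        - cube_average (- I) (\<lambda>K. mollify \<phi> \<epsilon> (G (I \<union> K))) (place I x s)\<bar> powr q) \<partial>box_measure a b I)
      \<le> ?C * (\<Sum>K\<in>Pow (- I). \<integral>\<^sup>+y\<in>?Q. ennreal (\<bar>G (I \<union> K) y - mollify \<phi> \<epsilon> (G (I \<union> K)) y\<bar> powr q) \<partial>lborel)"
      by (rule face_cube_average_le[OF borel mollify_continuous[OF \<phi> elim] q])
    then show ?case
      by (simp add: face_trace_def mollify_cube_average[OF \<phi> elim, of I, symmetric] abs_minus_commute)
  qed
  ultimately show ?thesis by (rule tendsto_zero_ennreal_mono)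
qed

lemma mollify_place_integrable:
  "mollifier \<phi> \<Longrightarrow> \<epsilon> > 0 \<Longrightarrow> integrable (box_measure a b I) (\<lambda>s. mollify \<phi> \<epsilon> (G I) (place I x s))"
  by (intro integrable_place mollify_continuous)

lemma face_trace_place_measurable:
  "(\<lambda>s. face_trace I (place I x s)) \<in> borel_measurable (box_measure a b I)"
  by measurable

lemma face_trace_integral_limit:
  assumes \<phi>: "mollifier \<phi>"
  shows "integrable (box_measure a b I) (\<lambda>s. face_trace I (place I x s))"
    and "((\<lambda>\<epsilon>. LINT s|box_measure a b I. mollify \<phi> \<epsilon> (G I) (place I x s)) \<longlongrightarrow>
      (LINT s|box_measure a b I. face_trace I (place I x s))) (at_right 0)"
proof -
  have lim: "((\<lambda>\<epsilon>. \<integral>\<^sup>+s. ennreal \<bar>mollify \<phi> \<epsilon> (G I) (place I x s) - face_trace I (place I x s)\<bar> \<partial>box_measure a b I)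
    \<longlongrightarrow> 0) (at_right 0)"
    using face_trace_limit[OF \<phi> order_refl locally_L1, where I = I and x = x and a = a and b = b] by simp
  have ev: "\<forall>\<^sub>F \<epsilon> in at_right 0. integrable (box_measure a b I) (\<lambda>s. mollify \<phi> \<epsilon> (G I) (place I x s))"
    using eventually_at_right_less[of "0::real"] by eventually_elim (rule mollify_place_integrable[OF \<phi>])
  show "integrable (box_measure a b I) (\<lambda>s. face_trace I (place I x s))"
    "((\<lambda>\<epsilon>. LINT s|box_measure a b I. mollify \<phi> \<epsilon> (G I) (place I x s)) \<longlongrightarrow>
      (LINT s|box_measure a b I. face_trace I (place I x s))) (at_right 0)"
    using integrable_of_L1_limit[OF lim _ ev face_trace_place_measurable] by simp_all
qed

lemma mollify_pointwise_limit:
  assumes \<phi>: "mollifier \<phi>"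
  shows "((\<lambda>\<epsilon>. mollify \<phi> \<epsilon> (G {}) x) \<longlongrightarrow> face_trace {} x) (at_right 0)"
  using face_trace_integral_limit(2)[OF \<phi>, where I = "{}" and x = x]
  by (simp only: integral_box_measure_empty place_empty)

lemma newton_leibniz_face_trace:
  assumes "\<And>i. a i \<le> b i" and "\<And>i. i \<in> D \<Longrightarrow> y $ i = a i"
  shows "face_trace {} (place D y b) = (\<Sum>K\<in>Pow D. LINT s|box_measure a b K. face_trace K (place K y s))"
proof -
  obtain \<phi> :: "'n euclid \<Rightarrow> real" where \<phi>: "mollifier \<phi>" using mollifier_exists by blast
  have "((\<lambda>\<epsilon>. \<Sum>K\<in>Pow D. LINT s|box_measure a b K. mollify \<phi> \<epsilon> (G K) (place K y s)) \<longlongrightarrow>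
      (\<Sum>K\<in>Pow D. LINT s|box_measure a b K. face_trace K (place K y s))) (at_right 0)"
    by (intro tendsto_sum face_trace_integral_limit \<phi>)
  moreover have "\<forall>\<^sub>F \<epsilon> in at_right 0. (\<Sum>K\<in>Pow D. LINT s|box_measure a b K. mollify \<phi> \<epsilon> (G K) (place K y s))
      = mollify \<phi> \<epsilon> (G {}) (place D y b)"
    using eventually_at_right_less[of "0::real"]
    by eventually_elim (rule newton_leibniz_family[OF mixed_family_mollify[OF \<phi> _ weak] assms, symmetric])
  ultimately have "((\<lambda>\<epsilon>. mollify \<phi> \<epsilon> (G {}) (place D y b)) \<longlongrightarrow>
      (\<Sum>K\<in>Pow D. LINT s|box_measure a b K. face_trace K (place K y s))) (at_right 0)"
    by (rule Lim_transform_eventually)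
  from tendsto_unique[OF _ mollify_pointwise_limit[OF \<phi>] this] show ?thesis by simp
qed

text \<open>
  \<open>L_1\<close> convergence of all mixed derivatives on a box gives uniform convergence of the function
  itself. This makes \<open>face_trace {}\<close> continuous and almost everywhere equal to \<open>G {}\<close>.
\<close>
lemma mollify_locally_uniform:
  assumes \<phi>: "mollifier \<phi>"
  obtains \<beta> :: "real \<Rightarrow> ennreal" where "(\<beta> \<longlongrightarrow> 0) (at_right 0)"
    "\<And>\<epsilon> x. \<epsilon> > 0 \<Longrightarrow> x \<in> cbox c d \<Longrightarrow> ennreal \<bar>mollify \<phi> \<epsilon> (G {}) x - face_trace {} x\<bar> \<le> \<beta> \<epsilon>"
proof -
  let ?B = "\<lambda>\<epsilon> K. \<integral>\<^sup>+y\<in>cbox c (d + 1). ennreal (\<bar>mollify \<phi> \<epsilon> (G K) y - G K y\<bar> powr 1) \<partial>lborel"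
  define \<beta> where "\<beta> \<epsilon> = ennreal (2 ^ CARD('n)) * (\<Sum>K\<in>UNIV. ?B \<epsilon> K)" for \<epsilon>
  have "(\<beta> \<longlongrightarrow> 0) (at_right 0)"
    unfolding \<beta>_def by (intro tendsto_sum_cmult_zero mollify_tendsto \<phi> borel locally_L1) simp_all
  moreover have "ennreal \<bar>mollify \<phi> \<epsilon> (G {}) x - face_trace {} x\<bar> \<le> \<beta> \<epsilon>" if "\<epsilon> > 0" "x \<in> cbox c d" for \<epsilon> x
    using cube_average_diff_le[where G = G and F = "\<lambda>K. mollify \<phi> \<epsilon> (G K)", OF borel mollify_continuous[OF \<phi> that(1)] that(2)]
      fun_cong[OF mollify_cube_average[OF \<phi> that(1), of "{}"], of x]
    by (simp add: \<beta>_def face_trace_def abs_minus_commute)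
  ultimately show thesis by (rule that)
qed

lemma face_trace_continuous: "continuous_on UNIV (face_trace {})"
proof -
  obtain \<phi> :: "'n euclid \<Rightarrow> real" where \<phi>: "mollifier \<phi>" using mollifier_exists by blast
  have "continuous_on (cbox c d) (face_trace {})" for c d
  proof -
    obtain \<beta> where \<beta>: "(\<beta> \<longlongrightarrow> 0) (at_right 0)"
      "\<And>\<epsilon> x. \<epsilon> > 0 \<Longrightarrow> x \<in> cbox c d \<Longrightarrow> ennreal \<bar>mollify \<phi> \<epsilon> (G {}) x - face_trace {} x\<bar> \<le> \<beta> \<epsilon>"
      using mollify_locally_uniform[OF \<phi>] by blast
    show ?thesis
    proof (rule uniform_limit_theorem)
      show "\<forall>\<^sub>F \<epsilon> in at_right 0. continuous_on (cbox c d) (mollify \<phi> \<epsilon> (G {}))"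
        using eventually_at_right_less[of "0::real"]
        by eventually_elim (rule continuous_on_subset[OF mollify_continuous[OF \<phi>]], auto)
      show "uniform_limit (cbox c d) (\<lambda>\<epsilon>. mollify \<phi> \<epsilon> (G {})) (face_trace {}) (at_right 0)"
        unfolding uniform_limit_iff
      proof (intro allI impI)
        fix e :: real assume e: "e > 0"
        then have "\<forall>\<^sub>F \<epsilon> in at_right 0. \<beta> \<epsilon> < ennreal e" using \<beta>(1) by (intro order_tendstoD) auto
        then show "\<forall>\<^sub>F \<epsilon> in at_right 0. \<forall>x\<in>cbox c d. dist (mollify \<phi> \<epsilon> (G {}) x) (face_trace {} x) < e"
          using eventually_at_right_less[of "0::real"]
        proof eventually_elim
          case (elim \<epsilon>)
          show ?case
          proof
            fix x assume "x \<in> cbox c d"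
            then have "ennreal \<bar>mollify \<phi> \<epsilon> (G {}) x - face_trace {} x\<bar> < ennreal e"
              using \<beta>(2)[OF elim(2)] elim(1) by (meson le_less_trans)
            then show "dist (mollify \<phi> \<epsilon> (G {}) x) (face_trace {} x) < e"
              using e by (simp add: dist_real_def ennreal_less_iff)
          qed
        qed
      qed
    qed simp
  qed
  then have "isCont (face_trace {}) x" for x
    by (intro continuous_on_interior[of "cbox (x - 1) (x + 1)"]) (auto simp: interior_cbox mem_box_cart)
  then show ?thesis by (simp add: continuous_on_eq_continuous_at)
qed

lemma face_trace_AE: "AE x in lborel. face_trace {} x = G {} x"
proof -
  obtain \<phi> :: "'n euclid \<Rightarrow> real" where \<phi>: "mollifier \<phi>" using mollifier_exists by blast
  show ?thesis
  proof (rule AE_eq_of_L1_limits[where f = "\<lambda>\<epsilon>. mollify \<phi> \<epsilon> (G {})" and F = "at_right 0"])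
    show "\<forall>\<^sub>F \<epsilon> in at_right 0. mollify \<phi> \<epsilon> (G {}) \<in> borel_measurable borel"
      using eventually_at_right_less[of "0::real"]
      by eventually_elim (rule borel_measurable_continuous_onI[OF mollify_continuous[OF \<phi>]])
    fix c d :: "'n euclid"
    show "((\<lambda>\<epsilon>. \<integral>\<^sup>+x\<in>cbox c d. ennreal \<bar>mollify \<phi> \<epsilon> (G {}) x - G {} x\<bar> \<partial>lborel) \<longlongrightarrow> 0) (at_right 0)"
      using mollify_tendsto[OF \<phi> borel[of "{}"] order_refl locally_L1, of c d] by simp
    obtain \<beta> where \<beta>: "(\<beta> \<longlongrightarrow> 0) (at_right 0)"
      "\<And>\<epsilon> x. \<epsilon> > 0 \<Longrightarrow> x \<in> cbox c d \<Longrightarrow> ennreal \<bar>mollify \<phi> \<epsilon> (G {}) x - face_trace {} x\<bar> \<le> \<beta> \<epsilon>"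
      using mollify_locally_uniform[OF \<phi>] by blast
    have "((\<lambda>\<epsilon>. emeasure lborel (cbox c d) * \<beta> \<epsilon>) \<longlongrightarrow> emeasure lborel (cbox c d) * 0) (at_right 0)"
      by (intro ennreal_tendsto_cmult \<beta>) (simp add: emeasure_lborel_cbox_eq)
    then have "((\<lambda>\<epsilon>. emeasure lborel (cbox c d) * \<beta> \<epsilon>) \<longlongrightarrow> 0) (at_right 0)" by simp
    moreover have "\<forall>\<^sub>F \<epsilon> in at_right 0. (\<integral>\<^sup>+x\<in>cbox c d. ennreal \<bar>mollify \<phi> \<epsilon> (G {}) x - face_trace {} x\<bar> \<partial>lborel)
        \<le> emeasure lborel (cbox c d) * \<beta> \<epsilon>"
      using eventually_at_right_less[of "0::real"]
    proof eventually_elim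
      case (elim \<epsilon>)
      have "(\<integral>\<^sup>+x\<in>cbox c d. ennreal \<bar>mollify \<phi> \<epsilon> (G {}) x - face_trace {} x\<bar> \<partial>lborel)
          \<le> (\<integral>\<^sup>+x\<in>cbox c d. \<beta> \<epsilon> \<partial>lborel)"
        using elim \<beta>(2) by (intro nn_integral_mono) (auto simp: indicator_def)
      also have "\<dots> = emeasure lborel (cbox c d) * \<beta> \<epsilon>"
        by (simp add: nn_integral_cmult_indicator mult.commute)
      finally show ?case .
    qed
    ultimately show "((\<lambda>\<epsilon>. \<integral>\<^sup>+x\<in>cbox c d. ennreal \<bar>mollify \<phi> \<epsilon> (G {}) x - face_trace {} x\<bar> \<partial>lborel) \<longlongrightarrow> 0) (at_right 0)"
      by (rule tendsto_zero_ennreal_mono)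
  qed (auto simp: face_trace_measurable)
qed

lemma face_trace_powr_finite:
  assumes q: "q \<ge> 1"
    and fin: "\<And>J a b. (\<integral>\<^sup>+x\<in>cbox a b. ennreal (\<bar>G J x\<bar> powr q) \<partial>lborel) < \<infinity>"
  shows "(\<integral>\<^sup>+s. ennreal (\<bar>face_trace I (place I x s)\<bar> powr q) \<partial>box_measure a b I) < \<infinity>"
proof -
  have "(\<integral>\<^sup>+s. ennreal (\<bar>face_trace I (place I x s)\<bar> powr q) \<partial>box_measure a b I)
    \<le> ennreal (card (Pow (- I)) powr q) * (\<Sum>K\<in>Pow (- I).
      \<integral>\<^sup>+y. ennreal (\<bar>G (I \<union> K) y\<bar> powr q) * indicator (cbox (place I x a) (place I (x + 1) b)) y \<partial>lborel)"
    using face_cube_average_le[where G = "\<lambda>K. G (I \<union> K)" and F = "\<lambda>K x. 0" and q = q and I = I and x = x and a = a and b = b] q by (simp add: face_trace_def)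
  also have "\<dots> < \<infinity>"
    using fin by (simp add: ennreal_mult_less_top)
  finally show ?thesis .
qed

lemma face_trace_bounded:
  assumes M: "\<And>J x. \<bar>G J x\<bar> \<le> M"
  shows "\<bar>face_trace I x\<bar> \<le> (2 ^ card (- I))\<^sup>2 * M"
proof -
  let ?N = "2 ^ card (- I) :: real"
  have M0: "M \<ge> 0" using M[of "{}" 0] abs_ge_zero order_trans by blast
  interpret prob_space "unit_cube (- I)" by (rule prob_space_unit_cube)
  have "ennreal \<bar>face_trace I x\<bar> \<le> ennreal ?N * (\<Sum>K\<in>Pow (- I). \<integral>\<^sup>+s. ennreal \<bar>G (I \<union> K) (x + place (- I) 0 s)\<bar> \<partial>unit_cube (- I))"
    using cube_average_diff_powr_le[where G = "\<lambda>K. G (I \<union> K)" and F = "\<lambda>K x. 0" and q = 1 and D = "- I" and \<eta> = x]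
    by (simp add: face_trace_def card_Pow)
  also have "\<dots> \<le> ennreal ?N * (\<Sum>K\<in>Pow (- I). \<integral>\<^sup>+s. ennreal M \<partial>unit_cube (- I))"
    by (intro mult_left_mono sum_mono nn_integral_mono ennreal_leI M) simp
  also have "\<dots> = ennreal (?N * (?N * M))"
    using M0 by (simp add: emeasure_space_1 card_Pow ennreal_mult flip: ennreal_power)
  finally show ?thesis
    using M0 by (simp add: power2_eq_square mult.assoc)
qed

section \<open>Bounds for the continuous representative\<close>

lemma cbox_edge_volume:
  fixes y :: "'n euclid"
  assumes h: "h \<ge> 0"
  shows "measure lborel (cbox (place {i} y (\<lambda>_. y $ i)) (place {i} (y + 1) (\<lambda>_. y $ i + h))) = h"
proof -
  have "cbox (place {i} y (\<lambda>_. y $ i)) (place {i} (y + 1) (\<lambda>_. y $ i + h)) \<noteq> {}"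
    using h by (auto simp: interval_ne_empty_cart)
  then have "measure lborel (cbox (place {i} y (\<lambda>_. y $ i)) (place {i} (y + 1) (\<lambda>_. y $ i + h)))
      = (\<Prod>j\<in>UNIV. place {i} (y + 1) (\<lambda>_. y $ i + h) $ j - place {i} y (\<lambda>_. y $ i) $ j)"
    by (rule content_cbox_cart)
  also have "\<dots> = (\<Prod>j\<in>UNIV. if j = i then h else 1)"
    by (rule prod.cong) auto
  finally show ?thesis by simp
qed

text \<open>
  By the Newton-Leibniz formula along one edge, the increment is the integral of the trace in direction
  \<open>i\<close> over that edge. The edge and the transversal unit cube form a box of volume \<open>h\<close>, to which \<open>bound\<close>
  applies.
\<close>
lemma face_trace_edge_le:
  fixes S :: real
  assumes h: "h > 0" and S: "S \<ge> 0"
    and bound: "\<And>J a b. measure lborel (cbox a b) > 0 \<Longrightarrow>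
      (\<integral>\<^sup>+y\<in>cbox a b. ennreal \<bar>G J y\<bar> \<partial>lborel) \<le> ennreal (S * measure lborel (cbox a b) powr \<gamma>)"
  shows "\<bar>face_trace {} (y + h *\<^sub>R axis i 1) - face_trace {} y\<bar> \<le> (2 ^ CARD('n))\<^sup>2 * S * h powr \<gamma>"
proof -
  let ?D = "- {i}" and ?a = "\<lambda>_::'n. y $ i" and ?b = "\<lambda>_::'n. y $ i + h"
  let ?m = "box_measure ?a ?b {i}"
  let ?Q = "cbox (place {i} y ?a) (place {i} (y + 1) ?b)"
  let ?N = "real (card (Pow ?D))"
  have vol: "measure lborel ?Q = h" using cbox_edge_volume[of h i y] h by simp
  have pl: "place {i} y ?b = y + h *\<^sub>R axis i 1" by (auto simp: vec_eq_iff axis_def)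
  have "face_trace {} (y + h *\<^sub>R axis i 1) = (\<Sum>K\<in>Pow {i}. LINT s|box_measure ?a ?b K. face_trace K (place K y s))"
    unfolding pl[symmetric] using h by (intro newton_leibniz_face_trace) auto
  also have "\<dots> = face_trace {} y + (LINT s|?m. face_trace {i} (place {i} y s))"
  proof -
    have "Pow {i} = {{}, {i}}" by auto
    then have "(\<Sum>K\<in>Pow {i}. f K) = f {} + f {i}" for f :: "'n set \<Rightarrow> real" by simp
    then show ?thesis by (simp only: integral_box_measure_empty place_empty)
  qed
  finally have "\<bar>face_trace {} (y + h *\<^sub>R axis i 1) - face_trace {} y\<bar> = \<bar>LINT s|?m. face_trace {i} (place {i} y s)\<bar>"
    by simp
  also have "\<dots> \<le> (LINT s|?m. \<bar>face_trace {i} (place {i} y s)\<bar>)"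
    by (rule integral_abs_bound)
  finally have "ennreal \<bar>face_trace {} (y + h *\<^sub>R axis i 1) - face_trace {} y\<bar>
      \<le> ennreal (LINT s|?m. \<bar>face_trace {i} (place {i} y s)\<bar>)" by (rule ennreal_leI)
  also have "\<dots> = (\<integral>\<^sup>+s. ennreal \<bar>face_trace {i} (place {i} y s)\<bar> \<partial>?m)"
  proof (rule nn_integral_eq_integral[symmetric])
    obtain \<phi> :: "'n euclid \<Rightarrow> real" where "mollifier \<phi>" using mollifier_exists by blast
    then show "integrable ?m (\<lambda>s. \<bar>face_trace {i} (place {i} y s)\<bar>)"
      by (intro integrable_abs face_trace_integral_limit)
  qed simp
  also have "\<dots> \<le> ennreal ?N * (\<Sum>K\<in>Pow ?D. \<integral>\<^sup>+z\<in>?Q. ennreal \<bar>G ({i} \<union> K) z\<bar> \<partial>lborel)"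
    using face_cube_average_le[where G = "\<lambda>K. G ({i} \<union> K)" and F = "\<lambda>K x. 0" and q = 1 and I = "{i}" and x = y and a = ?a and b = ?b] by (simp add: face_trace_def)
  also have "\<dots> \<le> ennreal ?N * (\<Sum>K\<in>Pow ?D. ennreal (S * h powr \<gamma>))"
    using bound[of "place {i} y ?a" "place {i} (y + 1) ?b"] h unfolding vol by (intro mult_left_mono sum_mono) auto
  also have "\<dots> = ennreal (?N * (?N * (S * h powr \<gamma>)))"
    using S by (simp add: ennreal_mult ennreal_of_nat_eq_real_of_nat)
  finally have "\<bar>face_trace {} (y + h *\<^sub>R axis i 1) - face_trace {} y\<bar> \<le> ?N * (?N * (S * h powr \<gamma>))"
    using S by (subst (asm) ennreal_le_iff) auto
  also have "\<dots> \<le> 2 ^ CARD('n) * (2 ^ CARD('n) * (S * h powr \<gamma>))"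
  proof -
    have "card ?D \<le> CARD('n)" by (rule card_mono) auto
    then have "?N \<le> 2 ^ CARD('n)" by (simp add: card_Pow)
    then show ?thesis using S by (intro mult_mono mult_nonneg_nonneg) auto
  qed
  finally show ?thesis by (simp add: power2_eq_square mult_ac)
qed

lemma face_trace_sup_le:
  fixes S :: real
  assumes S: "S \<ge> 0"
    and bound: "\<And>J a b. measure lborel (cbox a b) > 0 \<Longrightarrow>
      (\<integral>\<^sup>+y\<in>cbox a b. ennreal \<bar>G J y\<bar> \<partial>lborel) \<le> ennreal (S * measure lborel (cbox a b) powr \<gamma>)"
  shows "\<bar>face_trace {} y\<bar> \<le> (2 ^ CARD('n))\<^sup>2 * S"
proof -
  have "cbox y (y + 1) \<noteq> {}" by (auto simp: interval_ne_empty_cart)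
  then have vol: "measure lborel (cbox y (y + 1)) = 1" by (subst content_cbox_cart) auto
  have "ennreal \<bar>face_trace {} y\<bar> \<le> ennreal (2 ^ CARD('n)) * (\<Sum>K\<in>UNIV. \<integral>\<^sup>+z\<in>cbox y (y + 1). ennreal \<bar>G K z\<bar> \<partial>lborel)"
    using cube_average_diff_le[where G = G and F = "\<lambda>K x. 0" and x = y and c = y and d = y] by (simp add: face_trace_def mem_box_cart)
  also have "\<dots> \<le> ennreal (2 ^ CARD('n)) * (\<Sum>K\<in>(UNIV :: 'n set set). ennreal S)"
    using bound[of y "y + 1"] unfolding vol by (intro mult_left_mono sum_mono) auto
  also have "\<dots> = ennreal (2 ^ CARD('n) * (2 ^ CARD('n) * S))"
    using S by (simp add: ennreal_mult card_UNIV_set flip: ennreal_power)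
  finally show ?thesis
    using S by (subst (asm) ennreal_le_iff) (auto simp: power2_eq_square mult_ac)
qed

text \<open>
  Move from \<open>y'\<close> to \<open>y\<close> along the coordinate directions, one at a time; there are \<open>CARD('n)\<close> edges,
  none longer than the distance of the two points.
\<close>
lemma face_trace_hoelder:
  fixes S :: real
  assumes S: "S \<ge> 0" and \<gamma>: "\<gamma> \<ge> 0"
    and bound: "\<And>J a b. measure lborel (cbox a b) > 0 \<Longrightarrow>
      (\<integral>\<^sup>+y\<in>cbox a b. ennreal \<bar>G J y\<bar> \<partial>lborel) \<le> ennreal (S * measure lborel (cbox a b) powr \<gamma>)"
  shows "\<bar>face_trace {} y - face_trace {} y'\<bar> \<le> CARD('n) * ((2 ^ CARD('n))\<^sup>2 * S) * norm (y - y') powr \<gamma>"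
proof -
  let ?v = "face_trace {}" and ?c = "(2 ^ CARD('n))\<^sup>2 * S * norm (y - y') powr \<gamma>"
  have c0: "?c \<ge> 0" using S by simp
  have edge: "\<bar>?v (z + t *\<^sub>R axis i 1) - ?v z\<bar> \<le> ?c" if t: "\<bar>t\<bar> \<le> norm (y - y')" for z t i
  proof -
    have pos: "\<bar>?v (z + h *\<^sub>R axis i 1) - ?v z\<bar> \<le> ?c" if "0 < h" "h \<le> norm (y - y')" for h z
    proof -
      have "\<bar>?v (z + h *\<^sub>R axis i 1) - ?v z\<bar> \<le> (2 ^ CARD('n))\<^sup>2 * S * h powr \<gamma>"
        by (rule face_trace_edge_le[OF that(1) S bound])
      also have "\<dots> \<le> ?c" using that S \<gamma> by (intro mult_left_mono powr_mono2) auto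
      finally show ?thesis .
    qed
    consider "t > 0" | "t = 0" | "t < 0" by linarith
    then show ?thesis
    proof cases
      case 3
      have "\<bar>?v (z + t *\<^sub>R axis i 1 + (- t) *\<^sub>R axis i 1) - ?v (z + t *\<^sub>R axis i 1)\<bar> \<le> ?c"
        using 3 t by (intro pos) auto
      then show ?thesis by (simp add: abs_minus_commute)
    qed (use pos t c0 in auto)
  qed
  have "\<bar>?v (place A y' (vec_nth y)) - ?v y'\<bar> \<le> card A * ?c" for A
    using finite[of A]
  proof (induction A rule: finite_induct)
    case (insert i A)
    let ?z = "place A y' (vec_nth y)"
    have "place (insert i A) y' (vec_nth y) = ?z + (y $ i - y' $ i) *\<^sub>R axis i 1"
      using insert.hyps by (auto simp: vec_eq_iff axis_def)
    moreover have "\<bar>y $ i - y' $ i\<bar> \<le> norm (y - y')"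
      using component_le_norm_cart[of "y - y'" i] by simp
    ultimately have "\<bar>?v (place (insert i A) y' (vec_nth y)) - ?v ?z\<bar> \<le> ?c" using edge by simp
    then show ?case using insert by (simp add: algebra_simps)
  qed simp
  from this[of UNIV] have "\<bar>?v y - ?v y'\<bar> \<le> CARD('n) * ?c"
    by (simp add: place_def)
  then show ?thesis by (simp add: mult_ac)
qed

end

section \<open>Functions with mixed derivatives in Lp\<close>

lemma enn2real_ge_1: "1 \<le> p \<Longrightarrow> p \<noteq> \<infinity> \<Longrightarrow> 1 \<le> enn2real p"
  by (cases p) auto

lemma hoelder_exponent_nonneg: "1 \<le> p \<Longrightarrow> 0 \<le> hoelder_exponent p"
  using enn2real_ge_1[of p] by (auto simp: hoelder_exponent_def)

lemma Lp_space_cong_AE: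
  assumes f: "f \<in> Lp_space p M" and g: "g \<in> borel_measurable M" and eq: "AE x in M. f x = g x"
  shows "g \<in> Lp_space p M" "Lp_norm p M g = Lp_norm p M f"
proof -
  have fm: "f \<in> borel_measurable M" using f by (simp add: Lp_space_def)
  have "esssup M (\<lambda>x. ennreal \<bar>f x\<bar>) = esssup M (\<lambda>x. ennreal \<bar>g x\<bar>)"
    by (rule esssup_AE_cong) (use fm g eq in auto)
  moreover have "integrable M (\<lambda>x. \<bar>f x\<bar> powr enn2real p) \<longleftrightarrow> integrable M (\<lambda>x. \<bar>g x\<bar> powr enn2real p)"
    by (rule integrable_cong_AE) (use fm g eq in auto)
  moreover have "(LINT x|M. \<bar>f x\<bar> powr enn2real p) = (LINT x|M. \<bar>g x\<bar> powr enn2real p)"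
    by (rule integral_cong_AE) (use fm g eq in auto)
  ultimately show "g \<in> Lp_space p M" "Lp_norm p M g = Lp_norm p M f"
    using f g by (auto simp: Lp_space_def Lp_norm_def)
qed

lemma Lp_norm_nonneg: "0 \<le> Lp_norm p M f"
  by (simp add: Lp_norm_def)

lemma Lp_norm_powr:
  assumes f: "f \<in> Lp_space p M" and p: "p \<noteq> \<infinity>" "1 \<le> p"
  shows "(\<integral>\<^sup>+x. ennreal (\<bar>f x\<bar> powr enn2real p) \<partial>M) = ennreal (Lp_norm p M f powr enn2real p)"
proof -
  have q: "1 \<le> enn2real p" by (rule enn2real_ge_1[OF p(2,1)])
  have int: "integrable M (\<lambda>x. \<bar>f x\<bar> powr enn2real p)" using f p by (simp add: Lp_space_def)
  then have "(\<integral>\<^sup>+x. ennreal (\<bar>f x\<bar> powr enn2real p) \<partial>M) = ennreal (LINT x|M. \<bar>f x\<bar> powr enn2real p)"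
    by (rule nn_integral_eq_integral) simp
  also have "(LINT x|M. \<bar>f x\<bar> powr enn2real p) = Lp_norm p M f powr enn2real p"
    using p q by (simp add: Lp_norm_def powr_powr)
  finally show ?thesis .
qed

lemma Lp_norm_infinity_bound:
  assumes f: "f \<in> Lp_space \<infinity> M"
  shows "AE x in M. \<bar>f x\<bar> \<le> Lp_norm \<infinity> M f"
proof -
  have fin: "esssup M (\<lambda>x. ennreal \<bar>f x\<bar>) < \<infinity>" using f by (simp add: Lp_space_def)
  have "AE x in M. ennreal \<bar>f x\<bar> \<le> esssup M (\<lambda>x. ennreal \<bar>f x\<bar>)" by (rule esssup_AE)
  then show ?thesis
  proof eventually_elim
    case (elim x)
    then have "enn2real (ennreal \<bar>f x\<bar>) \<le> enn2real (esssup M (\<lambda>x. ennreal \<bar>f x\<bar>))"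
      using fin by (intro enn2real_mono) auto
    then show ?case by (simp add: Lp_norm_def)
  qed
qed

lemma le_of_all_greater:
  fixes c X s :: real
  assumes "\<And>t. t > s \<Longrightarrow> X \<le> c * t"
  shows "X \<le> c * s"
proof (rule tendsto_lowerbound)
  show "((\<lambda>t. c * t) \<longlongrightarrow> c * s) (at_right s)" by (intro tendsto_intros)
  show "\<forall>\<^sub>F t in at_right s. X \<le> c * t"
    using eventually_at_right_less[of s] by eventually_elim (rule assms)
qed simp

text \<open>
  \<open>S\<close> stands for the norm of \<open>u\<close>. The bound for \<open>p = \<infinity>\<close> is a pointwise one, since \<open>G J\<close> is
  evaluated on null sets.
\<close>
locale Lp_weak_deriv_family = weak_deriv_family u G
  for u :: "('n::{finite,linorder}) euclid \<Rightarrow> real" and G +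
  fixes p :: ennreal and S :: real
  assumes p: "1 \<le> p" and S: "0 \<le> S"
    and sup_bound: "\<And>J x. p = \<infinity> \<Longrightarrow> \<bar>G J x\<bar> \<le> S"
    and Lp_bound: "\<And>J. p \<noteq> \<infinity> \<Longrightarrow> (\<integral>\<^sup>+x. ennreal (\<bar>G J x\<bar> powr enn2real p) \<partial>lborel) \<le> ennreal (S powr enn2real p)"
begin

abbreviation v :: "'n euclid \<Rightarrow> real" where "v \<equiv> face_trace {}"

lemma local_powr_finite:
  assumes "if p = \<infinity> then 1 \<le> q else q = enn2real p"
  shows "(\<integral>\<^sup>+x\<in>cbox a b. ennreal (\<bar>G J x\<bar> powr q) \<partial>lborel) < \<infinity>"
proof (cases "p = \<infinity>")
  case True
  have "(\<integral>\<^sup>+x\<in>cbox a b. ennreal (\<bar>G J x\<bar> powr q) \<partial>lborel)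
    \<le> (\<integral>\<^sup>+x\<in>cbox a b. ennreal (S powr q) \<partial>lborel)"
    using assms True sup_bound[OF True] by (intro nn_integral_mono mult_right_mono ennreal_leI powr_mono2) auto
  also have "\<dots> < \<infinity>"
    by (simp add: nn_integral_cmult_indicator ennreal_mult_less_top emeasure_lborel_cbox_eq)
  finally show ?thesis .
next
  case False
  have "(\<integral>\<^sup>+x\<in>cbox a b. ennreal (\<bar>G J x\<bar> powr q) \<partial>lborel) \<le> (\<integral>\<^sup>+x. ennreal (\<bar>G J x\<bar> powr q) \<partial>lborel)"
    by (intro nn_integral_mono) (auto simp: indicator_def)
  also have "\<dots> \<le> ennreal (S powr q)" using Lp_bound[OF False, of J] assms False by simp
  also have "\<dots> < \<infinity>" by simp
  finally show ?thesis .
qed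

text \<open>
  Hoelder's inequality on a box, up to the factor 2. It follows by integrating
  \<open>t \<le> s + t powr q * s powr (1 - q)\<close>. The number \<open>s\<close> has to be positive, whence \<open>S'\<close> in place of \<open>S\<close>.
\<close>
lemma cbox_integral_le_pos:
  assumes V: "measure lborel (cbox a b) > 0" and S': "S \<le> S'" "S' > 0"
  shows "(\<integral>\<^sup>+y\<in>cbox a b. ennreal \<bar>G J y\<bar> \<partial>lborel)
    \<le> ennreal (2 * S' * measure lborel (cbox a b) powr hoelder_exponent p)"
proof -
  let ?V = "measure lborel (cbox a b)"
  have eV: "emeasure lborel (cbox a b) = ennreal ?V"
    by (intro emeasure_eq_ennreal_measure) (simp add: emeasure_lborel_cbox_eq)
  show ?thesis
  proof (cases "p = \<infinity>")
    case True
    have "(\<integral>\<^sup>+y\<in>cbox a b. ennreal \<bar>G J y\<bar> \<partial>lborel)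
      \<le> (\<integral>\<^sup>+y\<in>cbox a b. ennreal S' \<partial>lborel)"
      using sup_bound[OF True] S' by (intro nn_integral_mono mult_right_mono ennreal_leI) (auto intro: order_trans)
    also have "\<dots> = ennreal (S' * ?V)"
      using S' by (simp add: nn_integral_cmult_indicator eV ennreal_mult)
    also have "\<dots> \<le> ennreal (2 * S' * ?V powr hoelder_exponent p)"
      using S' V True by (intro ennreal_leI) (simp add: hoelder_exponent_def)
    finally show ?thesis .
  next
    case False
    define q where "q = enn2real p"
    have q: "q \<ge> 1" unfolding q_def by (rule enn2real_ge_1[OF p False])
    \<comment> \<open>With this \<open>s\<close> both terms contribute \<open>S' * ?V powr (1 - 1 / q)\<close>.\<close>
    define s where "s = S' * ?V powr (- 1 / q)"
    have s: "s > 0" using S' V by (simp add: s_def)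
    have pw: "t \<le> s + t powr q * s powr (1 - q)" if t: "t \<ge> 0" for t
    proof (cases "t \<le> s")
      case False
      then have "(s / t) powr (q - 1) \<le> 1" using s q by (intro powr_le1) auto
      have "t = t powr q * t powr (1 - q)" using False s by (simp flip: powr_add)
      also have "\<dots> \<le> t powr q * s powr (1 - q)"
        using False s q by (intro mult_left_mono powr_mono2') auto
      finally show ?thesis using s by simp
    qed (use s in \<open>simp add: add_increasing2\<close>)
    have "(\<integral>\<^sup>+y\<in>cbox a b. ennreal \<bar>G J y\<bar> \<partial>lborel)
      \<le> (\<integral>\<^sup>+y. ennreal s * indicator (cbox a b) y + ennreal (\<bar>G J y\<bar> powr q) * ennreal (s powr (1 - q)) \<partial>lborel)"
    proof (rule nn_integral_mono)
      fix y
      have "ennreal \<bar>G J y\<bar> \<le> ennreal (s + \<bar>G J y\<bar> powr q * s powr (1 - q))"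
        by (intro ennreal_leI pw) simp
      also have "\<dots> = ennreal s + ennreal (\<bar>G J y\<bar> powr q) * ennreal (s powr (1 - q))"
        using s by (simp add: ennreal_mult)
      finally show "ennreal \<bar>G J y\<bar> * indicator (cbox a b) y
          \<le> ennreal s * indicator (cbox a b) y + ennreal (\<bar>G J y\<bar> powr q) * ennreal (s powr (1 - q))"
        by (auto simp: indicator_def)
    qed
    also have "\<dots> = ennreal s * ennreal ?V + (\<integral>\<^sup>+y. ennreal (\<bar>G J y\<bar> powr q) \<partial>lborel) * ennreal (s powr (1 - q))"
      by (subst nn_integral_add) (auto simp: nn_integral_cmult_indicator eV nn_integral_multc)
    also have "\<dots> \<le> ennreal s * ennreal ?V + ennreal (S' powr q) * ennreal (s powr (1 - q))"
    proof (intro add_left_mono mult_right_mono)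
      have "(\<integral>\<^sup>+y. ennreal (\<bar>G J y\<bar> powr q) \<partial>lborel) \<le> ennreal (S powr q)"
        using Lp_bound[OF False] by (simp add: q_def)
      also have "\<dots> \<le> ennreal (S' powr q)" using S S' q by (intro ennreal_leI powr_mono2) auto
      finally show "(\<integral>\<^sup>+y. ennreal (\<bar>G J y\<bar> powr q) \<partial>lborel) \<le> ennreal (S' powr q)" .
    qed simp
    also have "\<dots> = ennreal (s * ?V + S' powr q * s powr (1 - q))"
      using s by (simp add: ennreal_mult ennreal_plus)
    also have "s * ?V + S' powr q * s powr (1 - q) = 2 * S' * ?V powr hoelder_exponent p"
    proof -
      have "s * ?V = S' * (?V powr (- 1 / q) * ?V powr 1)" using V by (simp add: s_def)
      also have "\<dots> = S' * ?V powr (- 1 / q + 1)" by (simp only: powr_add)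
      also have "- 1 / q + 1 = 1 - 1 / q" by simp
      finally have 1: "s * ?V = S' * ?V powr (1 - 1 / q)" .
      have "S' powr q * s powr (1 - q) = (S' powr q * S' powr (1 - q)) * ?V powr (- 1 / q * (1 - q))"
        using S' V by (simp add: s_def powr_mult powr_powr)
      also have "S' powr q * S' powr (1 - q) = S'" using S' by (simp flip: powr_add)
      also have "- 1 / q * (1 - q) = 1 - 1 / q" using q by (simp add: field_simps)
      finally show ?thesis using 1 False by (simp add: hoelder_exponent_def q_def)
    qed
    finally show ?thesis .
  qed
qed

lemma v_bounded: "\<bar>v y\<bar> \<le> (2 * (2 ^ CARD('n))\<^sup>2) * S"
proof (rule le_of_all_greater)
  fix t assume t: "t > S"
  have "\<bar>v y\<bar> \<le> (2 ^ CARD('n))\<^sup>2 * (2 * t)"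
    by (rule face_trace_sup_le[OF _ cbox_integral_le_pos]) (use t S in auto)
  then show "\<bar>v y\<bar> \<le> (2 * (2 ^ CARD('n))\<^sup>2) * t" by (simp add: mult_ac)
qed

lemma v_hoelder:
  "\<bar>v y - v y'\<bar> \<le> (2 * CARD('n) * (2 ^ CARD('n))\<^sup>2 * norm (y - y') powr hoelder_exponent p) * S"
proof (rule le_of_all_greater)
  fix t assume t: "t > S"
  have "\<bar>v y - v y'\<bar> \<le> CARD('n) * ((2 ^ CARD('n))\<^sup>2 * (2 * t)) * norm (y - y') powr hoelder_exponent p"
    by (rule face_trace_hoelder[OF _ hoelder_exponent_nonneg[OF p] cbox_integral_le_pos]) (use t S in auto)
  then show "\<bar>v y - v y'\<bar> \<le> (2 * CARD('n) * (2 ^ CARD('n))\<^sup>2 * norm (y - y') powr hoelder_exponent p) * t"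
    by (simp add: mult_ac)
qed

definition embedding_constant :: real where
  "embedding_constant = 2 * (2 ^ CARD('n))\<^sup>2 + 2 * CARD('n) * (2 ^ CARD('n))\<^sup>2"

lemma hoelder_quotient_le:
  "y \<noteq> y' \<Longrightarrow> \<bar>v y - v y'\<bar> / norm (y - y') powr hoelder_exponent p \<le> 2 * CARD('n) * (2 ^ CARD('n))\<^sup>2 * S"
  using v_hoelder[of y y'] by (simp add: pos_divide_le_eq mult_ac)

lemma v_hoelder_space: "v \<in> hoelder_space (hoelder_exponent p)"
proof -
  have "bounded (range v)" using v_bounded by (auto simp: bounded_iff)
  then have "v \<in> bcontfun" using face_trace_continuous by (simp add: bcontfun_def)
  moreover have "bdd_above ((\<lambda>(y, y'). \<bar>v y - v y'\<bar> / norm (y - y') powr hoelder_exponent p) ` {(y, y'). y \<noteq> y'})"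
    by (rule bdd_aboveI2[where M = "2 * CARD('n) * (2 ^ CARD('n))\<^sup>2 * S"]) (use hoelder_quotient_le in auto)
  ultimately show ?thesis by (simp add: hoelder_space_def)
qed

lemma v_hoelder_norm: "hoelder_norm (hoelder_exponent p) v \<le> embedding_constant * S"
proof -
  have "(SUP y. \<bar>v y\<bar>) \<le> 2 * (2 ^ CARD('n))\<^sup>2 * S"
    by (rule cSUP_least) (use v_bounded in auto)
  moreover have "(SUP (y, y')\<in>{(y, y'). y \<noteq> y'}. \<bar>v y - v y'\<bar> / norm (y - y') powr hoelder_exponent p)
      \<le> 2 * CARD('n) * (2 ^ CARD('n))\<^sup>2 * S"
  proof (rule cSUP_least)
    have "(0 :: 'n euclid) \<noteq> 1" by (simp add: vec_eq_iff)
    then show "{(y, y'). (y :: 'n euclid) \<noteq> y'} \<noteq> {}" by blast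
  qed (use hoelder_quotient_le in auto)
  ultimately show ?thesis by (simp add: hoelder_norm_def embedding_constant_def algebra_simps)
qed

lemma face_trace_powr_integrable:
  assumes q: "if p = \<infinity> then 1 \<le> q else q = enn2real p" and x: "\<And>i. x $ i \<le> x' $ i"
  shows "integrable (face_measure I x x') (\<lambda>\<eta>. \<bar>face_trace I \<eta>\<bar> powr q)"
proof -
  have q1: "1 \<le> q" using q enn2real_ge_1[OF p] by (auto split: if_splits)
  have "integrable (box_measure (vec_nth x) (vec_nth x') I) (\<lambda>s. \<bar>face_trace I (place I x s)\<bar> powr q)"
    by (rule integrableI_bounded) (use face_trace_powr_finite[OF q1 local_powr_finite[OF q]] in auto)
  then show ?thesis by (subst integrable_face_measure[OF x]) auto
qed

lemma face_trace_Lp: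
  assumes x: "\<And>i. x $ i \<le> x' $ i"
  shows "face_trace I \<in> Lp_space p (face_measure I x x')"
proof (cases "p = \<infinity>")
  case True
  have [measurable]: "face_trace I \<in> borel_measurable (face_measure I x x')"
    by (intro borel_measurable_face_measure face_trace_measurable)
  have "esssup (face_measure I x x') (\<lambda>\<eta>. ennreal \<bar>face_trace I \<eta>\<bar>) \<le> ennreal ((2 ^ card (- I))\<^sup>2 * S)"
    by (rule esssup_I) (auto intro!: AE_I2 ennreal_leI face_trace_bounded sup_bound[OF True])
  also have "\<dots> < \<infinity>" by simp
  finally show ?thesis using True by (simp add: Lp_space_def)
next
  case False
  then show ?thesis
    using face_trace_powr_integrable[of "enn2real p", OF _ x] borel_measurable_face_measure[OF face_trace_measurable]
    by (simp add: Lp_space_def)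
qed

lemma mollify_v:
  assumes \<phi>: "mollifier \<phi>" and \<epsilon>: "\<epsilon> > 0"
  shows "mixed_deriv I (mollify \<phi> \<epsilon> v) = mollify \<phi> \<epsilon> (G I)"
proof -
  have "mollify \<phi> \<epsilon> v = mollify \<phi> \<epsilon> (G {})"
    unfolding mollify_eq_conv
    by (rule conv_cong_AE)
      (auto intro!: measurable_completion AE_completion face_trace_AE face_trace_measurable borel
        kernel_measurable[OF kernel_rescaled[OF \<phi> \<epsilon>]])
  then show ?thesis by (simp add: mollify_mixed_deriv[OF \<phi> \<epsilon>])
qed

text \<open>
  For \<open>p = \<infinity>\<close> every finite exponent \<open>r\<close> is admitted: bounded functions are locally in \<open>L_r\<close>.
\<close>
lemma face_trace_tendsto_Lp:
  assumes \<phi>: "mollifier \<phi>" and r: "r \<noteq> \<infinity>" "1 \<le> r" "p \<noteq> \<infinity> \<Longrightarrow> r = p"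
    and x: "\<And>i. x $ i \<le> x' $ i"
  shows "tendsto_Lp r (face_measure I x x') (\<lambda>\<epsilon>. mixed_deriv I (mollify \<phi> \<epsilon> v)) (face_trace I) (at_right 0)"
proof -
  let ?M = "face_measure I x x'" and ?B = "box_measure (vec_nth x) (vec_nth x') I"
  define q where "q = enn2real r"
  have q1: "1 \<le> q" unfolding q_def by (rule enn2real_ge_1[OF r(2,1)])
  have q: "if p = \<infinity> then 1 \<le> q else q = enn2real p" using q1 r by (simp add: q_def)
  have m: "mollify \<phi> \<epsilon> (G I) \<in> borel_measurable borel" if "\<epsilon> > 0" for \<epsilon>
    by (rule borel_measurable_continuous_onI[OF mollify_continuous[OF \<phi> that]])
  have "\<forall>\<^sub>F \<epsilon> in at_right 0. mixed_deriv I (mollify \<phi> \<epsilon> v) \<in> Lp_space r ?M"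
    using eventually_at_right_less[of "0::real"]
  proof eventually_elim
    case (elim \<epsilon>)
    have "integrable ?B (\<lambda>s. \<bar>mollify \<phi> \<epsilon> (G I) (place I x s)\<bar> powr q)"
      using q1 by (intro integrable_place[where f = "\<lambda>\<eta>. \<bar>mollify \<phi> \<epsilon> (G I) \<eta>\<bar> powr q"] continuous_on_powr'
          continuous_intros mollify_continuous[OF \<phi> elim]) auto
    then have "integrable ?M (\<lambda>\<eta>. \<bar>mollify \<phi> \<epsilon> (G I) \<eta>\<bar> powr q)"
      using m[OF elim] by (subst integrable_face_measure[OF x]) auto
    then show ?case
      using r borel_measurable_face_measure[OF m[OF elim]]
      by (simp add: mollify_v[OF \<phi> elim] Lp_space_def q_def)
  qed
  moreover have "face_trace I \<in> Lp_space r ?M"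
    using face_trace_powr_integrable[OF q x] r borel_measurable_face_measure[OF face_trace_measurable]
    by (simp add: Lp_space_def q_def)
  moreover have "((\<lambda>\<epsilon>. Lp_norm r ?M (\<lambda>\<eta>. mixed_deriv I (mollify \<phi> \<epsilon> v) \<eta> - face_trace I \<eta>)) \<longlongrightarrow> 0) (at_right 0)"
  proof -
    let ?N = "\<lambda>\<epsilon>. \<integral>\<^sup>+s. ennreal (\<bar>mollify \<phi> \<epsilon> (G I) (place I x s) - face_trace I (place I x s)\<bar> powr q) \<partial>?B"
    have "(?N \<longlongrightarrow> 0) (at_right 0)"
      by (rule face_trace_limit[OF \<phi> q1 local_powr_finite[OF q]])
    then have "((\<lambda>\<epsilon>. enn2real (?N \<epsilon>)) \<longlongrightarrow> 0) (at_right 0)"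
      using tendsto_enn2real[of ?N 0] by simp
    then have "((\<lambda>\<epsilon>. enn2real (?N \<epsilon>) powr (1 / q)) \<longlongrightarrow> 0) (at_right 0)"
      by (rule tendsto_zero_powrI[OF _ tendsto_const]) (use q1 in auto)
    moreover have "\<forall>\<^sub>F \<epsilon> in at_right 0. enn2real (?N \<epsilon>) powr (1 / q)
        = Lp_norm r ?M (\<lambda>\<eta>. mixed_deriv I (mollify \<phi> \<epsilon> v) \<eta> - face_trace I \<eta>)"
      using eventually_at_right_less[of "0::real"]
    proof eventually_elim
      case (elim \<epsilon>)
      note m[OF elim, measurable]
      have "(LINT \<eta>|?M. \<bar>mollify \<phi> \<epsilon> (G I) \<eta> - face_trace I \<eta>\<bar> powr q)
          = enn2real (\<integral>\<^sup>+\<eta>. ennreal (\<bar>mollify \<phi> \<epsilon> (G I) \<eta> - face_trace I \<eta>\<bar> powr q) \<partial>?M)"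
        by (rule integral_eq_nn_integral) (auto intro!: borel_measurable_face_measure)
      also have "\<dots> = enn2real (?N \<epsilon>)"
        by (subst nn_integral_face_measure[OF x]) auto
      finally show ?case
        using r by (simp add: mollify_v[OF \<phi> elim] Lp_norm_def q_def)
    qed
    ultimately show ?thesis by (rule Lim_transform_eventually)
  qed
  ultimately show ?thesis by (simp add: tendsto_Lp_def)
qed

lemma face_trace_is_trace:
  assumes x: "\<And>i. x $ i \<le> x' $ i"
  shows "is_trace p I v x x' (face_trace I)"
  unfolding is_trace_def
  using face_trace_tendsto_Lp[OF _ _ _ _ x] p by auto

lemma v_AE: "AE y in lebesgue. v y = u y"
proof -
  have "locally_integrable u" using weak by (simp add: has_weak_deriv_def)
  then have "AE y in lebesgue. u y = G {} y"
    by (rule has_weak_deriv_unique[OF has_weak_deriv_empty weak])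
  moreover have "AE y in lebesgue. v y = G {} y" by (rule AE_completion[OF face_trace_AE])
  ultimately show ?thesis by eventually_elim simp
qed

lemma weak_deriv_v:
  "weak_deriv I v \<in> borel_measurable lebesgue" "AE y in lebesgue. G I y = weak_deriv I v y"
proof -
  have Gm: "G I \<in> borel_measurable lebesgue" using borel by (intro measurable_completion) simp
  have vm: "v \<in> borel_measurable lebesgue" using face_trace_measurable by (intro measurable_completion) simp
  have w: "has_weak_deriv I v (G I)"
    by (rule has_weak_deriv_cong_AE[OF weak _ vm _ Gm]) (use v_AE in auto)
  then have w': "has_weak_deriv I v (weak_deriv I v)"
    unfolding weak_deriv_def by (rule someI[of "has_weak_deriv I v"])
  then show "weak_deriv I v \<in> borel_measurable lebesgue"
    by (intro locally_integrable_measurable) (simp add: has_weak_deriv_def)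
  show "AE y in lebesgue. G I y = weak_deriv I v y"
    by (rule has_weak_deriv_unique[OF w w'])
qed

text \<open>
  \<open>is_face_deriv\<close> asks for the weak derivative of \<open>v\<close> on the full rectangle; it agrees with
  \<open>face_trace UNIV\<close> only almost everywhere.
\<close>

definition face_deriv :: "'n set \<Rightarrow> 'n euclid \<Rightarrow> real" where
  "face_deriv I = (if I = UNIV then weak_deriv I v else face_trace I)"

lemma face_deriv_measurable:
  "face_deriv I \<in> borel_measurable (face_measure I x x')"
proof (cases "I = UNIV")
  case True
  then show ?thesis
    unfolding face_deriv_def True face_measure_UNIV
    by (simp add: measurable_restrict_space1 weak_deriv_v)
qed (simp add: face_deriv_def borel_measurable_face_measure face_trace_measurable)

lemma face_deriv_AE: "AE \<eta> in face_measure I x x'. face_trace I \<eta> = face_deriv I \<eta>"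
proof (cases "I = UNIV")
  case True
  have "AE \<eta> in restrict_space lebesgue (cbox x x'). G UNIV \<eta> = weak_deriv UNIV v \<eta>"
    by (subst AE_restrict_space_iff) (use weak_deriv_v(2)[of UNIV] in auto)
  then show ?thesis unfolding True face_measure_UNIV face_deriv_def face_trace_UNIV by simp
qed (simp add: face_deriv_def)

lemma face_deriv_correct:
  assumes x: "\<And>i. x $ i \<le> x' $ i"
  shows "is_face_deriv p I v x x' (face_deriv I)"
    and "face_deriv I \<in> Lp_space p (face_measure I x x')"
    and "(LINT \<eta>|face_measure I x x'. face_deriv I \<eta>)
      = (LINT s|box_measure (vec_nth x) (vec_nth x') I. face_trace I (place I x s))"
proof -
  show "is_face_deriv p I v x x' (face_deriv I)"
    using face_trace_is_trace[OF x] by (simp add: is_face_deriv_def face_deriv_def)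
  show "face_deriv I \<in> Lp_space p (face_measure I x x')"
    by (rule Lp_space_cong_AE(1)[OF face_trace_Lp[OF x] face_deriv_measurable face_deriv_AE])
  have "(LINT \<eta>|face_measure I x x'. face_deriv I \<eta>) = (LINT \<eta>|face_measure I x x'. face_trace I \<eta>)"
    by (rule integral_cong_AE)
      (use face_deriv_AE[of I x x'] in \<open>auto simp: face_deriv_measurable borel_measurable_face_measure face_trace_measurable\<close>)
  also have "\<dots> = (LINT s|box_measure (vec_nth x) (vec_nth x') I. face_trace I (place I x s))"
    by (rule integral_face_measure[OF x face_trace_measurable])
  finally show "(LINT \<eta>|face_measure I x x'. face_deriv I \<eta>)
      = (LINT s|box_measure (vec_nth x) (vec_nth x') I. face_trace I (place I x s))" .
qed

lemma newton_leibniz: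
  assumes x: "\<And>i. x $ i \<le> x' $ i"
  shows "v x' - v x = (\<Sum>k=1..CARD('n). \<Sum>I | card I = k. LINT \<eta>|face_measure I x x'. face_deriv I \<eta>)"
proof -
  let ?f = "\<lambda>I. LINT \<eta>|face_measure I x x'. face_deriv I \<eta>"
  have "place UNIV x (vec_nth x') = x'" by (simp add: vec_eq_iff)
  then have "v x' = (\<Sum>I\<in>UNIV. LINT s|box_measure (vec_nth x) (vec_nth x') I. face_trace I (place I x s))"
    using newton_leibniz_face_trace[where D = UNIV and y = x and a = "vec_nth x" and b = "vec_nth x'"] x by simp
  also have "\<dots> = (LINT s|box_measure (vec_nth x) (vec_nth x') {}. v (place {} x s))
      + (\<Sum>I\<in>UNIV - {{}}. LINT s|box_measure (vec_nth x) (vec_nth x') I. face_trace I (place I x s))"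
    by (rule sum.remove) auto
  also have "(LINT s|box_measure (vec_nth x) (vec_nth x') {}. v (place {} x s)) = v x"
    by (simp only: integral_box_measure_empty place_empty)
  also have "(\<Sum>I\<in>UNIV - {{}}. LINT s|box_measure (vec_nth x) (vec_nth x') I. face_trace I (place I x s))
      = (\<Sum>I\<in>UNIV - {{}}. ?f I)"
    by (simp add: face_deriv_correct(3)[OF x])
  also have "\<dots> = (\<Sum>k\<in>{1..CARD('n)}. \<Sum>I\<in>{I \<in> UNIV - {{}}. card I = k}. ?f I)"
  proof (rule sum.group[symmetric])
    have "card I \<le> CARD('n)" for I :: "'n set" by (rule card_mono) auto
    moreover have "card I \<ge> 1" if "I \<noteq> {}" for I :: "'n set" using that by (simp add: Suc_le_eq card_gt_0_iff)
    ultimately show "card ` (UNIV - {{}} :: 'n set set) \<subseteq> {1..CARD('n)}" by (intro image_subsetI) simp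
  qed auto
  also have "\<dots> = (\<Sum>k=1..CARD('n). \<Sum>I | card I = k. ?f I)"
    by (intro sum.cong) auto
  finally show ?thesis by simp
qed

end

section \<open>Functions in the Sobolev space\<close>

lemma continuous_AE_eq:
  fixes f g :: "'a::euclidean_space \<Rightarrow> real"
  assumes "continuous_on UNIV f" "continuous_on UNIV g" "AE x in lebesgue. f x = g x"
  shows "f = g"
proof -
  have op: "open {x. f x \<noteq> g x}" by (intro open_Collect_neq assms)
  then have "{x. f x \<noteq> g x} \<in> sets lebesgue" by (simp add: borel_open)
  then have "negligible {x. f x \<noteq> g x}"
    unfolding negligible_iff_null_sets using assms(3) AE_iff_null[of lebesgue "\<lambda>x. f x = g x"] by simp
  with op have "{x. f x \<noteq> g x} = {}" using open_not_negligible by blast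
  then show ?thesis by auto
qed

definition mixed_weak_deriv :: "'n set \<Rightarrow> (('n::{finite,linorder}) euclid \<Rightarrow> real) \<Rightarrow> 'n euclid \<Rightarrow> real" where
  "mixed_weak_deriv I u = (if I = {} then u else weak_deriv I u)"

lemma S1_space_weak_deriv:
  fixes u :: "('n::{finite,linorder}) euclid \<Rightarrow> real"
  assumes u: "u \<in> S1_space p"
  shows "has_weak_deriv I u (mixed_weak_deriv I u)" "mixed_weak_deriv I u \<in> Lp_space p lebesgue"
proof -
  have ex: "\<exists>g. has_weak_deriv J u g \<and> g \<in> Lp_space p lebesgue" if "J \<noteq> {}" for J
    using u that by (simp add: S1_space_def)
  have "locally_integrable u" using ex[of UNIV] by (auto simp: has_weak_deriv_def)
  moreover have "u \<in> Lp_space p lebesgue" using u by (simp add: S1_space_def)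
  moreover have "has_weak_deriv I u (weak_deriv I u) \<and> weak_deriv I u \<in> Lp_space p lebesgue" if I: "I \<noteq> {}"
  proof
    obtain g where g: "has_weak_deriv I u g" "g \<in> Lp_space p lebesgue" using ex[OF I] by blast
    then show w: "has_weak_deriv I u (weak_deriv I u)"
      unfolding weak_deriv_def by (intro someI[of "has_weak_deriv I u"])
    show "weak_deriv I u \<in> Lp_space p lebesgue"
    proof (rule Lp_space_cong_AE(1)[OF g(2)])
      show "weak_deriv I u \<in> borel_measurable lebesgue"
        using w by (intro locally_integrable_measurable) (simp add: has_weak_deriv_def)
    qed (rule has_weak_deriv_unique[OF g(1) w])
  qed
  ultimately show "has_weak_deriv I u (mixed_weak_deriv I u)" "mixed_weak_deriv I u \<in> Lp_space p lebesgue"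
    by (auto simp: mixed_weak_deriv_def has_weak_deriv_empty)
qed

lemma S1_norm_nonneg: "0 \<le> S1_norm p u"
  by (simp add: S1_norm_def Lp_norm_nonneg sum_nonneg)

lemma Lp_norm_le_S1_norm:
  fixes u :: "('n::{finite,linorder}) euclid \<Rightarrow> real"
  assumes p: "1 \<le> p"
  shows "Lp_norm p lebesgue (mixed_weak_deriv I u) \<le> S1_norm p u"
proof -
  have mem: "f I \<le> (\<Sum>k=1..CARD('n). \<Sum>J | card J = k. f J)"
    if I: "I \<noteq> {}" and f: "\<And>J. 0 \<le> f J" for f :: "'n set \<Rightarrow> real"
  proof -
    have "f I \<le> (\<Sum>J | card J = card I. f J)"
      by (rule member_le_sum) (auto simp: f)
    also have "\<dots> \<le> (\<Sum>k=1..CARD('n). \<Sum>J | card J = k. f J)"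
    proof (rule member_le_sum[where f = "\<lambda>k. \<Sum>J | card J = k. f J"])
      show "card I \<in> {1..CARD('n)}"
        using I card_mono[of UNIV I] by (simp add: Suc_le_eq card_gt_0_iff)
    qed (auto simp: f intro: sum_nonneg)
    finally show ?thesis .
  qed
  show ?thesis
  proof (cases "p = \<infinity>")
    case True
    have "0 \<le> (\<Sum>k=1..CARD('n). \<Sum>J | card J = k. Lp_norm p lebesgue (weak_deriv J u))"
      by (intro sum_nonneg Lp_norm_nonneg)
    then show ?thesis
      using mem[of "\<lambda>J. Lp_norm p lebesgue (weak_deriv J u)", OF _ Lp_norm_nonneg] Lp_norm_nonneg[of p lebesgue u] True
      by (cases "I = {}") (simp_all add: S1_norm_def mixed_weak_deriv_def add_increasing)
  next
    case False
    define q where "q = enn2real p"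
    have q: "1 \<le> q" unfolding q_def by (rule enn2real_ge_1[OF p False])
    let ?t = "Lp_norm p lebesgue u powr q + (\<Sum>k=1..CARD('n). \<Sum>J | card J = k. Lp_norm p lebesgue (weak_deriv J u) powr q)"
    have "Lp_norm p lebesgue (mixed_weak_deriv I u) powr q \<le> ?t"
      using mem[of "\<lambda>J. Lp_norm p lebesgue (weak_deriv J u) powr q"]
      by (cases "I = {}") (auto simp: mixed_weak_deriv_def intro!: sum_nonneg add_increasing)
    then have "(Lp_norm p lebesgue (mixed_weak_deriv I u) powr q) powr (1 / q) \<le> ?t powr (1 / q)"
      using q by (intro powr_mono2) auto
    then show ?thesis
      using False q by (simp add: powr_powr Lp_norm_nonneg S1_norm_def q_def)
  qed
qed

text \<open>
  For \<open>p = \<infinity>\<close> the representatives are truncated at the norm, so that the bound holds everywhere and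
  hence also on the lower-dimensional slices that enter the traces.
\<close>
lemma S1_space_family:
  fixes u :: "('n::{finite,linorder}) euclid \<Rightarrow> real"
  assumes p: "1 \<le> p" and u: "u \<in> S1_space p"
  shows "\<exists>G. Lp_weak_deriv_family u G p (S1_norm p u)"
proof -
  let ?S = "S1_norm p u"
  have "\<exists>g. g \<in> borel_measurable borel \<and> (AE x in lebesgue. mixed_weak_deriv J u x = g x)
     \<and> (p = \<infinity> \<longrightarrow> (\<forall>x. \<bar>g x\<bar> \<le> ?S))" for J
  proof -
    note Lp = S1_space_weak_deriv(2)[OF u, of J]
    obtain h where h: "h \<in> borel_measurable borel" "AE x in lebesgue. mixed_weak_deriv J u x = h x"
      using borel_representative Lp by (auto simp: Lp_space_def)
    show ?thesis
    proof (cases "p = \<infinity>")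
      case True
      have "AE x in lebesgue. \<bar>mixed_weak_deriv J u x\<bar> \<le> Lp_norm p lebesgue (mixed_weak_deriv J u)"
        using Lp_norm_infinity_bound Lp True by blast
      then have "AE x in lebesgue. mixed_weak_deriv J u x = clip ?S (h x)"
        using h(2)
      proof eventually_elim
        case (elim x)
        then have "\<bar>h x\<bar> \<le> ?S" using Lp_norm_le_S1_norm[OF p, of J u] by simp
        then show ?case using elim by (auto simp: clip_def)
      qed
      moreover have "(\<lambda>x. clip ?S (h x)) \<in> borel_measurable borel" using h(1) by simp
      moreover have "\<bar>clip ?S (h x)\<bar> \<le> ?S" for x using S1_norm_nonneg[of p u] by (auto simp: clip_def)
      ultimately show ?thesis by blast
    qed (use h in blast)
  qed
  then obtain G where G: "\<And>J. G J \<in> borel_measurable borel"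
    "\<And>J. AE x in lebesgue. mixed_weak_deriv J u x = G J x" "\<And>J x. p = \<infinity> \<Longrightarrow> \<bar>G J x\<bar> \<le> ?S"
    by metis
  have Gm: "G J \<in> borel_measurable lebesgue" for J using G(1) by (intro measurable_completion) simp
  have "Lp_weak_deriv_family u G p ?S"
  proof
    show "G J \<in> borel_measurable borel" for J by (rule G)
    show "has_weak_deriv J u (G J)" for J
      by (rule has_weak_deriv_cong_AE[OF S1_space_weak_deriv(1)[OF u] _ _ G(2) Gm])
        (use u in \<open>auto simp: S1_space_def Lp_space_def\<close>)
    fix J
    assume pf: "p \<noteq> \<infinity>"
    note G' = Lp_space_cong_AE[OF S1_space_weak_deriv(2)[OF u] Gm G(2), of J]
    have "(\<integral>\<^sup>+x. ennreal (\<bar>G J x\<bar> powr enn2real p) \<partial>lborel) = (\<integral>\<^sup>+x. ennreal (\<bar>G J x\<bar> powr enn2real p) \<partial>lebesgue)"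
      by (rule nn_integral_completion[symmetric])
    also have "\<dots> = ennreal (Lp_norm p lebesgue (G J) powr enn2real p)"
      by (rule Lp_norm_powr[OF G'(1) pf p])
    also have "\<dots> \<le> ennreal (?S powr enn2real p)"
      unfolding G'(2) using Lp_norm_le_S1_norm[OF p] Lp_norm_nonneg by (intro ennreal_leI powr_mono2) auto
    finally show "(\<integral>\<^sup>+x. ennreal (\<bar>G J x\<bar> powr enn2real p) \<partial>lborel) \<le> ennreal (?S powr enn2real p)" .
  qed (use p S1_norm_nonneg G(3) in auto)
  then show ?thesis by blast
qed

theorem theorem2:
  fixes p :: ennreal
  assumes "1 \<le> p"
  shows "bounded_embedding
      (S1_space p :: (('n::{finite,linorder}) euclid \<Rightarrow> real) set) (S1_norm p)
      (hoelder_space (hoelder_exponent p)) (hoelder_norm (hoelder_exponent p)) \<and>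
    (\<forall>u \<in> (S1_space p :: ('n euclid \<Rightarrow> real) set).
      \<exists>v \<in> hoelder_space (hoelder_exponent p).
        (AE y in lebesgue. v y = u y) \<and>
        (\<forall>x x'. (\<forall>i. x $ i < x' $ i) \<longrightarrow>
          (\<exists>g :: 'n set \<Rightarrow> 'n euclid \<Rightarrow> real.
            (\<forall>I. I \<noteq> {} \<longrightarrow>
              is_face_deriv p I v x x' (g I) \<and> g I \<in> Lp_space p (face_measure I x x')) \<and>
            v x' - v x =
              (\<Sum>k=1..CARD('n). \<Sum>I | card I = k. LINT \<eta>|face_measure I x x'. g I \<eta>))))"
proof (intro conjI ballI)
  let ?C = "2 * (2 ^ CARD('n))\<^sup>2 + 2 * CARD('n) * (2 ^ CARD('n))\<^sup>2 :: real"
  have rep: "\<exists>v\<in>hoelder_space (hoelder_exponent p). AE x in lebesgue. v x = u x"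
    if u: "u \<in> S1_space p" for u :: "'n euclid \<Rightarrow> real"
  proof -
    obtain G where "Lp_weak_deriv_family u G p (S1_norm p u)" using S1_space_family[OF assms u] by blast
    then interpret Lp_weak_deriv_family u G p "S1_norm p u" .
    show ?thesis using v_hoelder_space v_AE by blast
  qed
  have norm: "hoelder_norm (hoelder_exponent p) w \<le> ?C * S1_norm p u"
    if u: "u \<in> S1_space p" and w: "w \<in> hoelder_space (hoelder_exponent p)" "AE x in lebesgue. w x = u x"
    for u w :: "'n euclid \<Rightarrow> real"
  proof -
    obtain G where "Lp_weak_deriv_family u G p (S1_norm p u)" using S1_space_family[OF assms u] by blast
    then interpret Lp_weak_deriv_family u G p "S1_norm p u" .
    have "w = v"
    proof (rule continuous_AE_eq)
      show "continuous_on UNIV w" using w(1) by (simp add: hoelder_space_def bcontfun_def)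
      show "AE x in lebesgue. w x = v x" using w(2) v_AE by eventually_elim simp
    qed (rule face_trace_continuous)
    then show ?thesis using v_hoelder_norm by (simp add: embedding_constant_def)
  qed
  show "bounded_embedding (S1_space p :: ('n euclid \<Rightarrow> real) set) (S1_norm p)
      (hoelder_space (hoelder_exponent p)) (hoelder_norm (hoelder_exponent p))"
    unfolding bounded_embedding_def using rep norm by blast
next
  fix u :: "'n euclid \<Rightarrow> real" assume u: "u \<in> S1_space p"
  obtain G where "Lp_weak_deriv_family u G p (S1_norm p u)" using S1_space_family[OF assms u] by blast
  then interpret Lp_weak_deriv_family u G p "S1_norm p u" .
  show "\<exists>v \<in> hoelder_space (hoelder_exponent p).
        (AE y in lebesgue. v y = u y) \<and>
        (\<forall>x x'. (\<forall>i. x $ i < x' $ i) \<longrightarrow>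
          (\<exists>g :: 'n set \<Rightarrow> 'n euclid \<Rightarrow> real.
            (\<forall>I. I \<noteq> {} \<longrightarrow>
              is_face_deriv p I v x x' (g I) \<and> g I \<in> Lp_space p (face_measure I x x')) \<and>
            v x' - v x =
              (\<Sum>k=1..CARD('n). \<Sum>I | card I = k. LINT \<eta>|face_measure I x x'. g I \<eta>)))"
  proof (intro bexI[of _ v] conjI allI impI)
    fix x x' :: "'n euclid" assume "\<forall>i. x $ i < x' $ i"
    then have x: "x $ i \<le> x' $ i" for i by (simp add: less_imp_le)
    show "\<exists>g :: 'n set \<Rightarrow> 'n euclid \<Rightarrow> real.
            (\<forall>I. I \<noteq> {} \<longrightarrow>
              is_face_deriv p I v x x' (g I) \<and> g I \<in> Lp_space p (face_measure I x x')) \<and>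
            v x' - v x =
              (\<Sum>k=1..CARD('n). \<Sum>I | card I = k. LINT \<eta>|face_measure I x x'. g I \<eta>)"
      using face_deriv_correct(1,2)[OF x] newton_leibniz[OF x] by blast
  qed (use v_AE v_hoelder_space in auto)
qed

end
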